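(* Let $X$ be a Banach space, let $A:D(A)\subset X\to X$ be a sectorial operator with $\operatorname{Re}\sigma(A)>0$, and let $0\le\alpha<1$. Suppose that $f:X^\alpha\to X$ is continuously differentiable and Lipschitz continuous in bounded subsets of $X^\alpha$, and that the semigroup $\{S(t):t\ge 0\}$ in $X^\alpha$ associated to the abstract parabolic problem $$\dot x+Ax=f(x),\qquad x(0)=x_0\in X^\alpha,$$ has a global attractor $\mathcal{A}$. If either $e^{-At}$ is compact for each $t>0$, or the derivative $f'(x)\in\mathscr{L}(X^\alpha,X)$ is a compact operator for each $x\in\mathcal{A}$, then $\dim_B(\mathcal{A})<\infty$.
   Context: $X^\alpha$ denotes the fractional power space associated to the sectorial operator $A$ (the domain of $A^\alpha$ with norm $\|A^\alpha\cdot\|_X$), and $e^{-At}$ is the analytic semigroup generated by $-A$. The semigroup $S(t)$ on $X^\alpha$ is given by the mild solutions $$S(t)x=e^{-At}x+\int_0^t e^{-A(t-s)}f(S(s)x)\,ds,$$ assumed to be defined for all $t\ge0$. A global attractor is a compact set $\mathcal{A}\subset X^\alpha$ that is invariant ($S(t)\mathcal{A}=\mathcal{A}$ for all $t\ge 0$) and attracts every bounded subset of $X^\alpha$. The upper box-counting dimension is taken in $X^\alpha$: $\dim_B(\mathcal{A})=\limsup_{\epsilon\to0}\frac{\log N(\mathcal{A},\epsilon)}{-\log\epsilon}$, where $N(\mathcal{A},\epsilon)$ is the minimum number of balls in $X^\alpha$ of radius $\epsilon$ needed to cover $\mathcal{A}$. *)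

theory Defs
  imports "HOL-Analysis.Analysis"
begin

text \<open>
  The Banach space \<open>X\<close> is a type \<open>'a :: banach\<close>, hence real; spectral notions are taken in its
  complexification. A complex Banach space is covered through its underlying real space: if \<open>A\<close> is
  complex linear, the complexification of the real operator \<open>A\<close> is the direct sum of \<open>A\<close> and its
  conjugate, with spectrum the union of \<open>\<sigma>(A)\<close> and its mirror image in the real axis, so that neither
  sectoriality nor \<open>Re \<sigma>(A) > 0\<close> is affected.

  An unbounded operator is a pair of a domain \<open>D\<close> and a function \<open>A\<close>, whose values outside \<open>D\<close> are
  irrelevant.
\<close>

definition op_graph :: "'a set \<Rightarrow> ('a \<Rightarrow> 'a) \<Rightarrow> ('a \<times> 'a) set"
  where "op_graph D A = (\<lambda>x. (x, A x)) ` D"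

text \<open>That the graph is a subspace says that \<open>D\<close> is a subspace and that \<open>A\<close> is linear on it.\<close>

definition closed_densely_defined :: "'a::real_normed_vector set \<Rightarrow> ('a \<Rightarrow> 'a) \<Rightarrow> bool"
  where "closed_densely_defined D A \<longleftrightarrow>
    subspace (op_graph D A) \<and> closed (op_graph D A) \<and> closure D = UNIV"

text \<open>
  The operator \<open>\<lambda> - A\<close> on the complexification: \<open>(x, y)\<close> stands for \<open>x + \<i>y\<close>. The norm on pairs is
  the library's Euclidean product norm, which is equivalent to any of the usual complex norms on the
  complexification.
\<close>

definition shifted :: "('a::real_vector \<Rightarrow> 'a) \<Rightarrow> complex \<Rightarrow> 'a \<times> 'a \<Rightarrow> 'a \<times> 'a"
  where "shifted A l = (\<lambda>(x, y).
    (Re l *\<^sub>R x - Im l *\<^sub>R y - A x, Im l *\<^sub>R x + Re l *\<^sub>R y - A y))"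

definition is_resolvent ::
  "'a::real_normed_vector set \<Rightarrow> ('a \<Rightarrow> 'a) \<Rightarrow> complex \<Rightarrow> ('a \<times> 'a \<Rightarrow> 'a \<times> 'a) \<Rightarrow> bool"
  where "is_resolvent D A l R \<longleftrightarrow> bounded_linear R \<and>
    (\<forall>z\<in>D \<times> D. R (shifted A l z) = z) \<and>
    (\<forall>w. R w \<in> D \<times> D \<and> shifted A l (R w) = w)"

definition op_spectrum :: "'a::real_normed_vector set \<Rightarrow> ('a \<Rightarrow> 'a) \<Rightarrow> complex set"
  where "op_spectrum D A = {l. \<nexists>R. is_resolvent D A l R}"

text \<open>
  Henry's convention: the resolvent set contains a sector opening to the left, so that \<open>-A\<close> is the
  generator.
\<close>

definition sectorial :: "'a::real_normed_vector set \<Rightarrow> ('a \<Rightarrow> 'a) \<Rightarrow> bool"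
  where "sectorial D A \<longleftrightarrow> closed_densely_defined D A \<and>
    (\<exists>\<phi> M a. 0 < \<phi> \<and> \<phi> < pi / 2 \<and> 1 \<le> M \<and>
      (\<forall>l. l \<noteq> of_real a \<and> \<phi> \<le> \<bar>Arg (l - of_real a)\<bar> \<longrightarrow>
        (\<exists>R. is_resolvent D A l R \<and> onorm R \<le> M / cmod (l - of_real a))))"

definition analytic_semigroup :: "(real \<Rightarrow> 'a::real_normed_vector \<Rightarrow> 'a) \<Rightarrow> bool"
  where "analytic_semigroup T \<longleftrightarrow>
    (\<forall>t\<ge>0. bounded_linear (T t)) \<and>
    (\<forall>x. T 0 x = x) \<and>
    (\<forall>s\<ge>0. \<forall>t\<ge>0. \<forall>x. T (s + t) x = T s (T t x)) \<and>
    (\<forall>x. ((\<lambda>t. T t x) \<longlongrightarrow> x) (at_right 0)) \<and>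
    (\<forall>x. \<forall>t>0. \<exists>r>0. \<exists>c :: nat \<Rightarrow> 'a. \<forall>h. \<bar>h\<bar> < r \<longrightarrow> (\<lambda>n. h ^ n *\<^sub>R c n) sums T (t + h) x)"

definition generator_graph :: "(real \<Rightarrow> 'a::real_normed_vector \<Rightarrow> 'a) \<Rightarrow> ('a \<times> 'a) set"
  where "generator_graph T =
    {(x, y). ((\<lambda>h. (1 / h) *\<^sub>R (T h x - x)) \<longlongrightarrow> y) (at_right 0)}"

text \<open>
  \<open>T\<close> is the semigroup \<open>e\<^sup>-\<^sup>A\<^sup>t\<close>; it exists whenever \<open>(D, A)\<close> is sectorial and is unique for \<open>t \<ge> 0\<close>.
\<close>

definition semigroup_generated_by_minus ::
  "'a::real_normed_vector set \<Rightarrow> ('a \<Rightarrow> 'a) \<Rightarrow> (real \<Rightarrow> 'a \<Rightarrow> 'a) \<Rightarrow> bool"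
  where "semigroup_generated_by_minus D A T \<longleftrightarrow>
    analytic_semigroup T \<and> generator_graph T = op_graph D (\<lambda>x. - A x)"

text \<open>
  Fractional powers of \<open>A\<close> (with \<open>Re \<sigma>(A) > 0\<close>), expressed through \<open>T = e\<^sup>-\<^sup>A\<^sup>t\<close> as in Henry's book:
  \<open>A\<^sup>-\<^sup>\<alpha>\<close> is \<open>1/\<Gamma>(\<alpha>)\<close> times the integral of \<open>t\<^sup>\<alpha>\<^sup>-\<^sup>1 e\<^sup>-\<^sup>A\<^sup>t\<close> over \<open>t > 0\<close> when \<open>\<alpha> > 0\<close>, and \<open>A\<^sup>0 = I\<close>;
  \<open>A\<^sup>\<alpha>\<close> is the inverse of the injective operator \<open>A\<^sup>-\<^sup>\<alpha>\<close>, with domain its range.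
\<close>

definition neg_frac_power :: "(real \<Rightarrow> 'a::banach \<Rightarrow> 'a) \<Rightarrow> real \<Rightarrow> 'a \<Rightarrow> 'a"
  where "neg_frac_power T \<alpha> x =
    (if \<alpha> = 0 then x
     else (1 / Gamma \<alpha>) *\<^sub>R integral {0..} (\<lambda>t. t powr (\<alpha> - 1) *\<^sub>R T t x))"

definition frac_domain :: "(real \<Rightarrow> 'a::banach \<Rightarrow> 'a) \<Rightarrow> real \<Rightarrow> 'a set"
  where "frac_domain T \<alpha> = range (neg_frac_power T \<alpha>)"

definition frac_power :: "(real \<Rightarrow> 'a::banach \<Rightarrow> 'a) \<Rightarrow> real \<Rightarrow> 'a \<Rightarrow> 'a"
  where "frac_power T \<alpha> = inv (neg_frac_power T \<alpha>)"

text \<open>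
  \<open>X\<^sup>\<alpha>\<close> is \<open>D(A\<^sup>\<alpha>)\<close> with the norm of \<open>A\<^sup>\<alpha> x\<close> in \<open>X\<close>. It depends on \<open>A\<close>, so it cannot be a type by
  itself; instead a type \<open>'b\<close> carries it, and \<open>J\<close> is the inclusion of \<open>X\<^sup>\<alpha>\<close> into \<open>X\<close>. The norm
  condition makes \<open>J\<close> injective. Derivatives, compactness and balls in \<open>X\<^sup>\<alpha>\<close> are then those of \<open>'b\<close>.
\<close>

definition fractional_power_space ::
  "(real \<Rightarrow> 'a::banach \<Rightarrow> 'a) \<Rightarrow> real \<Rightarrow> ('b::banach \<Rightarrow> 'a) \<Rightarrow> bool"
  where "fractional_power_space T \<alpha> J \<longleftrightarrow>
    linear J \<and> range J = frac_domain T \<alpha> \<and> (\<forall>v. norm v = norm (frac_power T \<alpha> (J v)))"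

definition mild_solution ::
  "(real \<Rightarrow> 'a::banach \<Rightarrow> 'a) \<Rightarrow> ('b::banach \<Rightarrow> 'a) \<Rightarrow> ('b \<Rightarrow> 'a) \<Rightarrow> 'b \<Rightarrow> (real \<Rightarrow> 'b) \<Rightarrow> bool"
  where "mild_solution T J f x u \<longleftrightarrow>
    continuous_on {0..} u \<and>
    (\<forall>t\<ge>0. J (u t) = T t (J x) + integral {0..t} (\<lambda>s. T (t - s) (f (u s))))"

definition global_attractor :: "(real \<Rightarrow> 'b::metric_space \<Rightarrow> 'b) \<Rightarrow> 'b set \<Rightarrow> bool"
  where "global_attractor S K \<longleftrightarrow>
    compact K \<and> (\<forall>t\<ge>0. S t ` K = K) \<and>
    (\<forall>B. bounded B \<longrightarrow> (\<forall>\<epsilon>>0. \<forall>\<^sub>F t in at_top. S t ` B \<subseteq> (\<Union>a\<in>K. ball a \<epsilon>)))"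

definition compact_operator :: "('a::real_normed_vector \<Rightarrow> 'b::real_normed_vector) \<Rightarrow> bool"
  where "compact_operator L \<longleftrightarrow>
    bounded_linear L \<and> (\<forall>B. bounded B \<longrightarrow> compact (closure (L ` B)))"

text \<open>Only meaningful for totally bounded \<open>K\<close>, in particular for compact \<open>K\<close>.\<close>

definition covering_number :: "'b::metric_space set \<Rightarrow> real \<Rightarrow> nat"
  where "covering_number K \<epsilon> =
    (LEAST n. \<exists>C. finite C \<and> card C = n \<and> K \<subseteq> (\<Union>c\<in>C. ball c \<epsilon>))"

definition upper_box_dim :: "'b::metric_space set \<Rightarrow> ereal"
  where "upper_box_dim K =
    Limsup (at_right 0) (\<lambda>\<epsilon>. ereal (ln (real (covering_number K \<epsilon>)) / - ln \<epsilon>))"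

end

theory Submission
  imports Defs "HOL-Complex_Analysis.Complex_Analysis" "HOL-Real_Asymp.Real_Asymp"
begin

text \<open>
  It suffices that for some time \<open>\<tau>\<close> there is a finite set \<open>F\<close> such that, for all \<open>x, y\<close> in the
  attractor with \<open>|y - x| \<le> r\<close> and \<open>r\<close> small, \<open>S(\<tau>)y - S(\<tau>)x\<close> is within \<open>r / 8\<close> of \<open>r F\<close>: a cover
  of the attractor by balls of radius \<open>r\<close> is then mapped by \<open>S(\<tau>)\<close> to one by balls of radius \<open>r / 2\<close>
  with at most \<open>card F\<close> times as many balls. By the variation of constants formula, \<open>S(\<tau>)y - S(\<tau>)x\<close>
  is \<open>e\<^sup>-\<^sup>A\<^sup>\<tau>(y - x)\<close> plus an integral which, up to a small contribution of times close to \<open>\<tau>\<close>, lies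
  in a compact set scaled by \<open>r\<close>, because \<open>e\<^sup>-\<^sup>A\<^sup>t\<close> is compact or because the derivative of \<open>f\<close> is. In
  the second case \<open>\<tau>\<close> is taken so large that \<open>e\<^sup>-\<^sup>A\<^sup>\<tau>\<close> is a contraction.

  The estimates for \<open>e\<^sup>-\<^sup>A\<^sup>t\<close> come from
  \<open>\<pi> t\<^sup>2 e\<^sup>-\<^sup>A\<^sup>t = \<integral> exp((c + \<i>y)t) (c + \<i>y + A)\<^sup>-\<^sup>3 dy\<close>, an absolutely convergent integral, on the lines
  \<open>c = 0\<close> and \<open>c = 1 / t\<close>. To avoid improper integrals of operators, it is used in the form of a limit
  of integrals over \<open>|y| \<le> N\<close>.
\<close>

section \<open>Integrals of vector-valued functions over half-lines\<close>

text \<open>Sectoriality and the spectral condition give a resolvent of \<open>-A\<close> of size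
  \<open>M / (1 + |l|)\<close> on the closed right half-plane, so vertical lines suffice and no
  contour has to be bent into the left half-plane. The third power serves two purposes:
  \<open>A (l + A)^-3\<close> still decays like \<open>|l|^-2\<close>, so one formula also bounds
  \<open>A e^(-At)\<close>, and the factor \<open>t^2\<close> turns into decay of order
  \<open>t^-2\<close>. On the line \<open>c = 0\<close> the exponential has modulus 1, which yields
  this decay; on \<open>c = 1 / t\<close> it has modulus \<open>e\<close> and
  \<open>|l| \<ge> 1 / t\<close>, which yields boundedness and the bound \<open>C / t\<close> for
  \<open>A e^(-At)\<close>. Quadratic decay is enough for the integrals that define the fractional
  powers and for the contraction at a late time. The flow enters only through \<open>U\<close>, the
  semigroup on \<open>X^\<alpha>\<close>, and \<open>V\<close>, the same operators from
  \<open>X\<close> to \<open>X^\<alpha>\<close>, whose norm blows up like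
  \<open>t^-\<alpha>\<close>. This singularity is the obstacle to compactness arguments near the
  final time: there the integral is merely small, by \<open>\<alpha> < 1\<close>. The derivative of
  \<open>f\<close> is compact only at points of the attractor, so all increments are linearized at
  points of it, uniformly by compactness.\<close>

lemma has_integral_at_infinity:
  fixes F :: "real \<Rightarrow> 'a::banach"
  assumes int: "\<And>b. a \<le> b \<Longrightarrow> F integrable_on {a..b}"
    and lim: "((\<lambda>b. integral {a..b} F) \<longlongrightarrow> L) at_top"
  shows "(F has_integral L) {a..}"
  unfolding has_integral_alt'
proof (intro conjI allI impI)
  fix c d :: real
  have *: "(if x \<in> {c..d} then (if x \<in> {a..} then F x else 0) else 0)
      = (if x \<in> {max a c..d} then F x else 0)" for x by auto
  have "F integrable_on {max a c..d}"
    by (cases "max a c \<le> d") (auto intro!: integrable_subinterval_real[OF int[of d]])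
  then have "(\<lambda>x. if x \<in> {max a c..d} then F x else 0) integrable_on UNIV"
    by (simp only: integrable_restrict_UNIV)
  then have "(\<lambda>x. if x \<in> {c..d} then (if x \<in> {a..} then F x else 0) else 0) integrable_on UNIV"
    by (simp only: *)
  then show "(\<lambda>x. if x \<in> {a..} then F x else 0) integrable_on cbox c d"
    by (simp only: integrable_restrict_UNIV cbox_interval)
next
  fix e :: real assume "e > 0"
  then obtain B0 where B0: "\<And>b. b \<ge> B0 \<Longrightarrow> dist (integral {a..b} F) L < e"
    using tendstoD[OF lim] by (auto simp: eventually_at_top_linorder)
  define B where "B = max 1 (max \<bar>B0\<bar> \<bar>a\<bar>) + 1"
  show "\<exists>B>0. \<forall>c d. ball 0 B \<subseteq> cbox c d \<longrightarrow>
      norm (integral (cbox c d) (\<lambda>x. if x \<in> {a..} then F x else 0) - L) < e"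
  proof (intro exI[of _ B] conjI allI impI)
    fix c d :: real assume sub: "ball 0 B \<subseteq> cbox c d"
    have "B - 1 \<in> ball 0 B" "1 - B \<in> ball 0 B" unfolding B_def by auto
    then have cd: "c \<le> 1 - B" "B - 1 \<le> d" using sub by auto
    then have ca: "c \<le> a" "d \<ge> B0" "a \<le> d" by (auto simp: B_def)
    have "integral (cbox c d) (\<lambda>x. if x \<in> {a..} then F x else 0) = integral {a..d} F"
    proof -
      have "integral {c..d} (\<lambda>x. if x \<in> {a..} then F x else 0)
          = integral UNIV (\<lambda>x. if x \<in> {c..d} then (if x \<in> {a..} then F x else 0) else 0)"
        by (simp only: integral_restrict_UNIV)
      also have "\<dots> = integral UNIV (\<lambda>x. if x \<in> {a..d} then F x else 0)"
        using ca by (intro arg_cong[where f="integral UNIV"]) auto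
      finally show ?thesis by (simp only: integral_restrict_UNIV cbox_interval)
    qed
    with B0[OF ca(2)] show "norm (integral (cbox c d) (\<lambda>x. if x \<in> {a..} then F x else 0) - L) < e"
      by (simp add: dist_norm)
  qed (simp add: B_def)
qed

text \<open>The primitive of \<open>F\<close> extends continuously to the left end point, because the primitive
  of \<open>g\<close> does; the interior form of the fundamental theorem then gives integrability.\<close>

lemma integrable_dominated_left:
  fixes F :: "real \<Rightarrow> 'a::banach"
  assumes cont: "continuous_on {a<..b} F" and g: "g integrable_on {a..b}"
    and le: "\<And>t. a < t \<Longrightarrow> t \<le> b \<Longrightarrow> norm (F t) \<le> g t"
  shows "F integrable_on {a..b}"
proof (cases "a < b")
  case False
  then consider "a = b" | "b < a" by linarith
  then show ?thesis by cases (use integrable_on_refl[of F b] in auto)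
next
  case True
  define P where "P t = integral {t..b} F" for t
  define \<gamma> where "\<gamma> t = integral {a..t} g" for t
  have Fint: "F integrable_on {s..t}" if "a < s" "t \<le> b" for s t
    using that by (intro integrable_continuous_interval continuous_on_subset[OF cont]) auto
  have gint: "g integrable_on {s..t}" if "a \<le> s" "t \<le> b" for s t
    by (rule integrable_subinterval_real[OF g]) (use that in auto)
  have diff: "norm (P s - P t) \<le> \<gamma> t - \<gamma> s" if "a < s" "s \<le> t" "t \<le> b" for s t
  proof -
    have "P s - P t = integral {s..t} F"
      unfolding P_def using Henstock_Kurzweil_Integration.integral_combine[OF _ _ Fint[of s b], of t] that
      by (simp add: algebra_simps)
    moreover have "\<gamma> t - \<gamma> s = integral {s..t} g"
      unfolding \<gamma>_def using Henstock_Kurzweil_Integration.integral_combine[OF _ _ gint[of a t], of s] that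
      by (simp add: algebra_simps)
    moreover have "norm (integral {s..t} F) \<le> integral {s..t} g"
      using that by (intro integral_norm_bound_integral Fint gint) (auto intro!: le)
    ultimately show ?thesis by simp
  qed
  have diff': "norm (P s - P t) \<le> \<bar>\<gamma> t - \<gamma> s\<bar>" if "a < s" "a < t" "s \<le> b" "t \<le> b" for s t
    using diff[of s t] diff[of t s] that
    by (cases "s \<le> t") (auto simp: norm_minus_commute)
  have \<gamma>cont: "continuous_on {a..b} \<gamma>"
    unfolding \<gamma>_def by (rule indefinite_integral_continuous_1[OF g])
  have ucont: "uniformly_continuous_on {a<..b} P"
    unfolding uniformly_continuous_on_def
  proof (intro allI impI)
    fix e :: real assume "e > 0"
    have "uniformly_continuous_on {a..b} \<gamma>"
      by (rule compact_uniformly_continuous[OF \<gamma>cont]) simp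
    then obtain d where "d > 0" and d: "\<And>s t. s \<in> {a..b} \<Longrightarrow> t \<in> {a..b} \<Longrightarrow> dist t s < d \<Longrightarrow> dist (\<gamma> t) (\<gamma> s) < e"
      using \<open>e > 0\<close> unfolding uniformly_continuous_on_def by metis
    show "\<exists>d>0. \<forall>x\<in>{a<..b}. \<forall>x'\<in>{a<..b}. dist x' x < d \<longrightarrow> dist (P x') (P x) < e"
    proof (intro exI[of _ d] conjI ballI impI)
      fix x x' assume x: "x \<in> {a<..b}" "x' \<in> {a<..b}" "dist x' x < d"
      then have "dist (\<gamma> x') (\<gamma> x) < e" by (intro d) auto
      then show "dist (P x') (P x) < e"
        using diff'[of x' x] x by (simp add: dist_norm abs_minus_commute)
    qed (rule \<open>d > 0\<close>)
  qed
  obtain Q where Q: "continuous_on (closure {a<..b}) Q" "\<And>x. x \<in> {a<..b} \<Longrightarrow> P x = Q x"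
    using uniformly_continuous_on_extension_on_closure[OF ucont]
    by (metis uniformly_continuous_imp_continuous)
  have cl: "closure {a<..b} = {a..b}" using True by simp
  have "(F has_integral (- Q b) - (- Q a)) {a..b}"
  proof (rule fundamental_theorem_of_calculus_interior)
    show "continuous_on {a..b} (\<lambda>x. - Q x)" using Q(1) cl by (auto intro: continuous_intros)
    fix x assume x: "x \<in> {a<..<b}"
    define m where "m = (a + x) / 2"
    have m: "a < m" "m < x" using x by (auto simp: m_def)
    have "((\<lambda>u. integral {m..u} F) has_vector_derivative F x) (at x within {m..b})"
      using x m by (intro integral_has_vector_derivative continuous_on_subset[OF cont]) auto
    then have "((\<lambda>u. integral {m..u} F) has_vector_derivative F x) (at x)"
      using x m by (subst (asm) at_within_interior) auto
    then have "((\<lambda>u. integral {m..u} F - P m) has_vector_derivative F x) (at x)"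
      by (auto intro!: derivative_eq_intros)
    then show "((\<lambda>x. - Q x) has_vector_derivative F x) (at x)"
    proof (rule has_vector_derivative_transform_within_open[of _ _ _ "{m<..<b}"])
      fix u assume u: "u \<in> {m<..<b}"
      have "P m = integral {m..u} F + P u" unfolding P_def
        using Henstock_Kurzweil_Integration.integral_combine[OF _ _ Fint[of m b], of u] u m by simp
      then show "integral {m..u} F - P m = - Q u"
        using Q(2)[of u] u m by simp
    qed (use x m in auto)
  qed (use True in auto)
  then show ?thesis by blast
qed

lemma integrable_dominated_right:
  fixes F :: "real \<Rightarrow> 'a::banach"
  assumes cont: "continuous_on {a..<b} F" and g: "g integrable_on {a..b}"
    and le: "\<And>t. a \<le> t \<Longrightarrow> t < b \<Longrightarrow> norm (F t) \<le> g t"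
  shows "F integrable_on {a..b}"
proof -
  have "(\<lambda>x. F (- x)) integrable_on {-b..-a}"
  proof (rule integrable_dominated_left[where g = "\<lambda>x. g (- x)"])
    show "continuous_on {-b<..-a} (\<lambda>x. F (- x))"
      by (intro continuous_on_compose2[OF cont] continuous_intros) auto
    show "(\<lambda>x. g (- x)) integrable_on {- b..- a}" using g by simp
  qed (auto intro!: le)
  then show ?thesis by simp
qed

text \<open>The integrals over \<open>{a..b}\<close> are Cauchy as \<open>b\<close> grows, because
  their differences are bounded by those of the integrals of \<open>g\<close>. Completeness gives
  the limit, and \<open>has_integral_at_infinity\<close> identifies it with the integral.\<close>

lemma integrable_dominated_half_line:
  fixes F :: "real \<Rightarrow> 'a::banach"
  assumes cont: "continuous_on {a<..} F" and g: "g integrable_on {a..}"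
    and le: "\<And>t. a < t \<Longrightarrow> norm (F t) \<le> g t"
  shows "F integrable_on {a..}"
    and "((\<lambda>b. integral {a..b} F) \<longlongrightarrow> integral {a..} F) at_top"
    and "norm (integral {a..} F) \<le> integral {a..} g"
proof -
  have gint: "g integrable_on {s..t}" if "a \<le> s" for s t
    by (rule integrable_on_subinterval[OF g]) (use that in auto)
  have Fint: "F integrable_on {s..t}" if "a \<le> s" for s t
    using that by (intro integrable_dominated_left[OF continuous_on_subset[OF cont] gint]) (auto intro!: le)
  have bnd: "norm (integral {s..t} F) \<le> integral {s..t} g" if "a \<le> s" for s t
  proof -
    \<comment> \<open>Nothing bounds \<open>F a\<close> by \<open>g a\<close>, so the majorant is
      altered at this single point.\<close>
    define g' where "g' t = (if t = a then norm (F a) else g t)" for t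
    have eq: "integral {s..t} g = integral {s..t} g'"
      by (rule integral_spike[of "{a}"]) (auto simp: g'_def)
    have "g' integrable_on {s..t}"
      by (rule integrable_spike[OF gint[of s t], of "{a}"]) (use that in \<open>auto simp: g'_def\<close>)
    then have "norm (integral {s..t} F) \<le> integral {s..t} g'"
      using that by (intro integral_norm_bound_integral Fint) (auto simp: g'_def intro!: le)
    then show ?thesis using eq by simp
  qed
  have glim: "((\<lambda>b. integral {a..b} g) \<longlongrightarrow> integral {a..} g) at_top"
  proof (rule tendstoI)
    fix e :: real assume "e > 0"
    then obtain B where "B > 0" and B: "\<And>c d. ball 0 B \<subseteq> cbox c d \<Longrightarrow>
        norm (integral (cbox c d) (\<lambda>x. if x \<in> {a..} then g x else 0) - integral {a..} g) < e"
      using integrable_integral[OF g] unfolding has_integral_alt' by meson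
    show "\<forall>\<^sub>F b in at_top. dist (integral {a..b} g) (integral {a..} g) < e"
      unfolding eventually_at_top_linorder
    proof (intro exI[of _ "max a B"] allI impI)
      fix b assume b: "max a B \<le> b"
      define c where "c = min (-B) a"
      have "integral {c..b} (\<lambda>x. if x \<in> {a..} then g x else 0)
          = integral UNIV (\<lambda>x. if x \<in> {c..b} then (if x \<in> {a..} then g x else 0) else 0)"
        by (simp only: integral_restrict_UNIV)
      also have "\<dots> = integral UNIV (\<lambda>x. if x \<in> {a..b} then g x else 0)"
        by (intro arg_cong[where f="integral UNIV"]) (auto simp: c_def fun_eq_iff)
      finally have "integral (cbox c b) (\<lambda>x. if x \<in> {a..} then g x else 0) = integral {a..b} g"
        by (simp only: integral_restrict_UNIV cbox_interval)
      moreover have "ball 0 B \<subseteq> cbox c b" using b by (auto simp: c_def)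
      ultimately show "dist (integral {a..b} g) (integral {a..} g) < e"
        using B[of c b] by (simp add: dist_norm)
    qed
  qed
  have Cau: "\<exists>N. \<forall>m\<ge>N. \<forall>n\<ge>m. norm (integral {a..m} F - integral {a..n} F) < e" if "e > 0" for e
  proof -
    have "\<forall>\<^sub>F b in at_top. dist (integral {a..b} g) (integral {a..} g) < e / 2"
      using tendstoD[OF glim, of "e/2"] that by simp
    then obtain N0 where N0: "\<And>b. b \<ge> N0 \<Longrightarrow> dist (integral {a..b} g) (integral {a..} g) < e / 2"
      unfolding eventually_at_top_linorder by blast
    show ?thesis
    proof (intro exI[of _ "max a N0"] allI impI)
      fix m n assume mn: "max a N0 \<le> m" "m \<le> n"
      have "integral {a..n} F = integral {a..m} F + integral {m..n} F"
        using Henstock_Kurzweil_Integration.integral_combine[OF _ _ Fint[of a n], of m] mn by simp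
      then have "norm (integral {a..m} F - integral {a..n} F) = norm (integral {m..n} F)"
        by (simp add: norm_minus_commute)
      also have "\<dots> \<le> integral {m..n} g" using mn by (intro bnd) auto
      also have "\<dots> = integral {a..n} g - integral {a..m} g"
        using Henstock_Kurzweil_Integration.integral_combine[OF _ _ gint[of a n], of m] mn by simp
      also have "\<dots> < e" proof -
        have "\<bar>integral {a..m} g - integral {a..} g\<bar> < e / 2" "\<bar>integral {a..n} g - integral {a..} g\<bar> < e / 2"
          using N0[of m] N0[of n] mn by (auto simp: dist_real_def)
        then show ?thesis by linarith
      qed
      finally show "norm (integral {a..m} F - integral {a..n} F) < e" .
    qed
  qed
  have "Cauchy (\<lambda>n. integral {a..real n} F)"
  proof (rule CauchyI')
    fix e :: real assume "e > 0"
    from Cau[OF this] obtain N where N: "\<And>m n. m \<ge> N \<Longrightarrow> n \<ge> m \<Longrightarrow> norm (integral {a..m} F - integral {a..n} F) < e" by blast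
    show "\<exists>M. \<forall>m\<ge>M. \<forall>n>m. dist (integral {a..real m} F) (integral {a..real n} F) < e"
      unfolding dist_norm
      by (intro exI[of _ "nat \<lceil>N\<rceil>"] allI impI N) (auto simp: nat_le_iff ceiling_le_iff)
  qed
  then obtain L where L: "(\<lambda>n. integral {a..real n} F) \<longlonglongrightarrow> L"
    using Cauchy_convergent convergent_def by blast
  have lim: "((\<lambda>b. integral {a..b} F) \<longlongrightarrow> L) at_top"
  proof (rule tendstoI)
    fix e :: real assume "e > 0"
    then obtain N where N: "\<And>m n. m \<ge> N \<Longrightarrow> n \<ge> m \<Longrightarrow> norm (integral {a..m} F - integral {a..n} F) < e/2"
      using Cau[of "e/2"] by auto
    have "dist (integral {a..b} F) L < e" if "b \<ge> N" for b
    proof -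
      have "(\<lambda>n. norm (integral {a..b} F - integral {a..real n} F)) \<longlonglongrightarrow> norm (integral {a..b} F - L)"
        by (intro tendsto_intros L)
      moreover have "\<forall>\<^sub>F n in sequentially. norm (integral {a..b} F - integral {a..real n} F) \<le> e/2"
        unfolding eventually_sequentially using that
        by (intro exI[of _ "nat \<lceil>b\<rceil>"] allI impI less_imp_le[OF N]) (auto simp: nat_le_iff ceiling_le_iff)
      ultimately have "norm (integral {a..b} F - L) \<le> e/2"
        by (rule tendsto_upperbound) simp
      then show ?thesis using \<open>e > 0\<close> by (simp add: dist_norm)
    qed
    then show "\<forall>\<^sub>F b in at_top. dist (integral {a..b} F) L < e"
      unfolding eventually_at_top_linorder by blast
  qed
  have hi: "(F has_integral L) {a..}"
    by (rule has_integral_at_infinity[OF Fint lim]) simp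
  then show "F integrable_on {a..}" by blast
  show lim': "((\<lambda>b. integral {a..b} F) \<longlongrightarrow> integral {a..} F) at_top"
    using lim hi by (simp add: integral_unique)
  show "norm (integral {a..} F) \<le> integral {a..} g"
    by (rule tendsto_le[OF _ glim tendsto_norm[OF lim']]) (simp_all add: bnd)
qed

section \<open>The Hahn-Banach theorem\<close>

definition sublinear :: "('a::real_vector \<Rightarrow> real) \<Rightarrow> bool"
  where "sublinear p \<longleftrightarrow> (\<forall>x y. p (x + y) \<le> p x + p y) \<and> (\<forall>x. \<forall>t\<ge>0. p (t *\<^sub>R x) = t * p x)"

text \<open>Subadditivity at \<open>x + - x = 0\<close>. The lower bound depends on \<open>q\<close>
  alone, which keeps infima over families of functionals below \<open>q\<close> finite.\<close>

lemma sublinear_lower: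
  assumes "sublinear p" "\<And>x. p x \<le> q x"
  shows "- q (- x) \<le> p x"
proof -
  have "p (x + - x) \<le> p x + p (- x)" "p (0 *\<^sub>R x) = 0 * p x"
    using assms(1) unfolding sublinear_def by blast+
  then show ?thesis using assms(2)[of "- x"] by simp
qed

text \<open>\<open>q\<close> is the greatest sublinear functional below \<open>p\<close> whose value
  at \<open>- v\<close> is at most \<open>- c\<close>; a linear functional below it therefore takes
  a value of at least \<open>c\<close> at \<open>v\<close>. The bound \<open>low\<close> keeps the
  infimum finite.\<close>

lemma sublinear_shift:
  fixes p :: "'a::real_vector \<Rightarrow> real"
  assumes p: "sublinear p" and v: "- p (- v) \<le> c" "c \<le> p v"
  defines "q \<equiv> \<lambda>x. INF t\<in>{0..}. p (x + t *\<^sub>R v) - t * c"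
  shows "sublinear q" and "q x \<le> p x" and "q (- v) \<le> - c"
proof -
  have add: "p (x + y) \<le> p x + p y" and hom: "t \<ge> 0 \<Longrightarrow> p (t *\<^sub>R x) = t * p x" for x y t
    using p unfolding sublinear_def by auto
  have low: "- p (- x) \<le> p (x + t *\<^sub>R v) - t * c" if "t \<ge> 0" for x t
  proof -
    have "p (t *\<^sub>R v) \<le> p (x + t *\<^sub>R v) + p (- x)" using add[of "x + t *\<^sub>R v" "- x"] by simp
    moreover have "t * c \<le> p (t *\<^sub>R v)" using that v by (simp add: hom mult_left_mono)
    ultimately show ?thesis by simp
  qed
  have bdd: "bdd_below ((\<lambda>t. p (x + t *\<^sub>R v) - t * c) ` {0..})" for x
    using low by (intro bdd_belowI2[of _ "- p (- x)"]) auto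
  have le: "q x \<le> p (x + t *\<^sub>R v) - t * c" if "t \<ge> 0" for x t
    unfolding q_def by (rule cINF_lower[OF bdd]) (use that in auto)
  have ge: "m \<le> q x" if "\<And>t. t \<ge> 0 \<Longrightarrow> m \<le> p (x + t *\<^sub>R v) - t * c" for x m
    unfolding q_def by (rule cINF_greatest) (use that in auto)
  show "q x \<le> p x" using le[of 0 x] by simp
  show "q (- v) \<le> - c" using le[of 1 "- v"] hom[of 0 v] by simp
  show "sublinear q" unfolding sublinear_def
  proof (intro conjI allI impI)
    fix x y
    have "q (x + y) - (p (x + t *\<^sub>R v) - t * c) \<le> q y" if "t \<ge> 0" for t
    proof (rule ge)
      fix s :: real assume "s \<ge> 0"
      have "q (x + y) \<le> p ((x + y) + (t + s) *\<^sub>R v) - (t + s) * c"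
        using le[of "t + s"] that \<open>s \<ge> 0\<close> by simp
      moreover have "p ((x + y) + (t + s) *\<^sub>R v) \<le> p (x + t *\<^sub>R v) + p (y + s *\<^sub>R v)"
        using add[of "x + t *\<^sub>R v" "y + s *\<^sub>R v"] by (simp add: algebra_simps)
      ultimately show "q (x + y) - (p (x + t *\<^sub>R v) - t * c) \<le> p (y + s *\<^sub>R v) - s * c"
        by (simp add: algebra_simps)
    qed
    then have "q (x + y) - q y \<le> q x" by (intro ge) (smt (verit))
    then show "q (x + y) \<le> q x + q y" by simp
  next
    fix x :: 'a and r :: real assume "0 \<le> r"
    show "q (r *\<^sub>R x) = r * q x"
    proof (cases "r = 0")
      case True
      have "0 \<le> q 0"
        by (rule ge) (use v in \<open>simp add: hom mult_left_mono\<close>)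
      moreover have "q 0 \<le> 0" using le[of 0 0] hom[of 0 v] by simp
      ultimately show ?thesis using True by simp
    next
      case False
      then have r: "r > 0" using \<open>0 \<le> r\<close> by simp
      have eq: "p (r *\<^sub>R x + t *\<^sub>R v) - t * c = r * (p (x + (t / r) *\<^sub>R v) - (t / r) * c)" for t
        using hom[of r "x + (t / r) *\<^sub>R v"] r by (simp add: algebra_simps)
      have "r * q x \<le> q (r *\<^sub>R x)"
      proof (rule ge)
        fix t :: real assume t: "0 \<le> t"
        show "r * q x \<le> p (r *\<^sub>R x + t *\<^sub>R v) - t * c"
          unfolding eq using le[of "t / r" x] r t by (intro mult_left_mono) auto
      qed
      moreover have "q (r *\<^sub>R x) / r \<le> q x"
      proof (rule ge)
        fix t :: real assume t: "0 \<le> t"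
        show "q (r *\<^sub>R x) / r \<le> p (x + t *\<^sub>R v) - t * c"
          using le[of "r * t" "r *\<^sub>R x"] eq[of "r * t"] r t by (simp add: field_simps)
      qed
      ultimately show ?thesis using r by (simp add: field_simps)
    qed
  qed
qed

text \<open>Zorn's lemma for the reversed pointwise order: the upper bound of a chain is its
  pointwise infimum.\<close>

lemma exists_minimal_sublinear:
  fixes p :: "'a::real_vector \<Rightarrow> real"
  assumes p: "sublinear p"
  obtains q where "sublinear q" "\<And>x. q x \<le> p x"
    "\<And>q' x. sublinear q' \<Longrightarrow> (\<And>y. q' y \<le> q y) \<Longrightarrow> q' x = q x"
proof -
  define A where "A = {q. sublinear q \<and> (\<forall>x. q x \<le> p x)}"
  define rel where "rel = (\<lambda>q r :: 'a \<Rightarrow> real. \<forall>x. r x \<le> q x)"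
  have "\<exists>m\<in>A. \<forall>a\<in>A. rel m a \<longrightarrow> a = m"
  proof (rule predicate_Zorn)
    show "partial_order_on A (relation_of rel A)"
    proof (rule partial_order_on_relation_ofI)
      show "rel a c" if "rel a b" "rel b c" for a b c
        using that order_trans[of "c _" "b _" "a _"] unfolding rel_def by blast
      show "a = b" if "rel a b" "rel b a" for a b
      proof
        fix x show "a x = b x" using that[unfolded rel_def, rule_format, of x] by simp
      qed
      show "rel a a" for a by (simp add: rel_def)
    qed
  next
    fix C assume "C \<in> Chains (relation_of rel A)"
    then have C: "C \<subseteq> A" "\<And>q r. q \<in> C \<Longrightarrow> r \<in> C \<Longrightarrow> rel q r \<or> rel r q"
      unfolding Chains_def relation_of_def by auto
    show "\<exists>u\<in>A. \<forall>a\<in>C. rel a u"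
    proof (cases "C = {}")
      case True
      then show ?thesis using p by (auto simp: A_def intro!: exI[of _ p])
    next
      case False
      define u where "u x = (INF q\<in>C. q x)" for x
      have bdd: "bdd_below ((\<lambda>q. q x) ` C)" for x
        using C(1) sublinear_lower[of _ p x] by (intro bdd_belowI2[of _ "- p (- x)"]) (auto simp: A_def)
      have le: "u x \<le> q x" if "q \<in> C" for q x
        unfolding u_def by (rule cINF_lower[OF bdd that])
      have ge: "m \<le> u x" if "\<And>q. q \<in> C \<Longrightarrow> m \<le> q x" for m x
        unfolding u_def by (rule cINF_greatest[OF False that])
      have add: "q (x + y) \<le> q x + q y" and hom: "t \<ge> 0 \<Longrightarrow> q (t *\<^sub>R x) = t * q x" if "q \<in> C" for q x y t
        using C(1) that unfolding A_def sublinear_def by auto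
      have "sublinear u" unfolding sublinear_def
      proof (intro conjI allI impI)
        fix x y
        have "u (x + y) - q x \<le> u y" if "q \<in> C" for q
        proof (rule ge)
          fix r assume "r \<in> C"
          \<comment> \<open>Two members of a chain are comparable, so the smaller one serves at both
            \<open>x\<close> and \<open>y\<close>. This is what makes the infimum
            subadditive.\<close>
          then have "\<exists>s\<in>C. s x \<le> q x \<and> s y \<le> r y"
            using C(2)[OF that \<open>r \<in> C\<close>] that unfolding rel_def by blast
          then obtain s where "s \<in> C" "s x \<le> q x" "s y \<le> r y" by blast
          then show "u (x + y) - q x \<le> r y" using le[of s "x + y"] add[of s x y] by linarith
        qed
        then have "u (x + y) - u y \<le> u x" by (intro ge) (smt (verit))
        then show "u (x + y) \<le> u x + u y" by simp
      next
        fix x :: 'a and t :: real assume t: "0 \<le> t"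
        show "u (t *\<^sub>R x) = t * u x"
        proof (cases "t = 0")
          case True
          obtain q where "q \<in> C" using False by blast
          have r0: "r 0 = 0" if "r \<in> C" for r using hom[OF that, of 0 0] by simp
          have "u 0 \<le> 0" using le[OF \<open>q \<in> C\<close>, of 0] r0[OF \<open>q \<in> C\<close>] by simp
          moreover have "0 \<le> u 0" by (rule ge) (simp add: r0)
          ultimately show ?thesis using True by simp
        next
          case False
          then have "t > 0" using t by simp
          have "t * u x \<le> u (t *\<^sub>R x)"
          proof (rule ge)
            fix q assume "q \<in> C"
            then show "t * u x \<le> q (t *\<^sub>R x)" using mult_left_mono[OF le[of q x], of t] hom[of q t x] \<open>t > 0\<close> by linarith
          qed
          moreover have "u (t *\<^sub>R x) / t \<le> u x"
          proof (rule ge)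
            fix q assume "q \<in> C"
            then show "u (t *\<^sub>R x) / t \<le> q x" using le[of q "t *\<^sub>R x"] hom[of q t x] \<open>t > 0\<close>
              by (simp add: field_simps)
          qed
          ultimately show ?thesis using \<open>t > 0\<close> by (simp add: field_simps)
        qed
      qed
      moreover have "u x \<le> p x" for x
      proof -
        obtain q where "q \<in> C" using False by blast
        then show ?thesis using le[of q x] C(1) unfolding A_def by (auto intro: order_trans)
      qed
      ultimately have "u \<in> A" by (simp add: A_def)
      then show ?thesis using le unfolding rel_def by blast
    qed
  qed
  then obtain q where q: "q \<in> A" "\<And>a. a \<in> A \<Longrightarrow> rel q a \<Longrightarrow> a = q" by blast
  show ?thesis
  proof (rule that)
    fix q' x assume "sublinear q'" "\<And>y. q' y \<le> q y"
    moreover from this have "q' \<in> A"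
      using q(1) unfolding A_def by (auto intro: order_trans)
    ultimately have "q' = q" by (intro q(2)) (simp_all add: rel_def)
    then show "q' x = q x" by simp
  qed (use q(1) in \<open>auto simp: A_def\<close>)
qed

text \<open>A minimal sublinear functional is additive, since shifting it along any vector does not
  decrease it.\<close>

theorem Hahn_Banach_norming_functional:
  fixes z :: "'a::real_normed_vector"
  obtains \<phi> where "bounded_linear \<phi>" "\<And>x. \<bar>\<phi> x\<bar> \<le> norm x" "\<phi> z = norm z"
proof -
  have n: "sublinear (norm :: 'a \<Rightarrow> real)"
    unfolding sublinear_def by (simp add: norm_triangle_ineq)
  \<comment> \<open>Shifting the norm along \<open>z\<close> forces every linear functional below
    \<open>p\<close> to be at least \<open>norm z\<close> at \<open>z\<close>.\<close>
  define p where "p = (\<lambda>x. INF t\<in>{0..}. norm (x + t *\<^sub>R z) - t * norm z)"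
  have p: "sublinear p" "\<And>x. p x \<le> norm x" "p (- z) \<le> - norm z"
    unfolding p_def using sublinear_shift[OF n, of z "norm z"] by auto
  obtain q where q: "sublinear q" "\<And>x. q x \<le> p x"
    "\<And>q' x. sublinear q' \<Longrightarrow> (\<And>y. q' y \<le> q y) \<Longrightarrow> q' x = q x"
    using exists_minimal_sublinear[OF p(1)] by blast
  have add: "q (x + y) \<le> q x + q y" and hom: "t \<ge> 0 \<Longrightarrow> q (t *\<^sub>R x) = t * q x" for x y t
    using q(1) unfolding sublinear_def by auto
  have q0: "q 0 = 0" using hom[of 0 0] by simp
  have neg: "q (- y) = - q y" for y
  proof -
    define r where "r = (\<lambda>x. INF t\<in>{0..}. q (x + t *\<^sub>R y) - t * q y)"
    have "- q (- y) \<le> q y" using add[of y "- y"] q0 by simp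
    then have r: "sublinear r" "\<And>x. r x \<le> q x" "r (- y) \<le> - q y"
      unfolding r_def using sublinear_shift[OF q(1), of y "q y"] by auto
    then have "r (- y) = q (- y)" using q(3) by blast
    then show ?thesis using r(3) add[of y "- y"] q0 by simp
  qed
  have lin: "q (x + y) = q x + q y" for x y
    using add[of x y] add[of "x + y" "- y"] neg[of y] by simp
  have scale: "q (t *\<^sub>R x) = t * q x" for t x
    using hom[of t x] hom[of "- t" x] neg[of "t *\<^sub>R x"] by (cases "t \<ge> 0") auto
  have le: "q x \<le> norm x" for x using q(2)[of x] p(2)[of x] by simp
  have abs: "\<bar>q x\<bar> \<le> norm x" for x using le[of x] le[of "- x"] neg[of x] by simp
  show ?thesis
  proof (rule that)
    show "bounded_linear q"
      by (rule bounded_linear_intro[of _ 1]) (use lin scale abs in auto)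
    show "q z = norm z" using q(2)[of "- z"] p(3) neg[of z] le[of z] by simp
  qed (rule abs)
qed

section \<open>Iterated Abel integrals\<close>

text \<open>The weight produced by the kernel of a fractional power against quadratic decay:
  \<open>0 < b\<close> gives integrability at 0, \<open>b < 2\<close> at infinity.\<close>

lemma integrable_powr_over_square:
  fixes b :: real
  assumes b: "0 < b" "b < 2"
  shows "(\<lambda>s. s powr (b - 1) / (1 + s)\<^sup>2) integrable_on {0..}"
proof -
  have "(\<lambda>s. s powr (b - 1) / (1 + s)\<^sup>2) integrable_on {0..1}"
  proof (rule integrable_dominated_left[where g = "\<lambda>s. s powr (b - 1)"])
    show "continuous_on {0<..1} (\<lambda>s. s powr (b - 1) / (1 + s)\<^sup>2)"
      by (intro continuous_intros) auto
    show "(\<lambda>s. s powr (b - 1)) integrable_on {0..1}"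
      using b by (intro integrable_on_powr_from_0) auto
    fix t :: real assume "0 < t" "t \<le> 1"
    then have "1 \<le> (1 + t)\<^sup>2" by (simp add: one_le_power)
    then show "norm (t powr (b - 1) / (1 + t)\<^sup>2) \<le> t powr (b - 1)"
      by (simp add: divide_le_eq mult_le_cancel_left1)
  qed
  moreover have "(\<lambda>s. s powr (b - 1) / (1 + s)\<^sup>2) integrable_on {1..}"
  proof (rule integrable_dominated_half_line(1)[where g = "\<lambda>s. s powr (b - 3)"])
    show "continuous_on {1<..} (\<lambda>s. s powr (b - 1) / (1 + s)\<^sup>2)"
      by (intro continuous_intros) auto
    show "(\<lambda>s. s powr (b - 3)) integrable_on {1..}"
      using has_integral_powr_to_inf[of "b - 3" 1] b by (auto simp: integrable_on_def)
    fix t :: real assume t: "1 < t"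
    have "t powr (b - 3) = t powr (b - 1) / t\<^sup>2"
      using powr_diff[of t "b - 1" 2] t by simp
    moreover have "t powr (b - 1) / (1 + t)\<^sup>2 \<le> t powr (b - 1) / t\<^sup>2"
      using t by (intro divide_left_mono power_mono) auto
    ultimately show "norm (t powr (b - 1) / (1 + t)\<^sup>2) \<le> t powr (b - 3)" by simp
  qed
  moreover have "{0..} = {0..1} \<union> {1::real..}" by auto
  moreover have "{0..1} \<inter> {1..} = {1::real}" by auto
  ultimately show ?thesis
    using integrable_Un[of "{0..1}" "{1..}" "\<lambda>s::real. s powr (b - 1) / (1 + s)\<^sup>2"] by simp
qed

lemma set_integrable_powr_over_square:
  fixes b :: real
  assumes b: "0 < b" "b < 2"
  shows "set_integrable lborel {0..} (\<lambda>s. s powr (b - 1) / (1 + s)\<^sup>2)"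
proof -
  have "(\<lambda>s. s powr (b - 1) / (1 + s)\<^sup>2) absolutely_integrable_on {0..}"
    by (rule nonnegative_absolutely_integrable_1[OF integrable_powr_over_square[OF b]]) auto
  moreover have "(\<lambda>s. indicator {0..} s *\<^sub>R (s powr (b - 1) / (1 + s)\<^sup>2)) \<in> borel_measurable lborel"
    by measurable
  ultimately show ?thesis
    unfolding set_integrable_def by (simp add: integrable_completion)
qed

text \<open>Scaling by \<open>u\<close> in the Beta integral. The powers of \<open>u\<close> cancel
  since the exponents \<open>a - 1\<close> and \<open>- a\<close> and the Jacobian add up to 0, so
  the value does not depend on \<open>u\<close>.\<close>

lemma has_integral_Beta_scaled:
  fixes a u :: real
  assumes a: "0 < a" "a < 1" and u: "u > 0"
  shows "((\<lambda>t. t powr (a - 1) * (u - t) powr (- a)) has_integral Gamma a * Gamma (1 - a)) {0..u}"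
proof -
  have "((\<lambda>t. t powr (a - 1) * (1 - t) powr ((1 - a) - 1)) has_integral Beta a (1 - a)) {0..1}"
    using a by (intro has_integral_Beta_real) auto
  then have "((\<lambda>t. t powr (a - 1) * (1 - t) powr (- a)) has_integral Gamma a * Gamma (1 - a)) (cbox 0 1)"
    by (simp add: Beta_def)
  from has_integral_affinity'[OF this, of "1 / u" 0] u
  have "((\<lambda>x. (x / u) powr (a - 1) * (1 - x / u) powr (- a)) has_integral u * (Gamma a * Gamma (1 - a))) {0..u}"
    by (simp add: divide_simps)
  from has_integral_mult_right[OF this, of "1 / u"] u
  have "((\<lambda>x. (1 / u) * ((x / u) powr (a - 1) * (1 - x / u) powr (- a))) has_integral Gamma a * Gamma (1 - a)) {0..u}"
    by simp
  then show ?thesis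
  proof (rule has_integral_eq[rotated])
    fix x assume x: "x \<in> {0..u}"
    have "1 - x / u = (u - x) / u" using u by (simp add: field_simps)
    then have "(1 / u) * ((x / u) powr (a - 1) * (1 - x / u) powr (- a))
       = x powr (a - 1) * (u - x) powr (- a) / (u * (u powr (a - 1) * u powr (- a)))"
      using u x by (simp add: powr_divide field_simps)
    also have "u * (u powr (a - 1) * u powr (- a)) = 1"
    proof -
      have "u powr (a - 1) * u powr (- a) = u powr (- 1)" by (simp flip: powr_add)
      also have "\<dots> = 1 / u" using u powr_minus_divide[of u 1] by simp
      finally show ?thesis using u by simp
    qed
    finally show "(1 / u) * ((x / u) powr (a - 1) * (1 - x / u) powr (- a)) = x powr (a - 1) * (u - x) powr (- a)"
      by simp
  qed
qed

text \<open>With \<open>u = t + s\<close> and the order of integration exchanged, the integral in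
  \<open>t\<close> is a Beta integral independent of \<open>u\<close>. This is the scalar form of
  the composition law of complementary fractional powers.\<close>

lemma iterated_Abel_integral_real:
  fixes g :: "real \<Rightarrow> real"
  assumes a: "0 < a" "a < 1" and g: "continuous_on {0..} g"
    and le: "\<And>u. u \<ge> 0 \<Longrightarrow> \<bar>g u\<bar> \<le> C / (1 + u)\<^sup>2"
  shows "integral {0..} (\<lambda>t. t powr (a - 1) * integral {0..} (\<lambda>s. s powr (- a) * g (t + s)))
    = Gamma a * Gamma (1 - a) * integral {0..} g"
proof -
  \<comment> \<open>Extension by zero to the whole line turns the integral in \<open>t\<close> into
    a convolution of \<open>k1\<close> and \<open>k2\<close>, and the limits of integration
    disappear.\<close>
  define h where "h u = indicator {0..} u * g u" for u :: real
  define k1 where "k1 t = indicator {0..} t * t powr (a - 1)" for t :: real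
  define k2 where "k2 s = indicator {0..} s * s powr (- a)" for s :: real
  define B where "B = Gamma a * Gamma (1 - a)"
  have C: "C \<ge> 0" using le[of 0] by simp
  have "(\<lambda>u. indicator {0..} u *\<^sub>R g u) \<in> borel_measurable borel"
    by (rule borel_measurable_continuous_on_indicator[OF _ g]) simp
  then have hm[measurable]: "h \<in> borel_measurable borel" by (simp add: h_def[abs_def])
  have k1m[measurable]: "k1 \<in> borel_measurable borel" unfolding k1_def[abs_def] by measurable
  have k2m[measurable]: "k2 \<in> borel_measurable borel" unfolding k2_def[abs_def] by measurable
  have dom: "set_integrable lborel {0..} (\<lambda>s. C * (s powr (b - 1) / (1 + s)\<^sup>2))" if "0 < b" "b < 2" for b
    using set_integrable_mult_right[of C, OF set_integrable_powr_over_square[OF that]] by simp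
  have gint: "set_integrable lborel {0..} g"
  proof (rule set_integrable_bound[OF dom[of 1]])
    show "set_borel_measurable lborel {0..} g"
      using hm unfolding set_borel_measurable_def h_def[abs_def] by simp
    \<comment> \<open>The point 0 is excluded because \<open>0 powr 0 = 0\<close> makes the majorant
      vanish there.\<close>
    show "AE x in lborel. x \<in> {0..} \<longrightarrow> norm (g x) \<le> norm (C * (x powr (1 - 1) / (1 + x)\<^sup>2))"
    proof (rule AE_mp[OF AE_lborel_singleton[of 0]], intro AE_I2 impI)
      fix x :: real assume "x \<noteq> 0" "x \<in> {0..}"
      then show "norm (g x) \<le> norm (C * (x powr (1 - 1) / (1 + x)\<^sup>2))"
        using le[of x] C by simp
    qed
  qed auto
  then have hint: "integrable lborel h" by (simp add: set_integrable_def h_def[abs_def])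
  have hI: "integral\<^sup>L lborel h = integral {0..} g"
    using set_borel_integral_eq_integral(2)[OF gint] by (simp add: set_lebesgue_integral_def h_def[abs_def])
  have inner: "has_bochner_integral lborel (\<lambda>t. k1 t * k2 (u - t)) B" if u: "u > 0" for u
  proof -
    have eq: "k1 t * k2 (u - t) = indicator {0..u} t * (t powr (a - 1) * (u - t) powr (- a))" for t
      by (auto simp: k1_def k2_def indicator_def)
    have hi: "((\<lambda>t. t powr (a - 1) * (u - t) powr (- a)) has_integral B) {0..u}"
      unfolding B_def by (rule has_integral_Beta_scaled[OF a u])
    then have "(\<lambda>t. t powr (a - 1) * (u - t) powr (- a)) absolutely_integrable_on {0..u}"
      by (intro nonnegative_absolutely_integrable_1) auto
    then have "integrable lebesgue (\<lambda>t. k1 t * k2 (u - t))"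
      by (simp add: set_integrable_def eq)
    then have int: "integrable lborel (\<lambda>t. k1 t * k2 (u - t))"
      by (subst (asm) integrable_completion) auto
    then have "set_integrable lborel {0..u} (\<lambda>t. t powr (a - 1) * (u - t) powr (- a))"
      by (simp add: set_integrable_def eq)
    from set_borel_integral_eq_integral(2)[OF this] hi
    have "integral\<^sup>L lborel (\<lambda>t. k1 t * k2 (u - t)) = B"
      by (simp add: set_lebesgue_integral_def eq integral_unique)
    with int show ?thesis by (simp add: has_bochner_integral_iff)
  qed
  have h0: "h u = 0" if "u < 0" for u using that by (simp add: h_def)
  have inner': "has_bochner_integral lborel (\<lambda>t. h u * (k1 t * k2 (u - t))) (h u * B)" if "u \<noteq> 0" for u
  proof (cases "u > 0")
    case True
    then show ?thesis by (intro has_bochner_integral_mult_right inner)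
  next
    case False
    then have "h u = 0" using h0[of u] that by simp
    then show ?thesis using has_bochner_integral_zero[of lborel, where 'b = real] by simp
  qed
  define f where "f = (\<lambda>u t. h u * (k1 t * k2 (u - t)))"
  have fm[measurable]: "case_prod f \<in> borel_measurable (lborel \<Otimes>\<^sub>M lborel)"
    unfolding f_def by measurable
  have AE0: "AE u in lborel. u \<noteq> (0::real)" by (rule AE_lborel_singleton)
  have nonneg: "k1 t * k2 s \<ge> 0" for t s by (simp add: k1_def k2_def)
  have fint: "integrable (lborel \<Otimes>\<^sub>M lborel) (case_prod f)"
  proof (rule lborel_pair.Fubini_integrable)
    \<comment> \<open>The kernels are nonnegative, so integrating the absolute value in
      \<open>t\<close> leaves \<open>norm (h u) * B\<close>. Integrability in the plane thus reduces
      to that of \<open>h\<close>.\<close>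
    have ae: "AE u in lborel. norm (h u) * B = (LBINT t. norm (case_prod f (u, t)))"
    proof (rule AE_mp[OF AE0], intro AE_I2 impI)
      fix u :: real assume "u \<noteq> 0"
      have eq: "norm (case_prod f (u, t)) = norm (h u) * (k1 t * k2 (u - t))" for t
        using abs_of_nonneg[OF nonneg[of t "u - t"]] by (simp add: f_def abs_mult[of "h u"])
      moreover have "(LBINT t. norm (h u) * (k1 t * k2 (u - t))) = norm (h u) * B"
      proof (cases "u > 0")
        case True
        then show ?thesis using inner[of u] by (simp add: has_bochner_integral_iff)
      next
        case False
        then show ?thesis using h0[of u] \<open>u \<noteq> 0\<close> by simp
      qed
      ultimately show "norm (h u) * B = (LBINT t. norm (case_prod f (u, t)))" by (simp only: eq)
    qed
    show "integrable lborel (\<lambda>u. LBINT t. norm (case_prod f (u, t)))"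
    proof (rule integrable_cong_AE_imp[OF _ _ ae])
      show "integrable lborel (\<lambda>u. norm (h u) * B)" using hint by simp
      show "(\<lambda>u. LBINT t. norm (case_prod f (u, t))) \<in> borel_measurable lborel"
        by (rule lborel.borel_measurable_lebesgue_integral) (simp add: split_beta' f_def)
    qed
    show "AE u in lborel. integrable lborel (\<lambda>t. case_prod f (u, t))"
      by (rule AE_mp[OF AE0], intro AE_I2 impI) (use inner' in \<open>auto simp: f_def has_bochner_integral_iff\<close>)
  qed simp
  have "(LBINT t. LBINT u. f u t) = (LBINT u. LBINT t. f u t)"
    by (rule lborel_pair.Fubini_integral[OF fint])
  also have "\<dots> = (LBINT u. h u * B)"
  proof (rule integral_cong_AE)
    show "(\<lambda>u. LBINT t. f u t) \<in> borel_measurable lborel"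
      by (rule lborel.borel_measurable_lebesgue_integral[OF fm])
    show "AE u in lborel. (LBINT t. f u t) = h u * B"
      by (rule AE_mp[OF AE0], intro AE_I2 impI) (unfold f_def, rule has_bochner_integral_integral_eq[OF inner'])
  qed simp
  also have "\<dots> = B * integral {0..} g" using hI by simp
  finally have main: "(LBINT t. LBINT u. f u t) = B * integral {0..} g" .
  define I where "I t = integral {0..} (\<lambda>s. s powr (- a) * g (t + s))" for t
  have inI: "(LBINT u. f u t) = indicator {0..} t *\<^sub>R (t powr (a - 1) * I t)" for t
  proof (cases "t \<ge> 0")
    case False
    then show ?thesis by (simp add: f_def k1_def)
  next
    case True
    have "(LBINT u. f u t) = (LBINT s. f (t + 1 * s) t)"
      using lborel_integral_real_affine[of 1 "\<lambda>u. f u t" t] by simp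
    also have "\<dots> = (LBINT s. k1 t * (indicator {0..} s *\<^sub>R (s powr (- a) * g (t + s))))"
      by (rule Bochner_Integration.integral_cong) (use True in \<open>auto simp: f_def h_def k2_def indicator_def\<close>)
    also have "\<dots> = k1 t * (LINT s:{0..}|lborel. s powr (- a) * g (t + s))"
      by (simp add: set_lebesgue_integral_def)
    also have "(LINT s:{0..}|lborel. s powr (- a) * g (t + s)) = I t"
      unfolding I_def
    proof (rule set_borel_integral_eq_integral(2), rule set_integrable_bound[OF dom[of "1 - a"]])
      have "(\<lambda>s. indicator {0..} s *\<^sub>R (s powr (- a) * g (t + s))) = (\<lambda>s. k2 s * h (t + s))"
        using True by (auto simp: k2_def h_def indicator_def fun_eq_iff)
      then show "set_borel_measurable lborel {0..} (\<lambda>s. s powr (- a) * g (t + s))"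
        unfolding set_borel_measurable_def by simp
      show "AE s in lborel. s \<in> {0..} \<longrightarrow> norm (s powr - a * g (t + s)) \<le> norm (C * (s powr (1 - a - 1) / (1 + s)\<^sup>2))"
      proof (intro AE_I2 impI)
        fix s :: real assume s: "s \<in> {0..}"
        have "\<bar>g (t + s)\<bar> \<le> C / (1 + (t + s))\<^sup>2" using le[of "t + s"] True s by simp
        also have "\<dots> \<le> C / (1 + s)\<^sup>2"
          using True s C by (intro divide_left_mono power_mono) auto
        finally have "s powr - a * \<bar>g (t + s)\<bar> \<le> s powr - a * (C / (1 + s)\<^sup>2)"
          by (intro mult_left_mono) auto
        then show "norm (s powr - a * g (t + s)) \<le> norm (C * (s powr (1 - a - 1) / (1 + s)\<^sup>2))"
          using C by (simp add: abs_mult mult_ac)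
      qed
    qed (use a in auto)
    finally show ?thesis using True by (simp add: k1_def)
  qed
  have "integrable lborel (\<lambda>t. LBINT u. f u t)"
    using lborel_pair.integrable_snd[OF fint] by simp
  then have si: "set_integrable lborel {0..} (\<lambda>t. t powr (a - 1) * I t)"
    by (simp add: set_integrable_def inI)
  have "integral {0..} (\<lambda>t. t powr (a - 1) * I t) = (LBINT t. LBINT u. f u t)"
    unfolding set_borel_integral_eq_integral(2)[OF si, symmetric] set_lebesgue_integral_def inI ..
  then show ?thesis using main by (simp add: I_def B_def)
qed

section \<open>Inversion of the Laplace transform\<close>

lemma residue_exp_over_cube:
  "residue (\<lambda>z. exp (of_real t * z) / z ^ 3) 0 = of_real (t\<^sup>2) / 2"
proof -
  have d: "deriv (\<lambda>z. c * exp (of_real t * z)) = (\<lambda>z. (c * of_real t) * exp (of_real t * z))" for c :: complex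
    by (intro ext DERIV_imp_deriv) (auto intro!: derivative_eq_intros)
  have "residue (\<lambda>z. exp (of_real t * z) / z ^ Suc 2) 0 = (deriv ^^ 2) (\<lambda>z. exp (of_real t * z)) 0 / fact 2"
    by (rule residue_holomorphic_over_power'[of UNIV]) (auto intro!: holomorphic_intros)
  also have "(deriv ^^ 2) (\<lambda>z. exp (of_real t * z)) 0 = (of_real (t\<^sup>2) :: complex)"
    using d[of 1] d[of "of_real t"] by (simp add: numeral_2_eq_2 power2_eq_square)
  finally show ?thesis by (simp add: numeral_3_eq_3 numeral_2_eq_2)
qed

text \<open>The residue theorem on a large rectangle. The triple pole at 0 contributes the limit,
  and the three sides away from the line contribute a term of order \<open>N^-2\<close>.\<close>

lemma tendsto_inverse_Laplace_cube:
  fixes c t :: real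
  assumes c: "c > 0" and t: "t > 0"
  shows "((\<lambda>N. integral {-N..N} (\<lambda>y. exp (of_real t * Complex c y) / Complex c y ^ 3))
    \<longlongrightarrow> of_real (pi * t\<^sup>2)) at_top"
proof -
  define f where "f z = exp (of_real t * z) / z ^ 3" for z :: complex
  define I where "I N = integral {-N..N} (\<lambda>y. f (Complex c y))" for N
  have bound: "norm (I N - of_real (pi * t\<^sup>2)) \<le> exp (t * c) * (2 * c + 4 * N) / N ^ 3" if N: "N > 0" for N
  proof -
    \<comment> \<open>Corners in counter-clockwise order. The side from \<open>a2\<close> to
      \<open>a3\<close> is the segment in question; on the other three the real part is at most
      \<open>c\<close> and the distance to 0 at least \<open>N\<close>.\<close>
    define a1 a2 a3 a4 where "a1 = Complex (- N) (- N)" and "a2 = Complex c (- N)"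
      and "a3 = Complex c N" and "a4 = Complex (- N) N"
    have fc: "continuous_on S f" if "0 \<notin> S" for S
      unfolding f_def using that by (intro continuous_intros) auto
    have fh: "f holomorphic_on UNIV - {0}"
      unfolding f_def by (intro holomorphic_intros) auto
    have out: "z \<noteq> 0 \<and> norm (f z) \<le> exp (t * c) / N ^ 3" if "Re z \<le> c" "N \<le> \<bar>Re z\<bar> \<or> N \<le> \<bar>Im z\<bar>" for z
    proof -
      have "N \<le> cmod z" using that(2) abs_Re_le_cmod[of z] abs_Im_le_cmod[of z] by linarith
      moreover have "cmod (exp (of_real t * z)) \<le> exp (t * c)" using that(1) t by simp
      ultimately have "norm (f z) \<le> exp (t * c) / N ^ 3"
        unfolding f_def norm_divide norm_power using N by (intro frac_le power_mono) auto
      then show ?thesis using \<open>N \<le> cmod z\<close> N by auto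
    qed
    have s12: "z \<noteq> 0 \<and> norm (f z) \<le> exp (t * c) / N ^ 3" if "z \<in> closed_segment a1 a2" for z
      using that N c closed_segment_same_Im[of a1 a2]
      by (intro out) (auto simp: a1_def a2_def closed_segment_eq_real_ivl)
    have s34: "z \<noteq> 0 \<and> norm (f z) \<le> exp (t * c) / N ^ 3" if "z \<in> closed_segment a3 a4" for z
      using that N c closed_segment_same_Im[of a3 a4]
      by (intro out) (auto simp: a3_def a4_def closed_segment_eq_real_ivl)
    have s41: "z \<noteq> 0 \<and> norm (f z) \<le> exp (t * c) / N ^ 3" if "z \<in> closed_segment a4 a1" for z
      using that N c closed_segment_same_Re[of a4 a1]
      by (intro out) (auto simp: a1_def a4_def closed_segment_eq_real_ivl)
    have s23: "z \<noteq> 0" if "z \<in> closed_segment a2 a3" for z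
      using that N c closed_segment_same_Re[of a2 a3] by (auto simp: a3_def a2_def)
    have i12: "f contour_integrable_on linepath a1 a2"
      using s12 by (intro contour_integrable_continuous_linepath fc) auto
    have i23: "f contour_integrable_on linepath a2 a3"
      using s23 by (intro contour_integrable_continuous_linepath fc) auto
    have i34: "f contour_integrable_on linepath a3 a4"
      using s34 by (intro contour_integrable_continuous_linepath fc) auto
    have i41: "f contour_integrable_on linepath a4 a1"
      using s41 by (intro contour_integrable_continuous_linepath fc) auto
    have rect: "rectpath a1 a3 = linepath a1 a2 +++ linepath a2 a3 +++ linepath a3 a4 +++ linepath a4 a1"
      by (simp add: rectpath_def a1_def a2_def a3_def a4_def Let_def)
    have "contour_integral (rectpath a1 a3) f
       = contour_integral (linepath a1 a2) f + contour_integral (linepath a2 a3) f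
        + contour_integral (linepath a3 a4) f + contour_integral (linepath a4 a1) f"
      unfolding rect using i12 i23 i34 i41 by (simp add: contour_integrable_join)
    moreover have "contour_integral (linepath a2 a3) f = \<i> * I N"
      unfolding I_def by (rule contour_integral_linepath_same_Re) (use N in \<open>auto simp: a2_def a3_def\<close>)
    moreover have "contour_integral (rectpath a1 a3) f = 2 * pi * \<i> * (\<Sum>p\<in>{0}. winding_number (rectpath a1 a3) p * residue f p)"
    proof (rule Residue_theorem[of UNIV])
      show "path_image (rectpath a1 a3) \<subseteq> UNIV - {0}"
        using N c by (subst path_image_rectpath) (auto simp: a1_def a3_def)
    qed (use fh in auto)
    moreover have "winding_number (rectpath a1 a3) 0 = 1"
      by (rule winding_number_rectpath) (use N c in \<open>auto simp: a1_def a3_def in_box_complex_iff\<close>)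
    moreover have "residue f 0 = of_real (t\<^sup>2) / 2"
      unfolding f_def by (rule residue_exp_over_cube)
    ultimately have "\<i> * (I N - of_real (pi * t\<^sup>2)) = - (contour_integral (linepath a1 a2) f
        + contour_integral (linepath a3 a4) f + contour_integral (linepath a4 a1) f)"
      by (simp add: algebra_simps)
    then have "norm (I N - of_real (pi * t\<^sup>2)) = norm (contour_integral (linepath a1 a2) f
        + contour_integral (linepath a3 a4) f + contour_integral (linepath a4 a1) f)"
      by (metis mult_cancel_right2 norm_ii norm_minus_cancel norm_mult mult.commute)
    also have "\<dots> \<le> norm (contour_integral (linepath a1 a2) f)
        + norm (contour_integral (linepath a3 a4) f) + norm (contour_integral (linepath a4 a1) f)"
      by (intro order_trans[OF norm_triangle_ineq] add_mono norm_triangle_ineq order_refl)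
    also have "\<dots> \<le> exp (t * c) / N ^ 3 * norm (a2 - a1) + exp (t * c) / N ^ 3 * norm (a4 - a3)
        + exp (t * c) / N ^ 3 * norm (a1 - a4)"
      using N s12 s34 s41 i12 i34 i41 by (intro add_mono contour_integral_bound_linepath) auto
    finally have "norm (I N - of_real (pi * t\<^sup>2)) \<le> exp (t * c) / N ^ 3 * norm (a2 - a1)
        + exp (t * c) / N ^ 3 * norm (a4 - a3) + exp (t * c) / N ^ 3 * norm (a1 - a4)" .
    moreover have "norm (a2 - a1) = c + N" "norm (a4 - a3) = c + N" "norm (a1 - a4) = 2 * N"
      using N c by (auto simp: a1_def a2_def a3_def a4_def cmod_def real_sqrt_mult)
    moreover have "exp (t * c) / N ^ 3 * (c + N) + exp (t * c) / N ^ 3 * (c + N) + exp (t * c) / N ^ 3 * (2 * N)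
        = exp (t * c) * (2 * c + 4 * N) / N ^ 3"
      by (simp add: algebra_simps add_divide_distrib)
    ultimately show ?thesis by simp
  qed
  have "((\<lambda>N. exp (t * c) * (2 * c + 4 * N) / N ^ 3) \<longlongrightarrow> 0) at_top"
    by real_asymp
  then have "((\<lambda>N. I N - of_real (pi * t\<^sup>2)) \<longlongrightarrow> 0) at_top"
    by (rule Lim_null_comparison[rotated]) (rule eventually_mono[OF eventually_gt_at_top[of 0] bound])
  then show ?thesis unfolding I_def f_def by (simp add: LIM_zero_iff)
qed

lemma vector_derivative_bound:
  fixes f :: "real \<Rightarrow> 'a::real_normed_vector"
  assumes "\<And>x. x \<in> {a..b} \<Longrightarrow> (f has_vector_derivative f' x) (at x within {a..b})"
    and B: "\<And>x. x \<in> {a..b} \<Longrightarrow> norm (f' x) \<le> B"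
    and "x \<in> {a..b}" "y \<in> {a..b}"
  shows "norm (f x - f y) \<le> B * \<bar>x - y\<bar>"
proof -
  have "norm (f x - f y) \<le> B * norm (x - y)"
  proof (rule differentiable_bound[where S = "{a..b}" and f' = "\<lambda>x h. h *\<^sub>R f' x"])
    show "(f has_derivative (\<lambda>h. h *\<^sub>R f' u)) (at u within {a..b})" if "u \<in> {a..b}" for u
      using assms(1)[OF that] by (simp add: has_vector_derivative_def)
    show "onorm (\<lambda>h. h *\<^sub>R f' u) \<le> B" if "u \<in> {a..b}" for u
      using B[OF that] by (intro onorm_le) (simp add: mult.commute[of B] mult_left_mono)
  qed (use assms in auto)
  then show ?thesis by simp
qed

section \<open>Complex scalars acting on the complexification\<close>

text \<open>Multiplication by \<i>. As a bounded operator it makes \<open>cmul\<close> a bounded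
  linear function of its scalar, so that products with \<open>cmul\<close> can be
  differentiated.\<close>

definition rot :: "('a::real_normed_vector \<times> 'a) \<Rightarrow>\<^sub>L ('a \<times> 'a)"
  where "rot = Blinfun (\<lambda>(x, y). (- y, x))"

text \<open>Multiplication by a complex scalar on the complexification.\<close>

definition cmul :: "complex \<Rightarrow> ('a::real_normed_vector \<times> 'a) \<Rightarrow>\<^sub>L ('a \<times> 'a)"
  where "cmul l = Re l *\<^sub>R id_blinfun + Im l *\<^sub>R rot"

lemma rot_apply [simp]: "rot (x, y) = (- y, x)"
proof -
  have "bounded_linear (\<lambda>(x, y). (- y :: 'a, x :: 'a))"
    by (rule bounded_linear_intro[of _ 1]) (auto simp: norm_Pair)
  then show ?thesis by (simp add: rot_def bounded_linear_Blinfun_apply)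
qed

lemma cmul_Pair: "cmul l (x, y) = (Re l *\<^sub>R x - Im l *\<^sub>R y, Im l *\<^sub>R x + Re l *\<^sub>R y)"
  by (simp add: cmul_def blinfun.add_left blinfun.scaleR_left)

lemma cmul_mult: "cmul (l * m) z = cmul l (cmul m z)"
  by (cases z) (simp add: cmul_Pair algebra_simps scaleR_left_diff_distrib)

lemma cmul_1 [simp]: "cmul 1 z = z"
  by (cases z) (simp add: cmul_Pair)

lemma cmul_of_real: "cmul (of_real r) z = r *\<^sub>R z"
  by (cases z) (simp add: cmul_Pair)

lemma cmul_inverse: "l \<noteq> 0 \<Longrightarrow> cmul (inverse l) (cmul l z) = z"
  by (simp flip: cmul_mult)

lemma bounded_linear_cmul: "bounded_linear cmul"
proof -
  have "bounded_linear (\<lambda>l. Re l *\<^sub>R id_blinfun + Im l *\<^sub>R rot)"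
    by (intro bounded_linear_add bounded_linear_compose[OF bounded_linear_scaleR_left]
        bounded_linear_Re bounded_linear_Im)
  then show ?thesis by (simp add: cmul_def[abs_def])
qed

lemmas cmul_diff = linear_diff[OF bounded_linear.linear[OF bounded_linear_cmul]]
  and cmul_neg = linear_neg[OF bounded_linear.linear[OF bounded_linear_cmul]]

text \<open>In the product norm a scalar of modulus 1 need not act isometrically unless the norm
  comes from an inner product. The crude factor 2 enters the later constants.\<close>

lemma norm_cmul_le: "norm (cmul l z) \<le> 2 * cmod l * norm z"
proof -
  have r: "norm (rot z) = norm z" by (cases z) (simp add: norm_Pair add.commute)
  have "norm (cmul l z) \<le> norm (Re l *\<^sub>R z) + norm (Im l *\<^sub>R rot z)"
    using norm_triangle_ineq[of "Re l *\<^sub>R z" "Im l *\<^sub>R rot z"]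
    unfolding cmul_def by (simp add: blinfun.add_left blinfun.scaleR_left)
  also have "\<dots> = (\<bar>Re l\<bar> + \<bar>Im l\<bar>) * norm z" by (simp add: r algebra_simps)
  also have "\<dots> \<le> (2 * cmod l) * norm z"
    using abs_Re_le_cmod[of l] abs_Im_le_cmod[of l] by (intro mult_right_mono) auto
  finally show ?thesis .
qed

lemma norm_cmul_blinfun_le: "norm (cmul l) \<le> 2 * cmod l"
  by (rule norm_blinfun_bound) (auto intro: norm_cmul_le)

section \<open>Holomorphic maps on the half-plane and integrals over vertical segments\<close>

text \<open>Closed, so that the imaginary axis is an admissible line of integration. Derivatives are
  accordingly taken within the half-plane.\<close>

definition half_plane :: "complex set"
  where "half_plane = {l. 0 \<le> Re l}"

lemma half_plane_Complex [simp]: "Complex c y \<in> half_plane \<longleftrightarrow> 0 \<le> c"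
  by (simp add: half_plane_def)

text \<open>The integral is taken in the real parameter \<open>y\<close>, so it differs from the
  contour integral by the factor \<i>.\<close>

definition vline_integral :: "(complex \<Rightarrow> 'a::banach) \<Rightarrow> real \<Rightarrow> real \<Rightarrow> 'a"
  where "vline_integral F c N = integral {-N..N} (\<lambda>y. F (Complex c y))"

text \<open>Complex differentiability is expressed by a real derivative of the form
  \<open>cmul d (F' l)\<close>; the chain rule along a vertical line inserts the direction
  \<i>.\<close>

lemma has_vector_derivative_vertical:
  fixes F :: "complex \<Rightarrow> 'a::real_normed_vector \<times> 'a"
  assumes "(F has_derivative (\<lambda>d. cmul d (F' (Complex c y)))) (at (Complex c y) within half_plane)" "0 \<le> c"
  shows "((\<lambda>y. F (Complex c y)) has_vector_derivative cmul \<i> (F' (Complex c y))) (at y within S)"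
proof -
  have "((\<lambda>y. Complex c y) has_vector_derivative \<i>) (at y within S)"
  proof -
    have "Complex c = (\<lambda>y. of_real c + y *\<^sub>R \<i>)" by (auto simp: complex_eq_iff)
    moreover have "((\<lambda>y. of_real c + y *\<^sub>R \<i>) has_vector_derivative \<i>) (at y within S)"
      by (auto intro!: derivative_eq_intros)
    ultimately show ?thesis by simp
  qed
  moreover have "(F has_derivative (\<lambda>d. cmul d (F' (Complex c y)))) (at (Complex c y) within (\<lambda>y. Complex c y) ` S)"
    by (rule has_derivative_subset[OF assms(1)]) (use assms(2) in auto)
  ultimately show ?thesis
    using vector_derivative_diff_chain_within[of "\<lambda>y. Complex c y" \<i> y S F "\<lambda>d. cmul d (F' (Complex c y))"]
    by (simp add: o_def)
qed

lemma has_vector_derivative_horizontal: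
  fixes F :: "complex \<Rightarrow> 'a::real_normed_vector \<times> 'a"
  assumes "(F has_derivative (\<lambda>d. cmul d (F' (Complex c y)))) (at (Complex c y) within half_plane)" "S \<subseteq> {0..}"
  shows "((\<lambda>c. F (Complex c y)) has_vector_derivative F' (Complex c y)) (at c within S)"
proof -
  have "((\<lambda>c. Complex c y) has_vector_derivative 1) (at c within S)"
  proof -
    have "(\<lambda>c. Complex c y) = (\<lambda>c. of_real y * \<i> + c *\<^sub>R 1)" by (auto simp: complex_eq_iff)
    moreover have "((\<lambda>c. of_real y * \<i> + c *\<^sub>R 1 :: complex) has_vector_derivative 1) (at c within S)"
      by (auto intro!: derivative_eq_intros)
    ultimately show ?thesis by simp
  qed
  moreover have "(F has_derivative (\<lambda>d. cmul d (F' (Complex c y)))) (at (Complex c y) within (\<lambda>c. Complex c y) ` S)"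
    by (rule has_derivative_subset[OF assms(1)]) (use assms(2) in auto)
  ultimately show ?thesis
    using vector_derivative_diff_chain_within[of "\<lambda>c. Complex c y" 1 c S F "\<lambda>d. cmul d (F' (Complex c y))"]
    by (simp add: o_def)
qed

lemma continuous_on_Complex [continuous_intros]:
  "continuous_on S f \<Longrightarrow> continuous_on S g \<Longrightarrow> continuous_on S (\<lambda>x. Complex (f x) (g x))"
  unfolding Complex_eq by (intro continuous_intros)

lemma vline_integrable:
  fixes F :: "complex \<Rightarrow> 'a::banach"
  assumes "continuous_on half_plane F" "0 \<le> c"
  shows "(\<lambda>y. F (Complex c y)) integrable_on {a..b}"
  by (intro integrable_continuous_interval continuous_on_compose2[OF assms(1)] continuous_intros)
     (use assms(2) in auto)

text \<open>Along the segment \<open>\<i> F'\<close> has the primitive \<open>F\<close>, so only the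
  end points matter. The factor 4 counts two end points, times the 2 of
  \<open>norm_cmul_le\<close>.\<close>

lemma norm_vline_integral_derivative_le:
  fixes F :: "complex \<Rightarrow> 'a::banach \<times> 'a"
  assumes der: "\<And>l. l \<in> half_plane \<Longrightarrow> (F has_derivative (\<lambda>d. cmul d (F' l))) (at l within half_plane)"
    and cont: "continuous_on half_plane F'" and c: "0 \<le> c" and N: "0 \<le> N"
    and B: "norm (F (Complex c N)) \<le> B" "norm (F (Complex c (- N))) \<le> B"
  shows "norm (vline_integral F' c N) \<le> 4 * B"
proof -
  have "((\<lambda>y. cmul \<i> (F' (Complex c y))) has_integral (F (Complex c N) - F (Complex c (- N)))) {-N..N}"
    using N c by (intro fundamental_theorem_of_calculus has_vector_derivative_vertical[where F = F] der) auto
  then have "integral {-N..N} (\<lambda>y. cmul \<i> (F' (Complex c y))) = F (Complex c N) - F (Complex c (- N))"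
    by (rule integral_unique)
  moreover have "integral {-N..N} (\<lambda>y. cmul \<i> (F' (Complex c y))) = cmul \<i> (vline_integral F' c N)"
    unfolding vline_integral_def
    using integral_linear[OF vline_integrable[OF cont c, of "-N" N] blinfun.bounded_linear_right[of "cmul \<i>"]]
    by (simp add: o_def)
  ultimately have "vline_integral F' c N = cmul (inverse \<i>) (F (Complex c N) - F (Complex c (- N)))"
    by (metis cmul_inverse complex_i_not_zero)
  then have "norm (vline_integral F' c N) \<le> 2 * norm (F (Complex c N) - F (Complex c (- N)))"
    using norm_cmul_le[of "inverse \<i>" "F (Complex c N) - F (Complex c (- N))"] by simp
  then show ?thesis
    using norm_triangle_ineq4[of "F (Complex c N)" "F (Complex c (- N))"] B by linarith
qed

text \<open>Cauchy's theorem for a rectangle: the derivative of the integral over a vertical segment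
  with respect to its abscissa is a boundary term.\<close>

lemma norm_vline_integral_shift_le:
  fixes F :: "complex \<Rightarrow> 'a::banach \<times> 'a"
  assumes der: "\<And>l. l \<in> half_plane \<Longrightarrow> (F has_derivative (\<lambda>d. cmul d (F' l))) (at l within half_plane)"
    and cont: "continuous_on half_plane F'" and c: "0 \<le> a" "a \<le> b" and N: "0 \<le> N"
    and B: "\<And>c. c \<in> {a..b} \<Longrightarrow> norm (F (Complex c N)) \<le> B"
     "\<And>c. c \<in> {a..b} \<Longrightarrow> norm (F (Complex c (- N))) \<le> B"
  shows "norm (vline_integral F b N - vline_integral F a N) \<le> 4 * B * (b - a)"
proof -
  have Fc: "continuous_on half_plane F"
    using der by (meson has_derivative_continuous continuous_on_eq_continuous_within)
  have "norm (vline_integral F b N - vline_integral F a N) \<le> 4 * B * \<bar>b - a\<bar>"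
  proof (rule vector_derivative_bound[where a = a and b = b and f' = "\<lambda>c. vline_integral F' c N"])
    fix x assume x: "x \<in> {a..b}"
    then have "x \<ge> 0" using c by simp
    show "norm (vline_integral F' x N) \<le> 4 * B"
      by (rule norm_vline_integral_derivative_le[OF der cont \<open>x \<ge> 0\<close> N B(1)[OF x] B(2)[OF x]])
    have "((\<lambda>c. integral (cbox (-N) N) (\<lambda>y. F (Complex c y))) has_vector_derivative
        integral (cbox (-N) N) (\<lambda>y. F' (Complex x y))) (at x within {a..b})"
    proof (rule leibniz_rule_vector_derivative)
      show "((\<lambda>c. F (Complex c t)) has_vector_derivative F' (Complex u t)) (at u within {a..b})"
        if "u \<in> {a..b}" for u t
        using that c by (intro has_vector_derivative_horizontal[where F = F] der) auto
      show "(\<lambda>y. F (Complex u y)) integrable_on cbox (- N) N" if "u \<in> {a..b}" for u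
        using vline_integrable[OF Fc] that c by auto
      show "continuous_on ({a..b} \<times> cbox (- N) N) (\<lambda>(x, t). F' (Complex x t))"
        unfolding split_beta
        by (rule continuous_on_compose2[OF cont]) (use c in \<open>auto intro!: continuous_intros\<close>)
    qed (use x in auto)
    then show "((\<lambda>c. vline_integral F c N) has_vector_derivative vline_integral F' x N) (at x within {a..b})"
      by (simp add: vline_integral_def)
  qed (use c in auto)
  then show ?thesis using c by simp
qed

section \<open>Calculus of resolvent powers\<close>

text \<open>\<open>R l\<close> stands for \<open>(l + A)^-1\<close>, but the operator is absent: the
  relation \<open>B y = v\<close> for the generator \<open>B\<close> is later written as
  \<open>R l (cmul l y) - R l v = y\<close>. The bound joins boundedness near 0 with the decay
  \<open>1 / |l|\<close>.\<close>

locale half_plane_resolvent =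
  fixes R :: "complex \<Rightarrow> ('a::banach \<times> 'a) \<Rightarrow>\<^sub>L ('a \<times> 'a)" and M :: real
  assumes cmul_commute: "l \<in> half_plane \<Longrightarrow> R l (cmul m z) = cmul m (R l z)"
    and resolvent_identity: "l \<in> half_plane \<Longrightarrow> m \<in> half_plane \<Longrightarrow>
      R l z - R m z = cmul (m - l) (R l (R m z))"
    and resolvent_bound: "l \<in> half_plane \<Longrightarrow> norm (R l z) \<le> M / (1 + cmod l) * norm z"
    and M_ge_1: "1 \<le> M"
begin

lemma norm_resolvent_le:
  assumes "l \<in> half_plane" shows "norm (R l) \<le> M"
proof (rule norm_blinfun_bound)
  fix z
  have "norm (R l z) \<le> M / (1 + cmod l) * norm z" by (rule resolvent_bound[OF assms])
  also have "\<dots> \<le> M / 1 * norm z"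
    using M_ge_1 by (intro mult_right_mono divide_left_mono) (auto intro: add_pos_nonneg)
  finally show "norm (R l z) \<le> M * norm z" by simp
qed (use M_ge_1 in simp)

lemma resolvent_lipschitz:
  assumes "l \<in> half_plane" "m \<in> half_plane"
  shows "norm (R l - R m) \<le> 2 * M * M * cmod (m - l)"
proof (rule norm_blinfun_bound)
  fix z
  have "norm ((R l - R m) z) = norm (cmul (m - l) (R l (R m z)))"
    by (simp add: blinfun.diff_left resolvent_identity assms)
  also have "\<dots> \<le> 2 * cmod (m - l) * norm (R l (R m z))" by (rule norm_cmul_le)
  also have "\<dots> \<le> 2 * cmod (m - l) * (M * (M * norm z))"
  proof (intro mult_left_mono)
    have "norm (R k y) \<le> M * norm y" if "k \<in> half_plane" for k y
      using norm_blinfun[of "R k" y] norm_resolvent_le[OF that]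
      by (meson mult_right_mono norm_ge_zero order_trans)
    then show "norm (R l (R m z)) \<le> M * (M * norm z)"
      using assms M_ge_1 by (meson mult_left_mono order_trans zero_le_one)
  qed simp
  finally show "norm ((R l - R m) z) \<le> 2 * M * M * cmod (m - l) * norm z"
    by (simp add: mult_ac)
qed (use M_ge_1 in simp)

text \<open>Two uses of the resolvent identity: the remainder is
  \<open>- (m - l) (R m - R l) R l\<close>, of second order by the Lipschitz bound.\<close>

lemma resolvent_has_derivative:
  assumes l: "l \<in> half_plane"
  shows "(R has_derivative (\<lambda>d. - (cmul d o\<^sub>L R l o\<^sub>L R l))) (at l within half_plane)"
proof (rule has_derivativeI_sandwich[where e = 1 and H = "\<lambda>m. 4 * M * M * M * norm (m - l)"])
  show "bounded_linear (\<lambda>d. - (cmul d o\<^sub>L R l o\<^sub>L R l))"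
    by (intro bounded_linear_minus bounded_linear_compose[OF bounded_bilinear.bounded_linear_left[OF bounded_bilinear_blinfun_compose]] bounded_linear_cmul)
  have eq: "R m - R l - - (cmul (m - l) o\<^sub>L R l o\<^sub>L R l) = - (cmul (m - l) o\<^sub>L (R m - R l) o\<^sub>L R l)"
    if "m \<in> half_plane" for m
  proof (rule blinfun_eqI)
    fix z
    have "(R m - R l) z = cmul (l - m) (R m (R l z))"
      by (simp only: blinfun.diff_left resolvent_identity[OF that l])
    also have "cmul (l - m) = (- cmul (m - l) :: ('a \<times> 'a) \<Rightarrow>\<^sub>L _)"
      using cmul_neg[of "m - l"] by (simp only: minus_diff_eq)
    also have "(- cmul (m - l)) (R m (R l z)) = - cmul (m - l) (R m (R l z))"
      by (rule blinfun.minus_left)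
    finally have p1: "(R m - R l) z = - cmul (m - l) (R m (R l z))" .
    have p2: "(R m - R l - - (cmul (m - l) o\<^sub>L R l o\<^sub>L R l)) z = (R m - R l) z - - cmul (m - l) (R l (R l z))"
      by (simp only: blinfun.diff_left[of "R m - R l"] blinfun.minus_left blinfun_apply_blinfun_compose)
    have p3: "(- (cmul (m - l) o\<^sub>L (R m - R l) o\<^sub>L R l)) z = - (cmul (m - l) (R m (R l z)) - cmul (m - l) (R l (R l z)))"
      by (simp only: blinfun.diff_left blinfun.diff_right blinfun.minus_left blinfun_apply_blinfun_compose)
    have p4: "- y - - x = - (y - x)" for x y :: "'a \<times> 'a" by simp
    show "(R m - R l - - (cmul (m - l) o\<^sub>L R l o\<^sub>L R l)) z = (- (cmul (m - l) o\<^sub>L (R m - R l) o\<^sub>L R l)) z"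
      unfolding p2 p3 p1 by (rule p4)
  qed
  show "norm (R m - R l - - (cmul (m - l) o\<^sub>L R l o\<^sub>L R l)) / norm (m - l) \<le> 4 * M * M * M * norm (m - l)"
    if m: "m \<in> half_plane" "m \<noteq> l" "dist m l < 1" for m
  proof -
    have "norm (R m - R l - - (cmul (m - l) o\<^sub>L R l o\<^sub>L R l)) \<le> norm (cmul (m - l) :: ('a \<times> 'a) \<Rightarrow>\<^sub>L _) * norm (R m - R l) * norm (R l)"
    proof -
      have "norm (cmul (m - l) o\<^sub>L (R m - R l) o\<^sub>L R l) \<le> norm (cmul (m - l) o\<^sub>L (R m - R l)) * norm (R l)"
        by (rule norm_blinfun_compose)
      also have "\<dots> \<le> norm (cmul (m - l) :: ('a \<times> 'a) \<Rightarrow>\<^sub>L _) * norm (R m - R l) * norm (R l)"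
        by (intro mult_right_mono norm_blinfun_compose norm_ge_zero)
      finally show ?thesis unfolding eq[OF m(1)] norm_minus_cancel .
    qed
    also have "\<dots> \<le> (2 * cmod (m - l)) * (2 * M * M * cmod (l - m)) * M"
      using M_ge_1 by (intro mult_mono norm_cmul_blinfun_le resolvent_lipschitz norm_resolvent_le m l) auto
    also have "\<dots> = 4 * M * M * M * cmod (m - l) * cmod (m - l)" by (simp add: norm_minus_commute)
    finally show ?thesis using m(2) by (simp add: divide_le_eq mult_ac)
  qed
  show "((\<lambda>m. 4 * M * M * M * norm (m - l)) \<longlongrightarrow> 0) (at l within half_plane)"
    by (rule tendsto_eq_intros refl | simp)+
qed simp_all

definition pw :: "nat \<Rightarrow> complex \<Rightarrow> 'a \<times> 'a \<Rightarrow> 'a \<times> 'a"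
  where "pw k l z = (blinfun_apply (R l) ^^ k) z"

lemma pw_0 [simp]: "pw 0 l z = z" and pw_Suc: "pw (Suc k) l z = R l (pw k l z)"
  by (simp_all add: pw_def)

lemma pw_Suc': "pw (Suc k) l z = pw k l (R l z)"
  by (simp only: pw_def funpow_Suc_right o_apply)

lemma pw_cmul: "l \<in> half_plane \<Longrightarrow> pw k l (cmul m z) = cmul m (pw k l z)"
  by (induction k) (simp_all add: pw_Suc cmul_commute)

lemma bounded_linear_pw: "bounded_linear (pw k l)"
proof (induction k)
  case (Suc k)
  have "bounded_linear (\<lambda>z. R l (pw k l z))"
    by (rule bounded_linear_compose[OF blinfun.bounded_linear_right Suc])
  then show ?case by (simp add: pw_Suc[abs_def])
qed (simp add: bounded_linear_ident pw_def)

lemma norm_pw_le: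
  assumes "l \<in> half_plane"
  shows "norm (pw k l z) \<le> (M / (1 + cmod l)) ^ k * norm z"
proof (induction k)
  case (Suc k)
  have "norm (pw (Suc k) l z) \<le> M / (1 + cmod l) * norm (pw k l z)"
    unfolding pw_Suc by (rule resolvent_bound[OF assms])
  also have "\<dots> \<le> M / (1 + cmod l) * ((M / (1 + cmod l)) ^ k * norm z)"
    using M_ge_1 by (intro mult_left_mono Suc) auto
  finally show ?case by (simp add: mult_ac)
qed simp

lemma pw_has_derivative:
  assumes l: "l \<in> half_plane"
  shows "((\<lambda>l. pw k l z) has_derivative (\<lambda>d. cmul d (- real k *\<^sub>R pw (Suc k) l z))) (at l within half_plane)"
proof (induction k)
  case (Suc k)
  have "((\<lambda>l. R l (pw k l z)) has_derivative
     (\<lambda>d. R l (cmul d (- real k *\<^sub>R pw (Suc k) l z)) + (- (cmul d o\<^sub>L R l o\<^sub>L R l)) (pw k l z))) (at l within half_plane)"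
    by (rule blinfun.FDERIV[OF resolvent_has_derivative[OF l] Suc])
  moreover have "(\<lambda>d. R l (cmul d (- real k *\<^sub>R pw (Suc k) l z)) + (- (cmul d o\<^sub>L R l o\<^sub>L R l)) (pw k l z))
    = (\<lambda>d. cmul d (- real (Suc k) *\<^sub>R pw (Suc (Suc k)) l z))"
    using l by (auto simp: fun_eq_iff cmul_commute blinfun.minus_left blinfun.minus_right pw_Suc blinfun.scaleR_right blinfun.diff_right algebra_simps)
  ultimately show ?case by (simp only: pw_Suc)
qed (simp add: has_derivative_const)

text \<open>The integrand of the inversion formula, with the resolvent raised to the power
  \<open>k\<close>.\<close>

definition epw :: "nat \<Rightarrow> real \<Rightarrow> 'a \<times> 'a \<Rightarrow> complex \<Rightarrow> 'a \<times> 'a"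
  where "epw k t z l = cmul (exp (of_real t * l)) (pw k l z)"

text \<open>Product rule. The derivative mixes the powers \<open>k\<close> and \<open>Suc k\<close>,
  which is what allows integration by parts.\<close>

lemma epw_has_derivative:
  assumes l: "l \<in> half_plane"
  shows "(epw k t z has_derivative (\<lambda>d. cmul d (t *\<^sub>R epw k t z l - real k *\<^sub>R epw (Suc k) t z l))) (at l within half_plane)"
proof -
  have "((\<lambda>l. exp (of_real t * l)) has_derivative (\<lambda>d. of_real t * d * exp (of_real t * l))) (at l within half_plane)"
    by (auto intro!: derivative_eq_intros)
  then have "((\<lambda>l. cmul (exp (of_real t * l)) :: ('a \<times> 'a) \<Rightarrow>\<^sub>L _) has_derivative (\<lambda>d. cmul (of_real t * d * exp (of_real t * l)))) (at l within half_plane)"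
    by (rule bounded_linear.has_derivative[OF bounded_linear_cmul])
  from blinfun.FDERIV[OF this pw_has_derivative[OF l]]
  have "((\<lambda>l. cmul (exp (of_real t * l)) (pw k l z)) has_derivative
    (\<lambda>d. cmul (exp (of_real t * l)) (cmul d (- real k *\<^sub>R pw (Suc k) l z)) + cmul (of_real t * d * exp (of_real t * l)) (pw k l z))) (at l within half_plane)" .
  moreover have "cmul (exp (of_real t * l)) (cmul d (- real k *\<^sub>R pw (Suc k) l z)) + cmul (of_real t * d * exp (of_real t * l)) (pw k l z)
     = cmul d (t *\<^sub>R epw k t z l - real k *\<^sub>R epw (Suc k) t z l)" for d
  proof -
    have "cmul (exp (of_real t * l)) (cmul d y) = cmul d (cmul (exp (of_real t * l)) y)" for y :: "'a \<times> 'a"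
      by (simp add: mult.commute flip: cmul_mult)
    moreover have "cmul (of_real t * d * exp (of_real t * l)) y = cmul d (t *\<^sub>R cmul (exp (of_real t * l)) y)" for y :: "'a \<times> 'a"
    proof -
      have "of_real t * d * exp (of_real t * l) = d * (of_real t * exp (of_real t * l))" by simp
      then show ?thesis by (simp only: cmul_mult cmul_of_real)
    qed
    ultimately show ?thesis
      by (simp add: epw_def blinfun.scaleR_right blinfun.diff_right blinfun.minus_right)
  qed
  ultimately show ?thesis by (simp add: epw_def[abs_def])
qed

lemma continuous_on_epw: "continuous_on half_plane (epw k t z)"
  by (rule has_derivative_continuous_on[OF epw_has_derivative])

lemma norm_epw_le:
  assumes "l \<in> half_plane"
  shows "norm (epw k t z l) \<le> 2 * exp (t * Re l) * (M / (1 + cmod l)) ^ k * norm z"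
proof -
  have "norm (epw k t z l) \<le> 2 * exp (t * Re l) * norm (pw k l z)"
    unfolding epw_def using norm_cmul_le[of "exp (of_real t * l)" "pw k l z"] by simp
  also have "\<dots> \<le> 2 * exp (t * Re l) * ((M / (1 + cmod l)) ^ k * norm z)"
    by (intro mult_left_mono norm_pw_le assms) simp
  finally show ?thesis by (simp add: mult_ac)
qed

lemma norm_epw_boundary_le:
  assumes N: "N > 0" and c: "0 \<le> c" and y: "\<bar>y\<bar> = N"
  shows "norm (epw k t z (Complex c y)) \<le> 2 * exp (t * c) * (M / N) ^ k * norm z"
proof -
  have "norm (epw k t z (Complex c y)) \<le> 2 * exp (t * c) * (M / (1 + cmod (Complex c y))) ^ k * norm z"
    using norm_epw_le[of "Complex c y" k t z] c by simp
  also have "\<dots> \<le> 2 * exp (t * c) * (M / N) ^ k * norm z"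
  proof -
    have "N \<le> 1 + cmod (Complex c y)" using abs_Im_le_cmod[of "Complex c y"] y by simp
    then have "M / (1 + cmod (Complex c y)) \<le> M / N"
      using N M_ge_1 by (intro divide_left_mono) auto
    moreover have "0 \<le> M / (1 + cmod (Complex c y))" using M_ge_1 by simp
    ultimately show ?thesis by (intro mult_right_mono mult_left_mono power_mono) auto
  qed
  finally show ?thesis .
qed

section \<open>Truncated inversion integrals\<close>

text \<open>For \<open>k = 3\<close> the limit as \<open>N\<close> grows is to be
  \<open>pi * t^2\<close> times the orbit of \<open>z\<close> at time \<open>t\<close>.\<close>

definition W :: "nat \<Rightarrow> real \<Rightarrow> real \<Rightarrow> real \<Rightarrow> 'a \<times> 'a \<Rightarrow> 'a \<times> 'a"
  where "W k c t N z = vline_integral (epw k t z) c N"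

text \<open>The combination is the integral of the derivative of \<open>epw k\<close>, hence a
  boundary term of order \<open>N^-k\<close>.\<close>

lemma W_by_parts:
  assumes c: "0 \<le> c" and N: "N > 0"
  shows "norm (t *\<^sub>R W k c t N z - real k *\<^sub>R W (Suc k) c t N z) \<le> 8 * exp (t * c) * (M / N) ^ k * norm z"
proof -
  have cont: "continuous_on half_plane (\<lambda>l. t *\<^sub>R epw k t z l - real k *\<^sub>R epw (Suc k) t z l)"
    by (intro continuous_intros continuous_on_epw)
  have "vline_integral (\<lambda>l. t *\<^sub>R epw k t z l - real k *\<^sub>R epw (Suc k) t z l) c N
      = t *\<^sub>R W k c t N z - real k *\<^sub>R W (Suc k) c t N z"
    unfolding W_def vline_integral_def
    by (subst Henstock_Kurzweil_Integration.integral_diff)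
      (auto intro!: integrable_cmul vline_integrable[OF continuous_on_epw c])
  moreover have "norm (vline_integral (\<lambda>l. t *\<^sub>R epw k t z l - real k *\<^sub>R epw (Suc k) t z l) c N)
     \<le> 4 * (2 * exp (t * c) * (M / N) ^ k * norm z)"
    using N c by (intro norm_vline_integral_derivative_le[OF epw_has_derivative cont] norm_epw_boundary_le) auto
  ultimately show ?thesis by simp
qed

text \<open>Cauchy's theorem: the two horizontal sides of the rectangle contribute only a term of
  order \<open>N^-k\<close>, so the limit does not depend on the line.\<close>

lemma W_shift:
  assumes c: "0 \<le> a" "a \<le> b" and N: "N > 0" and t: "0 \<le> t"
  shows "norm (W k b t N z - W k a t N z) \<le> 8 * exp (t * b) * (M / N) ^ k * norm z * (b - a)"
proof -
  have cont: "continuous_on half_plane (\<lambda>l. t *\<^sub>R epw k t z l - real k *\<^sub>R epw (Suc k) t z l)"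
    by (intro continuous_intros continuous_on_epw)
  have bd: "norm (epw k t z (Complex c y)) \<le> 2 * exp (t * b) * (M / N) ^ k * norm z"
    if "c \<in> {a..b}" "\<bar>y\<bar> = N" for c y
  proof -
    have "norm (epw k t z (Complex c y)) \<le> 2 * exp (t * c) * (M / N) ^ k * norm z"
      using that c N by (intro norm_epw_boundary_le) auto
    also have "\<dots> \<le> 2 * exp (t * b) * (M / N) ^ k * norm z"
      using that t N M_ge_1 by (intro mult_right_mono mult_left_mono) (auto intro: mult_left_mono)
    finally show ?thesis .
  qed
  have "norm (vline_integral (epw k t z) b N - vline_integral (epw k t z) a N)
      \<le> 4 * (2 * exp (t * b) * (M / N) ^ k * norm z) * (b - a)"
    using N by (intro norm_vline_integral_shift_le[OF epw_has_derivative cont c] bd) auto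
  then show ?thesis by (simp add: W_def)
qed

lemma linear_W:
  assumes "0 \<le> c" shows "linear (W k c t N)"
proof
  fix x y :: "'a \<times> 'a" and r :: real
  have "epw k t (x + y) = (\<lambda>l. epw k t x l + epw k t y l)"
    by (simp add: epw_def fun_eq_iff linear_add[OF bounded_linear.linear[OF bounded_linear_pw]] blinfun.add_right)
  then show "W k c t N (x + y) = W k c t N x + W k c t N y"
    unfolding W_def vline_integral_def
    by (simp add: Henstock_Kurzweil_Integration.integral_add vline_integrable[OF continuous_on_epw assms])
  have "epw k t (r *\<^sub>R x) = (\<lambda>l. r *\<^sub>R epw k t x l)"
    by (simp add: epw_def fun_eq_iff linear_cmul[OF bounded_linear.linear[OF bounded_linear_pw]] blinfun.scaleR_right)
  then show "W k c t N (r *\<^sub>R x) = r *\<^sub>R W k c t N x"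
    unfolding W_def vline_integral_def by simp
qed

end

lemma integral_inverse_square_le:
  fixes c N :: real
  assumes c: "c > 0" and N: "N \<ge> 0"
  shows "(\<lambda>y. 1 / (c\<^sup>2 + y\<^sup>2)) integrable_on {-N..N}"
    and "integral {-N..N} (\<lambda>y. 1 / (c\<^sup>2 + y\<^sup>2)) \<le> pi / c"
proof -
  have pos: "c\<^sup>2 + y\<^sup>2 > 0" for y using c by (simp add: add_pos_nonneg)
  have "((\<lambda>y. 1 / (c\<^sup>2 + y\<^sup>2)) has_integral arctan (N / c) / c - arctan (- N / c) / c) {-N..N}"
  proof (rule fundamental_theorem_of_calculus)
    show "((\<lambda>y. arctan (y / c) / c) has_vector_derivative 1 / (c\<^sup>2 + y\<^sup>2)) (at y within {- N..N})" for y
    proof -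
      have "c * c * (1 + (y / c)\<^sup>2) = c\<^sup>2 + y\<^sup>2"
        using c by (simp add: field_simps power2_eq_square)
      moreover have "((\<lambda>y. arctan (y / c) / c) has_real_derivative 1 / (c * c * (1 + (y / c)\<^sup>2))) (at y within {- N..N})"
        using c by (auto intro!: derivative_eq_intros simp: inverse_eq_divide mult_ac)
      ultimately show ?thesis by (simp add: has_real_derivative_iff_has_vector_derivative)
    qed
  qed (use N in auto)
  moreover have "arctan (N / c) / c - arctan (- N / c) / c \<le> (pi / 2 - - (pi / 2)) / c"
    unfolding diff_divide_distrib[symmetric] using arctan_bounded[of "N / c"] arctan_bounded[of "- N / c"] c
    by (intro divide_right_mono) auto
  ultimately show "(\<lambda>y. 1 / (c\<^sup>2 + y\<^sup>2)) integrable_on {-N..N}"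
    and "integral {-N..N} (\<lambda>y. 1 / (c\<^sup>2 + y\<^sup>2)) \<le> pi / c"
    by (auto simp: integral_unique has_integral_integrable)
qed

lemma norm_vline_integral_le:
  fixes F :: "complex \<Rightarrow> 'a::banach"
  assumes F: "(\<lambda>y. F (Complex c y)) integrable_on {-N..N}" and d: "d > 0" and N: "N \<ge> 0"
    and le: "\<And>y. norm (F (Complex c y)) \<le> K * (1 / (d\<^sup>2 + y\<^sup>2))" and K: "0 \<le> K"
  shows "norm (vline_integral F c N) \<le> K * (pi / d)"
proof -
  have "norm (vline_integral F c N) \<le> integral {-N..N} (\<lambda>y. K * (1 / (d\<^sup>2 + y\<^sup>2)))"
    unfolding vline_integral_def
    using integral_inverse_square_le(1)[OF d N]
    by (intro integral_norm_bound_integral F integrable_on_mult_right le) auto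
  also have "\<dots> = K * integral {-N..N} (\<lambda>y. 1 / (d\<^sup>2 + y\<^sup>2))"
    by (rule integral_mult_right)
  also have "\<dots> \<le> K * (pi / d)"
    by (intro mult_left_mono integral_inverse_square_le d N K)
  finally show ?thesis .
qed

context half_plane_resolvent
begin

lemma resolvent_power_le:
  assumes "L > 0" "L \<le> 1 + cmod l"
  shows "(M / (1 + cmod l)) ^ k \<le> M ^ k / L ^ k"
proof -
  have "(M / (1 + cmod l)) ^ k \<le> (M / L) ^ k"
    using assms M_ge_1 by (intro power_mono divide_left_mono) auto
  then show ?thesis by (simp add: power_divide)
qed

lemma epw_vline_integrable:
  "0 \<le> c \<Longrightarrow> (\<lambda>y. epw k t z (Complex c y)) integrable_on {a..b}"
  by (rule vline_integrable[OF continuous_on_epw])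

text \<open>On this line the exponential has modulus \<open>e\<close>, and
  \<open>|l| \<ge> 1 / t\<close> gives \<open>|l|^-3 \<le> t |l|^-2\<close>. The integral of
  \<open>|l|^-2\<close> is at most \<open>pi * t\<close>.\<close>

lemma norm_W_reciprocal_le:
  assumes t: "t > 0" and N: "N \<ge> 0"
  shows "norm (W 3 (1 / t) t N z) \<le> 2 * exp 1 * M ^ 3 * norm z * pi * t\<^sup>2"
proof -
  have "norm (W 3 (1 / t) t N z) \<le> (2 * exp 1 * M ^ 3 * norm z * t) * (pi / (1 / t))"
    unfolding W_def
  proof (rule norm_vline_integral_le)
    fix y
    define l where "l = Complex (1 / t) y"
    have l: "l \<in> half_plane" using t by (simp add: l_def)
    have l2: "(cmod l)\<^sup>2 = (1 / t)\<^sup>2 + y\<^sup>2" by (simp add: l_def cmod_power2)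
    have lt: "cmod l \<ge> 1 / t" using complex_Re_le_cmod[of l] by (simp add: l_def)
    then have lpos: "cmod l > 0" using t by (meson divide_pos_pos less_le_trans zero_less_one)
    have "norm (epw 3 t z l) \<le> 2 * exp (t * Re l) * (M / (1 + cmod l)) ^ 3 * norm z"
      by (rule norm_epw_le[OF l])
    also have "\<dots> \<le> 2 * exp 1 * (M ^ 3 / cmod l ^ 3) * norm z"
      using t lpos M_ge_1 resolvent_power_le[of "cmod l" l 3]
      by (intro mult_right_mono mult_mono) (auto simp: l_def)
    also have "\<dots> \<le> 2 * exp 1 * (M ^ 3 * (t / (cmod l)\<^sup>2)) * norm z"
    proof (intro mult_right_mono mult_left_mono)
      have "1 / cmod l \<le> t" using lt t lpos by (simp add: field_simps)
      then have "(1 / cmod l) / (cmod l)\<^sup>2 \<le> t / (cmod l)\<^sup>2" by (intro divide_right_mono) auto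
      then have "1 / cmod l ^ 3 \<le> t / (cmod l)\<^sup>2" by (simp add: power3_eq_cube power2_eq_square)
      then have "M ^ 3 * (1 / cmod l ^ 3) \<le> M ^ 3 * (t / (cmod l)\<^sup>2)"
        using M_ge_1 by (intro mult_left_mono) auto
      then show "M ^ 3 / cmod l ^ 3 \<le> M ^ 3 * (t / (cmod l)\<^sup>2)" by simp
    qed auto
    finally show "norm (epw 3 t z (Complex (1 / t) y)) \<le> 2 * exp 1 * M ^ 3 * norm z * t * (1 / ((1 / t)\<^sup>2 + y\<^sup>2))"
      unfolding l2[symmetric] by (simp add: l_def mult_ac)
  qed (use t N M_ge_1 in \<open>auto intro: epw_vline_integrable\<close>)
  also have "\<dots> = 2 * exp 1 * M ^ 3 * norm z * pi * t\<^sup>2" by (simp add: power2_eq_square)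
  finally show ?thesis .
qed

text \<open>On the imaginary axis the exponential has modulus 1 and the cubed resolvent is
  integrable by itself, so the bound is uniform in \<open>t\<close>. Division by
  \<open>pi * t^2\<close> later turns it into decay.\<close>

lemma norm_W_zero_le:
  assumes N: "N \<ge> 0"
  shows "norm (W 3 0 t N z) \<le> 2 * M ^ 3 * norm z * pi"
proof -
  have "norm (W 3 0 t N z) \<le> (2 * M ^ 3 * norm z) * (pi / 1)"
    unfolding W_def
  proof (rule norm_vline_integral_le)
    fix y
    define l where "l = Complex 0 y"
    have l: "l \<in> half_plane" by (simp add: l_def)
    have cl: "cmod l = \<bar>y\<bar>" by (simp add: l_def cmod_def)
    have "norm (epw 3 t z l) \<le> 2 * exp (t * Re l) * (M / (1 + cmod l)) ^ 3 * norm z"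
      by (rule norm_epw_le[OF l])
    also have "\<dots> \<le> 2 * exp (t * Re l) * (M ^ 3 * (1 / (1\<^sup>2 + y\<^sup>2))) * norm z"
    proof (intro mult_right_mono mult_left_mono)
      have "1 + y\<^sup>2 \<le> (1 + \<bar>y\<bar>) * (1 + \<bar>y\<bar>)\<^sup>2"
      proof -
        have "1 + y\<^sup>2 \<le> (1 + \<bar>y\<bar>)\<^sup>2" by (simp add: power2_eq_square algebra_simps)
        also have "\<dots> \<le> (1 + \<bar>y\<bar>) * (1 + \<bar>y\<bar>)\<^sup>2" by (simp add: mult_le_cancel_right1)
        finally show ?thesis .
      qed
      then have "M ^ 3 / (1 + cmod l) ^ 3 \<le> M ^ 3 / (1 + y\<^sup>2)"
        using M_ge_1 unfolding cl by (intro divide_left_mono) (auto simp: power3_eq_cube power2_eq_square add_pos_nonneg mult_ac)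
      then show "(M / (1 + cmod l)) ^ 3 \<le> M ^ 3 * (1 / (1\<^sup>2 + y\<^sup>2))"
        by (simp add: power_divide)
    qed auto
    finally show "norm (epw 3 t z (Complex 0 y)) \<le> 2 * M ^ 3 * norm z * (1 / (1\<^sup>2 + y\<^sup>2))"
      by (simp add: l_def mult_ac)
  qed (use N M_ge_1 in \<open>auto intro: epw_vline_integrable\<close>)
  then show ?thesis by (simp add: mult_ac)
qed

lemma W_shift_tendsto:
  assumes "0 \<le> a" "0 \<le> b" and t: "0 \<le> t"
  shows "((\<lambda>N. W 3 a t N z - W 3 b t N z) \<longlongrightarrow> 0) at_top"
proof -
  have *: "((\<lambda>N. W 3 b t N z - W 3 a t N z) \<longlongrightarrow> 0) at_top" if "0 \<le> a" "a \<le> b" for a b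
  proof (rule Lim_null_comparison)
    show "\<forall>\<^sub>F N in at_top. norm (W 3 b t N z - W 3 a t N z) \<le> 8 * exp (t * b) * (M / N) ^ 3 * norm z * (b - a)"
      using eventually_gt_at_top[of 0] by eventually_elim (rule W_shift[OF that _ t])
    have "((\<lambda>N. M / N) \<longlongrightarrow> 0) at_top" by real_asymp
    then have "((\<lambda>N. 8 * exp (t * b) * (M / N) ^ 3 * norm z * (b - a)) \<longlongrightarrow> 8 * exp (t * b) * 0 ^ 3 * norm z * (b - a)) at_top"
      by (intro tendsto_intros)
    then show "((\<lambda>N. 8 * exp (t * b) * (M / N) ^ 3 * norm z * (b - a)) \<longlongrightarrow> 0) at_top" by simp
  qed
  show ?thesis
  proof (cases "a \<le> b")
    case True
    then show ?thesis using tendsto_minus[OF *[of a b]] assms by simp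
  next
    case False
    then show ?thesis using *[of b a] assms by simp
  qed
qed

text \<open>The condition on \<open>y\<close> and \<open>v\<close> says that \<open>y\<close> lies in the domain of the generator \<open>B\<close> and
  \<open>B y = v\<close>.\<close>

lemma pw_expansion:
  assumes l: "l \<in> half_plane" "l \<noteq> 0" and y: "R l (cmul l y) - R l v = y"
  shows "pw (Suc k) l y = cmul (inverse l) (pw k l y + pw (Suc k) l v)"
proof -
  have "cmul l (R l y) = y + R l v"
    using y cmul_commute[OF l(1), of l y] by (simp add: algebra_simps)
  then have "R l y = cmul (inverse l) (y + R l v)"
    using cmul_inverse[OF l(2), of "R l y"] by simp
  then show ?thesis
    by (simp add: pw_Suc' pw_cmul[OF l(1)] linear_add[OF bounded_linear.linear[OF bounded_linear_pw]])
qed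

text \<open>Repeated use of \<open>pw_expansion\<close> gives
  \<open>R^3 y = l^-3 y + l^-3 R v + l^-2 R^2 v + l^-1 R^3 v\<close>. The three error terms are of
  order \<open>|l|^-4\<close>, which gains a factor \<open>t\<close> over the main term
  \<open>pi * t^2\<close>; this is the initial condition in the inversion formula.\<close>

lemma norm_W_start_le:
  assumes t: "t > 0" and N: "N \<ge> 0"
    and y: "\<And>l. l \<in> half_plane \<Longrightarrow> R l (cmul l y) - R l v = y"
  shows "norm (W 3 (1 / t) t N y - cmul (integral {-N..N} (\<lambda>x. exp (of_real t * Complex (1 / t) x) / Complex (1 / t) x ^ 3)) y)
    \<le> 12 * exp 1 * M ^ 3 * norm v * pi * t ^ 3"
proof -
  define q where "q l = exp (of_real t * l) / l ^ 3" for l :: complex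
  define c where "c = 1 / t"
  have c: "c > 0" using t by (simp add: c_def)
  have qi: "(\<lambda>x. q (Complex c x)) integrable_on {-N..N}"
  proof -
    have "Complex c x \<noteq> 0" for x using c by (simp add: complex_eq_iff)
    then show ?thesis
      unfolding q_def by (intro integrable_continuous_interval continuous_intros) auto
  qed
  have bl: "bounded_linear (\<lambda>u. cmul u y)"
    by (rule bounded_linear_compose[OF blinfun.bounded_linear_left bounded_linear_cmul])
  have qi': "(\<lambda>x. cmul (q (Complex c x)) y) integrable_on {-N..N}"
    using integrable_linear[OF qi bl] by (simp add: o_def)
  have "cmul (integral {-N..N} (\<lambda>x. q (Complex c x))) y = vline_integral (\<lambda>l. cmul (q l) y) c N"
    unfolding vline_integral_def using integral_linear[OF qi bl] by (simp add: o_def)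
  then have eq: "W 3 c t N y - cmul (integral {-N..N} (\<lambda>x. q (Complex c x))) y
     = vline_integral (\<lambda>l. epw 3 t y l - cmul (q l) y) c N"
    unfolding W_def vline_integral_def
    using c by (simp add: Henstock_Kurzweil_Integration.integral_diff[OF epw_vline_integrable qi'])
  have "norm (vline_integral (\<lambda>l. epw 3 t y l - cmul (q l) y) c N) \<le> (12 * exp 1 * M ^ 3 * norm v * t\<^sup>2) * (pi / c)"
  proof (rule norm_vline_integral_le)
    fix x
    define l where "l = Complex c x"
    have l: "l \<in> half_plane" "l \<noteq> 0" using c by (auto simp: l_def complex_eq_iff)
    have l2: "(cmod l)\<^sup>2 = c\<^sup>2 + x\<^sup>2" by (simp add: l_def cmod_power2)
    have lt: "cmod l \<ge> c" using complex_Re_le_cmod[of l] by (simp add: l_def)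
    have lpos: "cmod l > 0" using l by simp
    note ex = pw_expansion[OF l y[OF l(1)]]
    define i where "i = inverse l"
    have three: "(3::nat) = Suc (Suc (Suc 0))" by simp
    have pe: "pw 3 l y - cmul (i ^ 3) y = cmul (i ^ 3) (pw 1 l v) + cmul (i ^ 2) (pw 2 l v) + cmul i (pw 3 l v)"
      unfolding three ex i_def[symmetric]
      by (simp add: blinfun.add_right power2_eq_square numeral_2_eq_2 flip: cmul_mult)
    have "norm (cmul (i ^ j) (pw k l v)) \<le> 2 * M ^ 3 / cmod l ^ 4 * norm v" if "j + k = 4" "k \<le> 3" for j k
    proof -
      have "norm (cmul (i ^ j) (pw k l v)) \<le> 2 * cmod (i ^ j) * norm (pw k l v)" by (rule norm_cmul_le)
      also have "\<dots> \<le> 2 * (1 / cmod l ^ j) * ((M ^ 3 / cmod l ^ k) * norm v)"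
      proof (intro mult_mono)
        have "norm (pw k l v) \<le> (M / (1 + cmod l)) ^ k * norm v" by (rule norm_pw_le[OF l(1)])
        also have "\<dots> \<le> (M ^ k / cmod l ^ k) * norm v"
          by (intro mult_right_mono resolvent_power_le lpos) auto
        also have "\<dots> \<le> (M ^ 3 / cmod l ^ k) * norm v"
          using M_ge_1 that by (intro mult_right_mono divide_right_mono power_increasing) auto
        finally show "norm (pw k l v) \<le> M ^ 3 / cmod l ^ k * norm v" .
      qed (auto simp: i_def norm_power norm_inverse norm_divide inverse_eq_divide power_one_over)
      also have "\<dots> = 2 * M ^ 3 / (cmod l ^ j * cmod l ^ k) * norm v" by simp
      also have "cmod l ^ j * cmod l ^ k = cmod l ^ 4" by (simp flip: power_add add: that)
      finally show ?thesis .
    qed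
    from this[of 3 1] this[of 2 2] this[of 1 3]
    have "norm (cmul (i ^ 3) (pw 1 l v)) \<le> 2 * M ^ 3 / cmod l ^ 4 * norm v"
      "norm (cmul (i ^ 2) (pw 2 l v)) \<le> 2 * M ^ 3 / cmod l ^ 4 * norm v"
      "norm (cmul i (pw 3 l v)) \<le> 2 * M ^ 3 / cmod l ^ 4 * norm v" by auto
    moreover have "6 * M ^ 3 / cmod l ^ 4 * norm v = 3 * (2 * M ^ 3 / cmod l ^ 4 * norm v)" by simp
    ultimately have n: "norm (pw 3 l y - cmul (i ^ 3) y) \<le> 6 * M ^ 3 / cmod l ^ 4 * norm v"
      using norm_triangle_ineq[of "cmul (i ^ 3) (pw 1 l v) + cmul (i ^ 2) (pw 2 l v)" "cmul i (pw 3 l v)"]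
        norm_triangle_ineq[of "cmul (i ^ 3) (pw 1 l v)" "cmul (i ^ 2) (pw 2 l v)"]
      unfolding pe by linarith
    have "q l = exp (of_real t * l) * i ^ 3" by (simp add: q_def i_def power_inverse divide_inverse)
    then have "epw 3 t y l - cmul (q l) y = cmul (exp (of_real t * l)) (pw 3 l y - cmul (i ^ 3) y)"
      by (simp add: epw_def blinfun.diff_right cmul_mult)
    then have "norm (epw 3 t y l - cmul (q l) y) \<le> 2 * cmod (exp (of_real t * l)) * norm (pw 3 l y - cmul (i ^ 3) y)"
      by (simp only: norm_cmul_le)
    also have "\<dots> \<le> 2 * exp 1 * (6 * M ^ 3 / cmod l ^ 4 * norm v)"
      using n t by (intro mult_mono) (auto simp: l_def c_def)
    also have "\<dots> = 12 * exp 1 * M ^ 3 * norm v * (1 / (cmod l)\<^sup>2) * (1 / (cmod l)\<^sup>2)"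
      by (simp add: power2_eq_square power4_eq_xxxx)
    also have "\<dots> \<le> 12 * exp 1 * M ^ 3 * norm v * t\<^sup>2 * (1 / (cmod l)\<^sup>2)"
    proof (intro mult_right_mono mult_left_mono)
      have "1 / cmod l \<le> t" using lt t lpos by (simp add: field_simps c_def)
      then have "(1 / cmod l)\<^sup>2 \<le> t\<^sup>2" by (intro power_mono) auto
      then show "1 / (cmod l)\<^sup>2 \<le> t\<^sup>2" by (simp add: power_one_over)
    qed (use M_ge_1 in auto)
    finally show "norm (epw 3 t y (Complex c x) - cmul (q (Complex c x)) y)
        \<le> 12 * exp 1 * M ^ 3 * norm v * t\<^sup>2 * (1 / (c\<^sup>2 + x\<^sup>2))"
      unfolding l2[symmetric] l_def .
  qed (use c N M_ge_1 qi' in \<open>auto intro!: epw_vline_integrable Henstock_Kurzweil_Integration.integrable_diff\<close>)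
  also have "\<dots> = 12 * exp 1 * M ^ 3 * norm v * pi * t ^ 3"
    by (simp add: c_def power2_eq_square power3_eq_cube)
  finally show ?thesis unfolding eq[symmetric] by (simp add: c_def q_def)
qed

lemma continuous_on_pw2:
  assumes f: "continuous_on S f" "f ` S \<subseteq> half_plane" and g: "continuous_on S g"
  shows "continuous_on S (\<lambda>x. pw k (f x) (g x))"
proof (induction k)
  case (Suc k)
  have "continuous_on half_plane R"
    by (rule has_derivative_continuous_on[OF resolvent_has_derivative])
  from continuous_on_compose2[OF this f]
  have "continuous_on S (\<lambda>x. R (f x))" .
  from blinfun.continuous_on[OF this Suc] show ?case by (simp add: pw_Suc)
qed (simp add: g)

text \<open>As \<open>\<phi>\<close> solves \<open>\<phi>' = B \<phi>\<close>, differentiating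
  produces the factor \<open>B - l\<close>, which cancels one resolvent.\<close>

lemma epw_semigroup_derivative:
  assumes l: "l \<in> half_plane" and \<phi>: "(\<phi> has_vector_derivative v) (at s within S)"
    and v: "R l (cmul l (\<phi> s)) - R l v = \<phi> s"
  shows "((\<lambda>s. epw (Suc k) (t - s) (\<phi> s) l) has_vector_derivative - epw k (t - s) (\<phi> s) l) (at s within S)"
proof -
  define e where "e s = exp (of_real (t - s) * l)" for s
  have e': "(e has_vector_derivative - (l * e s)) (at s within S)"
  proof -
    have "((\<lambda>x. exp ((of_real t - x) * l)) has_field_derivative - (l * exp ((of_real t - of_real s) * l))) (at (of_real s) within of_real ` S)"
      by (auto intro!: derivative_eq_intros)
    moreover have "((of_real :: real \<Rightarrow> complex) has_vector_derivative 1) (at s within S)"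
    proof -
      have "((\<lambda>x. x *\<^sub>R (1 :: complex)) has_vector_derivative 1) (at s within S)"
        by (auto intro!: derivative_eq_intros)
      then show ?thesis by (simp add: scaleR_conv_of_real)
    qed
    ultimately show ?thesis
      using field_vector_diff_chain_within[of of_real "1 :: complex" s S]
      by (fastforce simp: o_def e_def[abs_def])
  qed
  have p': "((\<lambda>s. pw (Suc k) l (\<phi> s)) has_vector_derivative pw (Suc k) l v) (at s within S)"
    by (rule bounded_linear.has_vector_derivative[OF bounded_linear_pw \<phi>])
  have "((\<lambda>s. cmul (e s) (pw (Suc k) l (\<phi> s))) has_vector_derivative
    cmul (e s) (pw (Suc k) l v) + cmul (- (l * e s)) (pw (Suc k) l (\<phi> s))) (at s within S)"
    by (rule blinfun.has_vector_derivative[OF bounded_linear.has_vector_derivative[OF bounded_linear_cmul e'] p'])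
  moreover have "cmul (e s) (pw (Suc k) l v) + cmul (- (l * e s)) (pw (Suc k) l (\<phi> s)) = - cmul (e s) (pw k l (\<phi> s))"
  proof -
    have "cmul (- (l * e s)) (pw (Suc k) l (\<phi> s)) = - cmul (e s) (pw (Suc k) l (cmul l (\<phi> s)))"
      by (simp add: cmul_neg blinfun.minus_left pw_cmul[OF l] mult.commute flip: cmul_mult)
    moreover have "pw (Suc k) l (cmul l (\<phi> s)) - pw (Suc k) l v = pw k l (\<phi> s)"
      using v by (simp add: pw_Suc' flip: linear_diff[OF bounded_linear.linear[OF bounded_linear_pw]])
    then have "pw (Suc k) l (cmul l (\<phi> s)) = pw (Suc k) l v + pw k l (\<phi> s)" by (simp add: algebra_simps)
    ultimately show ?thesis by (simp add: blinfun.add_right)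
  qed
  ultimately show ?thesis by (simp add: epw_def e_def)
qed

text \<open>The derivative in \<open>s\<close> of \<open>(t - s)^-2\<close> times
  \<open>W 3 c (t - s) N (\<phi> s)\<close> is a multiple of the boundary term of
  \<open>W_by_parts\<close>, so the quantity is constant in the limit. Stopping at
  \<open>s = t - d\<close> keeps \<open>t - s\<close> away from 0.\<close>

lemma W_along_orbit_tendsto:
  assumes \<phi>: "\<And>s. s \<ge> 0 \<Longrightarrow> (\<phi> has_vector_derivative \<psi> s) (at s within {0..})"
    and \<psi>: "\<And>s l. s \<ge> 0 \<Longrightarrow> l \<in> half_plane \<Longrightarrow> R l (cmul l (\<phi> s)) - R l (\<psi> s) = \<phi> s"
    and c: "0 \<le> c" and d: "0 < d" "d < t"
  shows "((\<lambda>N. (1 / d\<^sup>2) *\<^sub>R W 3 c d N (\<phi> (t - d)) - (1 / t\<^sup>2) *\<^sub>R W 3 c t N (\<phi> 0)) \<longlongrightarrow> 0) at_top"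
proof -
  define r where "r = t - d"
  have r: "0 < r" "r < t" "\<And>s. s \<in> {0..r} \<Longrightarrow> d \<le> t - s" using d by (auto simp: r_def)
  have \<phi>r: "(\<phi> has_vector_derivative \<psi> s) (at s within {0..r})" if "s \<in> {0..r}" for s
    by (rule has_vector_derivative_within_subset[OF \<phi>]) (use that in auto)
  have \<phi>c: "continuous_on {0..r} \<phi>"
    using \<phi>r by (meson continuous_on_eq_continuous_within has_vector_derivative_continuous)
  have "compact (\<phi> ` {0..r})" by (rule compact_continuous_image[OF \<phi>c]) simp
  then obtain B where B: "\<And>s. s \<in> {0..r} \<Longrightarrow> norm (\<phi> s) \<le> B" "0 < B"
    using compact_imp_bounded bounded_pos by (metis imageI)
  have main: "norm ((1 / d\<^sup>2) *\<^sub>R W 3 c d N (\<phi> (t - d)) - (1 / t\<^sup>2) *\<^sub>R W 3 c t N (\<phi> 0))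
      \<le> 1 / d ^ 3 * (8 * exp (t * c) * (M / N)\<^sup>2 * B) * r" if N: "N > 0" for N
  proof -
    have W': "((\<lambda>s. W 3 c (t - s) N (\<phi> s)) has_vector_derivative - W 2 c (t - s) N (\<phi> s)) (at s within {0..r})"
      if s: "s \<in> {0..r}" for s
    proof -
      have "((\<lambda>s. integral (cbox (-N) N) (\<lambda>y. epw 3 (t - s) (\<phi> s) (Complex c y))) has_vector_derivative
          integral (cbox (-N) N) (\<lambda>y. - epw 2 (t - s) (\<phi> s) (Complex c y))) (at s within {0..r})"
      proof (rule leibniz_rule_vector_derivative)
        fix u y assume u: "u \<in> {0..r}"
        then have "u \<ge> 0" by simp
        have "((\<lambda>s. epw (Suc 2) (t - s) (\<phi> s) (Complex c y)) has_vector_derivative - epw 2 (t - u) (\<phi> u) (Complex c y)) (at u within {0..r})"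
          by (rule epw_semigroup_derivative[OF _ \<phi>r[OF u] \<psi>[OF \<open>u \<ge> 0\<close>]]) (use c in auto)
        then show "((\<lambda>s. epw 3 (t - s) (\<phi> s) (Complex c y)) has_vector_derivative - epw 2 (t - u) (\<phi> u) (Complex c y)) (at u within {0..r})"
          by simp
        show "(\<lambda>y. epw 3 (t - u) (\<phi> u) (Complex c y)) integrable_on cbox (- N) N"
          using epw_vline_integrable[OF c] by simp
      next
        have "continuous_on ({0..r} \<times> cbox (- N) N)
          (\<lambda>p. - cmul (exp (of_real (t - fst p) * Complex c (snd p))) (pw 2 (Complex c (snd p)) (\<phi> (fst p))))"
          by (intro continuous_intros continuous_on_pw2 bounded_linear.continuous_on[OF bounded_linear_cmul]
              blinfun.continuous_on continuous_on_compose2[OF \<phi>c]) (use c in auto)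
        then show "continuous_on ({0..r} \<times> cbox (- N) N) (\<lambda>(s, y). - epw 2 (t - s) (\<phi> s) (Complex c y))"
          by (simp add: split_beta epw_def)
      qed (use s in auto)
      then show ?thesis by (simp add: W_def vline_integral_def)
    qed
    define g where "g s = (1 / (t - s)\<^sup>2) *\<^sub>R W 3 c (t - s) N (\<phi> s)" for s
    have "norm (g r - g 0) \<le> 1 / d ^ 3 * (8 * exp (t * c) * (M / N)\<^sup>2 * B) * \<bar>r - 0\<bar>"
    proof (rule vector_derivative_bound[where a = 0 and b = r
          and f' = "\<lambda>s. - ((1 / (t - s) ^ 3) *\<^sub>R ((t - s) *\<^sub>R W 2 c (t - s) N (\<phi> s) - real 2 *\<^sub>R W (Suc 2) c (t - s) N (\<phi> s)))"])
      fix s assume s: "s \<in> {0..r}"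
      then have ts: "t - s > 0" using r(3)[OF s] d by simp
      have h: "((\<lambda>s. 1 / (t - s)\<^sup>2) has_vector_derivative 2 / (t - s) ^ 3) (at s within {0..r})"
        unfolding has_real_derivative_iff_has_vector_derivative[symmetric]
      proof -
        have "t - s \<noteq> 0" using ts by simp
        moreover have "2 * t - 2 * s = 2 * (t - s)" by simp
        ultimately have k: "(2 * t - 2 * s) / (t - s) ^ 4 = 2 / ((t - s) * (t - s) * (t - s))"
          by (simp only: power4_eq_xxxx) (simp add: divide_simps)
        from \<open>t - s \<noteq> 0\<close> show "((\<lambda>s. 1 / (t - s)\<^sup>2) has_real_derivative 2 / (t - s) ^ 3) (at s within {0..r})"
          by (auto intro!: derivative_eq_intros)
            (simp add: power2_eq_square power3_eq_cube k)
      qed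
      have "(g has_vector_derivative ((1 / (t - s)\<^sup>2) *\<^sub>R (- W 2 c (t - s) N (\<phi> s)) + (2 / (t - s) ^ 3) *\<^sub>R W 3 c (t - s) N (\<phi> s))) (at s within {0..r})"
        unfolding g_def by (rule bounded_bilinear.has_vector_derivative[OF bounded_bilinear_scaleR h W'[OF s]])
      moreover have "(1 / (t - s)\<^sup>2) *\<^sub>R (- W 2 c (t - s) N (\<phi> s)) + (2 / (t - s) ^ 3) *\<^sub>R W 3 c (t - s) N (\<phi> s)
         = - ((1 / (t - s) ^ 3) *\<^sub>R ((t - s) *\<^sub>R W 2 c (t - s) N (\<phi> s) - real 2 *\<^sub>R W (Suc 2) c (t - s) N (\<phi> s)))"
        using ts by (simp add: scaleR_diff_right power2_eq_square power3_eq_cube numeral_3_eq_3 numeral_2_eq_2)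
      ultimately show "(g has_vector_derivative - ((1 / (t - s) ^ 3) *\<^sub>R ((t - s) *\<^sub>R W 2 c (t - s) N (\<phi> s) - real 2 *\<^sub>R W (Suc 2) c (t - s) N (\<phi> s)))) (at s within {0..r})"
        by simp
      have "norm ((t - s) *\<^sub>R W 2 c (t - s) N (\<phi> s) - real 2 *\<^sub>R W (Suc 2) c (t - s) N (\<phi> s)) \<le> 8 * exp ((t - s) * c) * (M / N)\<^sup>2 * norm (\<phi> s)"
        by (rule W_by_parts[OF c N])
      also have "\<dots> \<le> 8 * exp (t * c) * (M / N)\<^sup>2 * B"
        using s c B by (intro mult_mono) (auto intro!: mult_right_mono)
      finally have "1 / (t - s) ^ 3 * norm ((t - s) *\<^sub>R W 2 c (t - s) N (\<phi> s) - real 2 *\<^sub>R W (Suc 2) c (t - s) N (\<phi> s))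
        \<le> 1 / d ^ 3 * (8 * exp (t * c) * (M / N)\<^sup>2 * B)"
        using r(3)[OF s] d B(2) ts by (intro mult_mono divide_left_mono power_mono mult_pos_pos) auto
      then show "norm (- ((1 / (t - s) ^ 3) *\<^sub>R ((t - s) *\<^sub>R W 2 c (t - s) N (\<phi> s) - real 2 *\<^sub>R W (Suc 2) c (t - s) N (\<phi> s)))) \<le> 1 / d ^ 3 * (8 * exp (t * c) * (M / N)\<^sup>2 * B)"
        using ts by simp
    qed (use r in auto)
    then show ?thesis using r by (simp add: g_def) (simp add: r_def)
  qed
  show ?thesis
  proof (rule Lim_null_comparison)
    show "\<forall>\<^sub>F N in at_top. norm ((1 / d\<^sup>2) *\<^sub>R W 3 c d N (\<phi> (t - d)) - (1 / t\<^sup>2) *\<^sub>R W 3 c t N (\<phi> 0))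
        \<le> 1 / d ^ 3 * (8 * exp (t * c) * (M / N)\<^sup>2 * B) * r"
      using eventually_gt_at_top[of 0] by eventually_elim (rule main)
    have "((\<lambda>N. M / N) \<longlongrightarrow> 0) at_top" by real_asymp
    then have "((\<lambda>N. 1 / d ^ 3 * (8 * exp (t * c) * (M / N)\<^sup>2 * B) * r) \<longlongrightarrow> 1 / d ^ 3 * (8 * exp (t * c) * 0\<^sup>2 * B) * r) at_top"
      by (intro tendsto_intros)
    then show "((\<lambda>N. 1 / d ^ 3 * (8 * exp (t * c) * (M / N)\<^sup>2 * B) * r) \<longlongrightarrow> 0) at_top" by simp
  qed
qed

text \<open>Up to errors vanishing as \<open>N \<rightarrow> \<infinity>\<close>, the left hand side
  does not depend on \<open>c\<close>, and on the line \<open>Re l = 1 / d\<close> it can be transported along the orbit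
  to the time \<open>t - d\<close>, where it is close to \<open>\<phi> t\<close> for small \<open>d\<close>.\<close>

lemma inverse_Laplace:
  assumes \<phi>: "\<And>s. s \<ge> 0 \<Longrightarrow> (\<phi> has_vector_derivative \<psi> s) (at s within {0..})"
    and \<psi>: "\<And>s l. s \<ge> 0 \<Longrightarrow> l \<in> half_plane \<Longrightarrow> R l (cmul l (\<phi> s)) - R l (\<psi> s) = \<phi> s"
    and c: "0 \<le> c" and t: "0 < t"
  shows "((\<lambda>N. (1 / (pi * t\<^sup>2)) *\<^sub>R W 3 c t N (\<phi> 0)) \<longlongrightarrow> \<phi> t) at_top"
proof (rule tendstoI)
  fix e :: real assume e: "e > 0"
  define K1 where "K1 = 2 * exp 1 * M ^ 3"
  define K2 where "K2 = 12 * exp 1 * M ^ 3 * norm (\<psi> t)"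
  have K: "K1 \<ge> 0" "K2 \<ge> 0" using M_ge_1 by (auto simp: K1_def K2_def)
  have \<phi>t: "continuous (at t within {0..}) \<phi>"
    using has_vector_derivative_continuous[OF \<phi>] t by simp
  have \<phi>lim: "((\<lambda>d. \<phi> (t - d)) \<longlongrightarrow> \<phi> t) (at_right 0)"
  proof (rule isCont_tendsto_compose[where g = \<phi> and f = "\<lambda>d. t - d"])
    show "isCont \<phi> t" 
    proof -
      have "at t within {0..} = at t" by (rule at_within_interior) (use t in simp)
      then show ?thesis using \<phi>t by simp
    qed
    have "((\<lambda>d::real. t - d) \<longlongrightarrow> t - 0) (at_right 0)" by (rule tendsto_diff[OF tendsto_const tendsto_ident_at])
    then show "((\<lambda>d. t - d) \<longlongrightarrow> t) (at_right 0)" by simp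
  qed
  have "((\<lambda>d. K1 * norm (\<phi> (t - d) - \<phi> t)) \<longlongrightarrow> K1 * norm (\<phi> t - \<phi> t)) (at_right 0)"
    by (rule tendsto_mult[OF tendsto_const tendsto_norm[OF tendsto_diff[OF \<phi>lim tendsto_const]]])
  then have "\<forall>\<^sub>F d in at_right 0. K1 * norm (\<phi> (t - d) - \<phi> t) < e / 5"
    using e by (intro order_tendstoD) auto
  moreover have "((\<lambda>d. K2 * d) \<longlongrightarrow> K2 * 0) (at_right 0)" by (intro tendsto_intros)
  then have "\<forall>\<^sub>F d in at_right 0. K2 * d < e / 5"
    using e by (intro order_tendstoD) auto
  moreover have "\<forall>\<^sub>F d in at_right 0. d < t"
    using t by (auto simp: eventually_at_right_field)
  moreover have "\<forall>\<^sub>F d in at_right 0. (0::real) < d"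
    by (simp add: eventually_at_right_less)
  ultimately have "\<forall>\<^sub>F d in at_right 0. K1 * norm (\<phi> (t - d) - \<phi> t) < e / 5 \<and> K2 * d < e / 5 \<and> d < t \<and> 0 < d"
    by eventually_elim auto
  then have "\<exists>d. K1 * norm (\<phi> (t - d) - \<phi> t) < e / 5 \<and> K2 * d < e / 5 \<and> d < t \<and> 0 < d"
    by (rule eventually_happens'[OF trivial_limit_at_right_real])
  then obtain d where d: "K1 * norm (\<phi> (t - d) - \<phi> t) < e / 5" "K2 * d < e / 5" "d < t" "0 < d"
    by blast
  define S where "S N = integral {-N..N} (\<lambda>x. exp (of_real d * Complex (1 / d) x) / Complex (1 / d) x ^ 3)" for N
  \<comment> \<open>The difference is split as follows: \<open>D1\<close> moves the line to
    \<open>Re l = 1 / d\<close>, \<open>D2\<close> transports along the orbit, \<open>D3\<close>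
    replaces \<open>\<phi> (t - d)\<close> by \<open>\<phi> t\<close>, \<open>D4\<close> replaces
    the cubed resolvent by \<open>l^-3\<close>, and \<open>D5\<close> is the scalar inversion.
    \<open>D1\<close>, \<open>D2\<close>, \<open>D5\<close> vanish as \<open>N\<close> grows;
    \<open>D3\<close> and \<open>D4\<close> are small by the choice of \<open>d\<close>, uniformly
    in \<open>N\<close>.\<close>
  define D1 where "D1 N = (1 / (pi * t\<^sup>2)) *\<^sub>R (W 3 c t N (\<phi> 0) - W 3 (1 / d) t N (\<phi> 0))" for N
  define D2 where "D2 N = (1 / pi) *\<^sub>R ((1 / d\<^sup>2) *\<^sub>R W 3 (1 / d) d N (\<phi> (t - d)) - (1 / t\<^sup>2) *\<^sub>R W 3 (1 / d) t N (\<phi> 0))" for N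
  define D3 where "D3 N = (1 / (pi * d\<^sup>2)) *\<^sub>R W 3 (1 / d) d N (\<phi> (t - d) - \<phi> t)" for N
  define D4 where "D4 N = (1 / (pi * d\<^sup>2)) *\<^sub>R (W 3 (1 / d) d N (\<phi> t) - cmul (S N) (\<phi> t))" for N
  define D5 where "D5 N = (1 / (pi * d\<^sup>2)) *\<^sub>R cmul (S N) (\<phi> t) - \<phi> t" for N
  have lin: "W 3 (1 / d) d N (\<phi> (t - d) - \<phi> t) = W 3 (1 / d) d N (\<phi> (t - d)) - W 3 (1 / d) d N (\<phi> t)" for N
    using d by (intro linear_diff linear_W) auto
  have sum: "(1 / (pi * t\<^sup>2)) *\<^sub>R W 3 c t N (\<phi> 0) - \<phi> t = D1 N - D2 N + D3 N + D4 N + D5 N" for N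
    by (simp add: D1_def D2_def D3_def D4_def D5_def lin scaleR_diff_right)
  have "(D1 \<longlongrightarrow> (1 / (pi * t\<^sup>2)) *\<^sub>R 0) at_top"
    unfolding D1_def[abs_def] using c t d by (intro tendsto_scaleR tendsto_const W_shift_tendsto) auto
  then have e1: "\<forall>\<^sub>F N in at_top. norm (D1 N) < e / 5"
    using tendstoD[of D1 0 at_top "e / 5"] e by (simp add: dist_norm)
  have "(D2 \<longlongrightarrow> (1 / pi) *\<^sub>R 0) at_top"
    unfolding D2_def[abs_def] using d by (intro tendsto_scaleR tendsto_const W_along_orbit_tendsto[OF \<phi> \<psi>]) auto
  then have e2: "\<forall>\<^sub>F N in at_top. norm (D2 N) < e / 5"
    using tendstoD[of D2 0 at_top "e / 5"] e by (simp add: dist_norm)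
  have e3: "\<forall>\<^sub>F N in at_top. norm (D3 N) < e / 5"
    using eventually_ge_at_top[of 0]
  proof eventually_elim
    case (elim N)
    have "norm (D3 N) \<le> (1 / (pi * d\<^sup>2)) * (2 * exp 1 * M ^ 3 * norm (\<phi> (t - d) - \<phi> t) * pi * d\<^sup>2)"
      unfolding D3_def norm_scaleR using norm_W_reciprocal_le[OF d(4) elim, of "\<phi> (t - d) - \<phi> t"]
      by (intro mult_mono) auto
    also have "\<dots> = K1 * norm (\<phi> (t - d) - \<phi> t)" using d by (simp add: K1_def)
    finally show ?case using d(1) by simp
  qed
  have e4: "\<forall>\<^sub>F N in at_top. norm (D4 N) < e / 5"
    using eventually_ge_at_top[of 0]
  proof eventually_elim
    case (elim N)
    have "norm (W 3 (1 / d) d N (\<phi> t) - cmul (S N) (\<phi> t)) \<le> 12 * exp 1 * M ^ 3 * norm (\<psi> t) * pi * d ^ 3"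
      unfolding S_def using t by (intro norm_W_start_le[OF d(4) elim] \<psi>) auto
    then have "norm (D4 N) \<le> (1 / (pi * d\<^sup>2)) * (12 * exp 1 * M ^ 3 * norm (\<psi> t) * pi * d ^ 3)"
      unfolding D4_def norm_scaleR by (intro mult_mono) auto
    also have "\<dots> = K2 * d" using d by (simp add: K2_def power2_eq_square power3_eq_cube)
    finally show ?case using d(2) by simp
  qed
  have "(S \<longlongrightarrow> of_real (pi * d\<^sup>2)) at_top"
    unfolding S_def[abs_def] using d by (intro tendsto_inverse_Laplace_cube) auto
  then have "((\<lambda>N. cmul (S N) (\<phi> t)) \<longlongrightarrow> cmul (of_real (pi * d\<^sup>2)) (\<phi> t)) at_top"
    by (intro blinfun.tendsto bounded_linear.tendsto[OF bounded_linear_cmul] tendsto_const)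
  then have "((\<lambda>N. cmul (S N) (\<phi> t)) \<longlongrightarrow> (pi * d\<^sup>2) *\<^sub>R \<phi> t) at_top"
    by (simp only: cmul_of_real)
  then have "(D5 \<longlongrightarrow> (1 / (pi * d\<^sup>2)) *\<^sub>R (pi * d\<^sup>2) *\<^sub>R \<phi> t - \<phi> t) at_top"
    unfolding D5_def[abs_def] by (intro tendsto_intros)
  then have e5: "\<forall>\<^sub>F N in at_top. norm (D5 N) < e / 5"
    using tendstoD[of D5 0 at_top "e / 5"] e d by (simp add: dist_norm)
  show "\<forall>\<^sub>F N in at_top. dist ((1 / (pi * t\<^sup>2)) *\<^sub>R W 3 c t N (\<phi> 0)) (\<phi> t) < e"
    using e1 e2 e3 e4 e5
  proof eventually_elim
    case (elim N)
    have "norm (D1 N - D2 N + D3 N + D4 N + D5 N) \<le> norm (D1 N) + norm (D2 N) + norm (D3 N) + norm (D4 N) + norm (D5 N)"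
      by (intro order_trans[OF norm_triangle_ineq] order_trans[OF norm_triangle_ineq4] add_right_mono) simp
    then show ?case unfolding dist_norm sum using elim by simp
  qed
qed

section \<open>Bounds for orbits and their derivatives\<close>

text \<open>The estimates of the truncated integrals pass to the limit: the line
  \<open>c = 1 / t\<close> gives the first bound, the imaginary axis the second.\<close>

lemma norm_orbit_le:
  assumes \<phi>: "\<And>s. s \<ge> 0 \<Longrightarrow> (\<phi> has_vector_derivative \<psi> s) (at s within {0..})"
    and \<psi>: "\<And>s l. s \<ge> 0 \<Longrightarrow> l \<in> half_plane \<Longrightarrow> R l (cmul l (\<phi> s)) - R l (\<psi> s) = \<phi> s"
    and t: "0 < t"
  shows "norm (\<phi> t) \<le> 2 * exp 1 * M ^ 3 * norm (\<phi> 0)"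
    and "norm (\<phi> t) \<le> 2 * M ^ 3 * norm (\<phi> 0) / t\<^sup>2"
proof -
  have *: "norm (\<phi> t) \<le> K" if c: "0 \<le> c" and K: "\<And>N. N \<ge> 0 \<Longrightarrow> norm (W 3 c t N (\<phi> 0)) \<le> K * (pi * t\<^sup>2)" for c K
  proof (rule tendsto_upperbound[OF tendsto_norm[OF inverse_Laplace[OF \<phi> \<psi> c t]]])
    show "\<forall>\<^sub>F N in at_top. norm ((1 / (pi * t\<^sup>2)) *\<^sub>R W 3 c t N (\<phi> 0)) \<le> K"
      using eventually_ge_at_top[of 0]
      by eventually_elim (use K t in \<open>simp add: divide_le_eq\<close>)
  qed auto
  show "norm (\<phi> t) \<le> 2 * exp 1 * M ^ 3 * norm (\<phi> 0)"
  proof (rule *[of "1 / t"])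
    show "norm (W 3 (1 / t) t N (\<phi> 0)) \<le> 2 * exp 1 * M ^ 3 * norm (\<phi> 0) * (pi * t\<^sup>2)" if "N \<ge> 0" for N
      using norm_W_reciprocal_le[OF t that, of "\<phi> 0"] by (simp add: mult_ac)
  qed (use t in simp)
  show "norm (\<phi> t) \<le> 2 * M ^ 3 * norm (\<phi> 0) / t\<^sup>2"
  proof (rule *[of 0])
    show "norm (W 3 0 t N (\<phi> 0)) \<le> 2 * M ^ 3 * norm (\<phi> 0) / t\<^sup>2 * (pi * t\<^sup>2)" if "N \<ge> 0" for N
      using norm_W_zero_le[OF that, of t "\<phi> 0"] t by (simp add: mult_ac)
  qed simp
qed

text \<open>\<open>R v = l R y - y\<close> trades \<open>v\<close> for \<open>y\<close> at the price
  of one power of \<open>l\<close>: \<open>R^3 v = l R^3 y - R^2 y\<close> is still of order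
  \<open>|l|^-2\<close>, so the integral converges with a bound in \<open>y\<close> alone.\<close>

lemma norm_W_derivative_le:
  assumes t: "t > 0" and N: "N \<ge> 0"
    and y: "\<And>l. l \<in> half_plane \<Longrightarrow> R l (cmul l y) - R l v = y"
  shows "norm (W 3 (1 / t) t N v) \<le> 6 * exp 1 * M ^ 3 * norm y * pi * t"
proof -
  have "norm (W 3 (1 / t) t N v) \<le> (6 * exp 1 * M ^ 3 * norm y) * (pi / (1 / t))"
    unfolding W_def
  proof (rule norm_vline_integral_le)
    fix x
    define l where "l = Complex (1 / t) x"
    have l: "l \<in> half_plane" using t by (simp add: l_def)
    have l2: "(cmod l)\<^sup>2 = (1 / t)\<^sup>2 + x\<^sup>2" by (simp add: l_def cmod_power2)
    have lpos: "cmod l > 0" using t by (auto simp: l_def complex_eq_iff)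
    have three: "(3::nat) = Suc 2" by simp
    have "R l v = cmul l (R l y) - y" using y[OF l] cmul_commute[OF l, of l y] by (simp add: algebra_simps)
    then have "pw 3 l v = cmul l (pw 3 l y) - pw 2 l y"
      by (simp only: three pw_Suc' pw_cmul[OF l] linear_diff[OF bounded_linear.linear[OF bounded_linear_pw]])
    then have "norm (pw 3 l v) \<le> 2 * cmod l * norm (pw 3 l y) + norm (pw 2 l y)"
      using norm_triangle_ineq4[of "cmul l (pw 3 l y)" "pw 2 l y"] norm_cmul_le[of l "pw 3 l y"] by simp
    also have "\<dots> \<le> 2 * cmod l * (M ^ 3 / cmod l ^ 3 * norm y) + M ^ 3 / (cmod l)\<^sup>2 * norm y"
    proof (intro add_mono mult_left_mono)
      have *: "norm (pw k l y) \<le> M ^ k / cmod l ^ k * norm y" for k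
        using norm_pw_le[OF l, of k y] mult_right_mono[OF resolvent_power_le[OF lpos, of l k] norm_ge_zero[of y]] by simp
      then show "norm (pw 3 l y) \<le> M ^ 3 / cmod l ^ 3 * norm y" by blast
      have "norm (pw 2 l y) \<le> M\<^sup>2 / (cmod l)\<^sup>2 * norm y" by (rule *)
      also have "\<dots> \<le> M ^ 3 / (cmod l)\<^sup>2 * norm y"
        using M_ge_1 by (intro mult_right_mono divide_right_mono power_increasing) auto
      finally show "norm (pw 2 l y) \<le> M ^ 3 / (cmod l)\<^sup>2 * norm y" .
    qed auto
    also have "\<dots> = 3 * M ^ 3 * norm y * (1 / (cmod l)\<^sup>2)"
      using lpos by (simp add: power2_eq_square power3_eq_cube)
    finally have n: "norm (pw 3 l v) \<le> 3 * M ^ 3 * norm y * (1 / (cmod l)\<^sup>2)" .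
    have "norm (epw 3 t v l) \<le> 2 * cmod (exp (of_real t * l)) * norm (pw 3 l v)"
      unfolding epw_def by (rule norm_cmul_le)
    also have "\<dots> \<le> 2 * exp 1 * (3 * M ^ 3 * norm y * (1 / (cmod l)\<^sup>2))"
      using n t by (intro mult_mono) (auto simp: l_def)
    finally show "norm (epw 3 t v (Complex (1 / t) x)) \<le> 6 * exp 1 * M ^ 3 * norm y * (1 / ((1 / t)\<^sup>2 + x\<^sup>2))"
      unfolding l2[symmetric] by (simp add: l_def mult_ac)
  qed (use t N M_ge_1 in \<open>auto intro: epw_vline_integrable\<close>)
  then show ?thesis by simp
qed

text \<open>The derivative \<open>\<psi>\<close> is itself an orbit, with derivative
  \<open>\<xi>\<close>, so the inversion formula applies to it; its initial value is then estimated
  through \<open>\<phi> 0\<close>.\<close>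

lemma norm_orbit_derivative_le:
  assumes \<psi>: "\<And>s l. s \<ge> 0 \<Longrightarrow> l \<in> half_plane \<Longrightarrow> R l (cmul l (\<phi> s)) - R l (\<psi> s) = \<phi> s"
    and \<psi>': "\<And>s. s \<ge> 0 \<Longrightarrow> (\<psi> has_vector_derivative \<xi> s) (at s within {0..})"
    and \<xi>: "\<And>s l. s \<ge> 0 \<Longrightarrow> l \<in> half_plane \<Longrightarrow> R l (cmul l (\<psi> s)) - R l (\<xi> s) = \<psi> s"
    and t: "0 < t"
  shows "norm (\<psi> t) \<le> 6 * exp 1 * M ^ 3 * norm (\<phi> 0) / t"
proof (rule tendsto_upperbound[OF tendsto_norm[OF inverse_Laplace[OF \<psi>' \<xi> _ t, of "1 / t"]]])
  show "\<forall>\<^sub>F N in at_top. norm ((1 / (pi * t\<^sup>2)) *\<^sub>R W 3 (1 / t) t N (\<psi> 0)) \<le> 6 * exp 1 * M ^ 3 * norm (\<phi> 0) / t"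
    using eventually_ge_at_top[of 0]
  proof eventually_elim
    case (elim N)
    have "norm (W 3 (1 / t) t N (\<psi> 0)) \<le> 6 * exp 1 * M ^ 3 * norm (\<phi> 0) * pi * t"
      by (intro norm_W_derivative_le[OF t elim] \<psi>) auto
    then have "norm ((1 / (pi * t\<^sup>2)) *\<^sub>R W 3 (1 / t) t N (\<psi> 0)) \<le> (1 / (pi * t\<^sup>2)) * (6 * exp 1 * M ^ 3 * norm (\<phi> 0) * pi * t)"
      unfolding norm_scaleR by (intro mult_mono) auto
    also have "\<dots> = 6 * exp 1 * M ^ 3 * norm (\<phi> 0) / t" using t by (simp add: power2_eq_square)
    finally show ?case .
  qed
qed (use t in auto)

end

section \<open>The resolvent of a sectorial operator\<close>

lemma op_graph_subspaceD:
  assumes "subspace (op_graph D A)"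
  shows "0 \<in> D" "A 0 = 0"
    "x \<in> D \<Longrightarrow> y \<in> D \<Longrightarrow> x + y \<in> D \<and> A (x + y) = A x + A y"
    "x \<in> D \<Longrightarrow> r *\<^sub>R x \<in> D \<and> A (r *\<^sub>R x) = r *\<^sub>R A x"
proof -
  show "0 \<in> D" "A 0 = 0"
    using subspace_0[OF assms] by (auto simp: op_graph_def zero_prod_def)
  show "x \<in> D \<Longrightarrow> y \<in> D \<Longrightarrow> x + y \<in> D \<and> A (x + y) = A x + A y"
    using subspace_add[OF assms, of "(x, A x)" "(y, A y)"] by (auto simp: op_graph_def)
  show "x \<in> D \<Longrightarrow> r *\<^sub>R x \<in> D \<and> A (r *\<^sub>R x) = r *\<^sub>R A x"
    using subspace_scale[OF assms, of "(x, A x)" r] by (auto simp: op_graph_def)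
qed

definition complexify :: "('a \<Rightarrow> 'a) \<Rightarrow> 'a \<times> 'a \<Rightarrow> 'a \<times> 'a"
  where "complexify A z = (A (fst z), A (snd z))"

lemma shifted_eq: "shifted A l z = cmul l z - complexify A z"
  by (cases z) (simp add: shifted_def complexify_def cmul_Pair)

lemma complexify_subspace:
  assumes "subspace (op_graph D A)" "y \<in> D \<times> D"
  shows "z \<in> D \<times> D \<Longrightarrow> y + z \<in> D \<times> D \<and> complexify A (y + z) = complexify A y + complexify A z"
    and "r *\<^sub>R y \<in> D \<times> D \<and> complexify A (r *\<^sub>R y) = r *\<^sub>R complexify A y"
    and "cmul m y \<in> D \<times> D \<and> complexify A (cmul m y) = cmul m (complexify A y)"
proof -
  note S = op_graph_subspaceD(3,4)[OF assms(1)]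
  show "z \<in> D \<times> D \<Longrightarrow> y + z \<in> D \<times> D \<and> complexify A (y + z) = complexify A y + complexify A z"
    using assms(2) S(1) by (auto simp: complexify_def)
  show "r *\<^sub>R y \<in> D \<times> D \<and> complexify A (r *\<^sub>R y) = r *\<^sub>R complexify A y"
    using assms(2) S(2) by (auto simp: complexify_def)
  obtain u v where y: "y = (u, v)" "u \<in> D" "v \<in> D" using assms(2) by blast
  have "Re m *\<^sub>R u + (- Im m) *\<^sub>R v \<in> D \<and> A (Re m *\<^sub>R u + (- Im m) *\<^sub>R v) = Re m *\<^sub>R A u + (- Im m) *\<^sub>R A v"
    "Im m *\<^sub>R u + Re m *\<^sub>R v \<in> D \<and> A (Im m *\<^sub>R u + Re m *\<^sub>R v) = Im m *\<^sub>R A u + Re m *\<^sub>R A v"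
    using y S by metis+
  then show "cmul m y \<in> D \<times> D \<and> complexify A (cmul m y) = cmul m (complexify A y)"
    by (simp add: y cmul_Pair complexify_def)
qed

text \<open>The resolvent is chosen by means of the spectral condition, while the sectorial estimate
  concerns a witness of its own; uniqueness identifies them.\<close>

lemma is_resolvent_unique:
  assumes "is_resolvent D A l R" "is_resolvent D A l R'"
  shows "R = R'"
proof
  fix w
  have "R w \<in> D \<times> D" "shifted A l (R w) = w" using assms(1) unfolding is_resolvent_def by blast+
  moreover have "R' (shifted A l (R w)) = R w" if "R w \<in> D \<times> D"
  proof -
    have "\<forall>z\<in>D \<times> D. R' (shifted A l z) = z" using assms(2) unfolding is_resolvent_def by (elim conjE)
    then show ?thesis using that by (rule bspec)
  qed
  ultimately show "R w = R' w" by simp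
qed

text \<open>\<open>R l\<close> is the resolvent of \<open>-A\<close> at \<open>l\<close>, that is, minus the resolvent of \<open>A\<close> at \<open>-l\<close>.\<close>

lemma generator_resolvent:
  fixes D :: "'a::banach set"
  assumes sub: "subspace (op_graph D A)" and spec: "\<forall>l\<in>op_spectrum D A. Re l > 0"
  obtains R :: "complex \<Rightarrow> ('a \<times> 'a) \<Rightarrow>\<^sub>L ('a \<times> 'a)"
  where "\<And>l w. l \<in> half_plane \<Longrightarrow> R l w \<in> D \<times> D"
    "\<And>l w. l \<in> half_plane \<Longrightarrow> cmul l (R l w) + complexify A (R l w) = w"
    "\<And>l z. l \<in> half_plane \<Longrightarrow> z \<in> D \<times> D \<Longrightarrow> R l (cmul l z + complexify A z) = z"
    "\<And>l Q. l \<in> half_plane \<Longrightarrow> is_resolvent D A (- l) Q \<Longrightarrow> blinfun_apply (R l) = (\<lambda>w. - Q w)"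
proof -
  have "\<forall>l. \<exists>Q. l \<in> half_plane \<longrightarrow> is_resolvent D A (- l) Q"
    using spec unfolding op_spectrum_def half_plane_def by fastforce
  then obtain Q where Q: "\<And>l. l \<in> half_plane \<Longrightarrow> is_resolvent D A (- l) (Q l)" by metis
  define R where "R l = Blinfun (\<lambda>w. - Q l w)" for l
  have R: "R l w = - Q l w" if "l \<in> half_plane" for l w
    using Q[OF that] unfolding R_def is_resolvent_def
    by (subst bounded_linear_Blinfun_apply) (auto intro: bounded_linear_minus)
  have QD: "Q l w \<in> D \<times> D" "shifted A (- l) (Q l w) = w" if "l \<in> half_plane" for l w
    using Q[OF that] unfolding is_resolvent_def by blast+
  have QI: "Q l (shifted A (- l) z) = z" if "l \<in> half_plane" "z \<in> D \<times> D" for l z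
    using Q[OF that(1)] that(2) unfolding is_resolvent_def by blast
  have lin: "linear (Q l)" if "l \<in> half_plane" for l
    using Q[OF that] unfolding is_resolvent_def by (simp add: bounded_linear.linear)
  have neg: "- y \<in> D \<times> D \<and> complexify A (- y) = - complexify A y" if "y \<in> D \<times> D" for y
    using complexify_subspace(2)[OF sub that, of "-1"] by simp
  have sh: "shifted A (- l) y = - (cmul l y + complexify A y)" for l y
    by (simp add: shifted_eq cmul_neg blinfun.minus_left)
  show ?thesis
  proof (rule that)
    fix l w assume l: "l \<in> half_plane"
    show "R l w \<in> D \<times> D" using neg QD(1)[OF l] R[OF l] by metis
    have "cmul l (R l w) + complexify A (R l w) = - (cmul l (Q l w) + complexify A (Q l w))"
      using neg[OF QD(1)[OF l, of w]] by (simp add: R[OF l] blinfun.minus_right)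
    then show "cmul l (R l w) + complexify A (R l w) = w"
      using QD(2)[OF l, of w] by (simp only: sh)
  next
    fix l z assume l: "l \<in> half_plane" and z: "z \<in> D \<times> D"
    have "R l (cmul l z + complexify A z) = Q l (- (cmul l z + complexify A z))"
      by (simp only: R[OF l] linear_neg[OF lin[OF l]])
    then show "R l (cmul l z + complexify A z) = z"
      using QI[OF l z] by (simp only: sh)
  next
    fix l Q' assume l: "l \<in> half_plane" and Q': "is_resolvent D A (- l) Q'"
    show "blinfun_apply (R l) = (\<lambda>w. - Q' w)"
      using is_resolvent_unique[OF Q[OF l] Q'] R[OF l] by auto
  qed
qed

lemma cos_ge_of_small_arg:
  assumes "\<bar>x\<bar> < p" "p < pi / 2"
  shows "cos p \<le> cos x"
  using assms cos_monotone_0_pi_le[of "\<bar>x\<bar>" p] by simp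

text \<open>For large \<open>l\<close> in the half-plane, \<open>- l\<close> lies in the sector and
  the sectorial estimate applies. The rest of the half-plane is compact, and there continuity of the
  resolvent gives a bound.\<close>

lemma half_plane_resolvent_of_sectorial:
  fixes D :: "'a::banach set"
  assumes sec: "sectorial D A" and spec: "\<forall>l\<in>op_spectrum D A. Re l > 0"
  obtains R :: "complex \<Rightarrow> ('a \<times> 'a) \<Rightarrow>\<^sub>L ('a \<times> 'a)" and M
  where "half_plane_resolvent R M"
    "\<And>l z. l \<in> half_plane \<Longrightarrow> z \<in> D \<times> D \<Longrightarrow> R l (cmul l z + complexify A z) = z"
proof -
  from sec obtain p M0 a where p: "0 < p" "p < pi / 2" and M0: "1 \<le> M0"
    and sect: "\<And>l. l \<noteq> of_real a \<Longrightarrow> p \<le> \<bar>Arg (l - of_real a)\<bar> \<Longrightarrow>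
      \<exists>Q. is_resolvent D A l Q \<and> onorm Q \<le> M0 / cmod (l - of_real a)"
    and sub: "subspace (op_graph D A)"
    unfolding sectorial_def closed_densely_defined_def by blast
  obtain R :: "complex \<Rightarrow> ('a \<times> 'a) \<Rightarrow>\<^sub>L ('a \<times> 'a)" where R:
    "\<And>l w. l \<in> half_plane \<Longrightarrow> R l w \<in> D \<times> D"
    "\<And>l w. l \<in> half_plane \<Longrightarrow> cmul l (R l w) + complexify A (R l w) = w"
    "\<And>l z. l \<in> half_plane \<Longrightarrow> z \<in> D \<times> D \<Longrightarrow> R l (cmul l z + complexify A z) = z"
    "\<And>l Q. l \<in> half_plane \<Longrightarrow> is_resolvent D A (- l) Q \<Longrightarrow> blinfun_apply (R l) = (\<lambda>w. - Q w)"
    using generator_resolvent[OF sub spec] by blast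
  have comm: "R l (cmul m z) = cmul m (R l z)" if l: "l \<in> half_plane" for l m z
  proof -
    note c = complexify_subspace(3)[OF sub R(1)[OF l, of z], of m]
    have "cmul m z = cmul m (cmul l (R l z) + complexify A (R l z))" by (simp only: R(2)[OF l])
    also have "\<dots> = cmul l (cmul m (R l z)) + complexify A (cmul m (R l z))"
      using c by (simp add: blinfun.add_right mult.commute flip: cmul_mult)
    finally show ?thesis using R(3)[OF l] c by metis
  qed
  have ident: "R l z - R m z = cmul (m - l) (R l (R m z))" if l: "l \<in> half_plane" and m: "m \<in> half_plane" for l m z
  proof -
    have "z = cmul m (R m z) + complexify A (R m z)" by (simp only: R(2)[OF m])
    also have "\<dots> = (cmul l (R m z) + complexify A (R m z)) + cmul (m - l) (R m z)"
      by (simp add: cmul_diff blinfun.diff_left)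
    finally have "R l z = R l (cmul l (R m z) + complexify A (R m z)) + R l (cmul (m - l) (R m z))"
      by (metis blinfun.add_right)
    then show ?thesis by (simp add: R(3)[OF l R(1)[OF m]] comm[OF l])
  qed
  have lip: "norm (R l - R m) \<le> 2 * cmod (m - l) * (norm (R l) * norm (R m))"
    if l: "l \<in> half_plane" and m: "m \<in> half_plane" for l m
  proof (rule norm_blinfun_bound)
    fix z
    have "norm ((R l - R m) z) = norm (cmul (m - l) (R l (R m z)))"
      by (simp add: blinfun.diff_left ident[OF l m])
    also have "\<dots> \<le> 2 * cmod (m - l) * norm (R l (R m z))" by (rule norm_cmul_le)
    also have "\<dots> \<le> 2 * cmod (m - l) * (norm (R l) * (norm (R m) * norm z))"
      by (intro mult_left_mono order_trans[OF norm_blinfun] norm_blinfun) auto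
    finally show "norm ((R l - R m) z) \<le> 2 * cmod (m - l) * (norm (R l) * norm (R m)) * norm z"
      by (simp add: mult_ac)
  qed simp
  \<comment> \<open>Local boundedness, needed before continuity: for \<open>m\<close> near
    \<open>l\<close> the resolvent identity bounds the increment by half of
    \<open>norm (R m)\<close>, which is absorbed.\<close>
  have loc: "norm (R m) \<le> 2 * norm (R l)" if l: "l \<in> half_plane" and m: "m \<in> half_plane"
    and d: "4 * cmod (m - l) * norm (R l) \<le> 1" for l m
  proof -
    have "norm (R m) \<le> norm (R l) + norm (R m - R l)" using norm_triangle_ineq[of "R l" "R m - R l"] by simp
    also have "norm (R m - R l) \<le> 2 * cmod (m - l) * (norm (R m) * norm (R l))"
      using lip[OF m l] by (simp add: norm_minus_commute)
    also have "\<dots> = (4 * cmod (m - l) * norm (R l)) * (norm (R m) / 2)" by simp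
    also have "\<dots> \<le> 1 * (norm (R m) / 2)" by (intro mult_right_mono d) auto
    finally show ?thesis by simp
  qed
  have cont: "continuous_on half_plane R"
    unfolding continuous_on_def
  proof
    fix l assume l: "l \<in> half_plane"
    have "((\<lambda>m. R m - R l) \<longlongrightarrow> 0) (at l within half_plane)"
    proof (rule Lim_null_comparison)
      have "((\<lambda>m. 4 * cmod (m - l) * norm (R l)) \<longlongrightarrow> 4 * cmod (l - l) * norm (R l)) (at l within half_plane)"
        by (intro tendsto_intros)
      then have "\<forall>\<^sub>F m in at l within half_plane. 4 * cmod (m - l) * norm (R l) < 1"
        by (rule order_tendstoD) simp
      moreover have "\<forall>\<^sub>F m in at l within half_plane. m \<in> half_plane"
        by (simp add: eventually_at_filter)
      ultimately show "\<forall>\<^sub>F m in at l within half_plane. norm (R m - R l) \<le> 2 * cmod (m - l) * (2 * norm (R l) * norm (R l))"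
      proof eventually_elim
        case (elim m)
        have "norm (R m - R l) \<le> 2 * cmod (m - l) * (norm (R m) * norm (R l))"
          using lip[OF elim(2) l] by (simp add: norm_minus_commute)
        also have "\<dots> \<le> 2 * cmod (m - l) * (2 * norm (R l) * norm (R l))"
          using loc[OF l elim(2)] elim(1) by (intro mult_left_mono mult_right_mono) auto
        finally show ?case .
      qed
      have "((\<lambda>m. 2 * cmod (m - l) * (2 * norm (R l) * norm (R l))) \<longlongrightarrow> 2 * cmod (l - l) * (2 * norm (R l) * norm (R l))) (at l within half_plane)"
        by (intro tendsto_intros)
      then show "((\<lambda>m. 2 * cmod (m - l) * (2 * norm (R l) * norm (R l))) \<longlongrightarrow> 0) (at l within half_plane)" by simp
    qed
    then show "(R \<longlongrightarrow> R l) (at l within half_plane)" by (simp add: LIM_zero_iff)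
  qed
  \<comment> \<open>Beyond this radius \<open>k = - l - a\<close> satisfies
    \<open>1 + |l| \<le> 4 |k|\<close> and \<open>|k| cos p > |a|\<close>. As
    \<open>Re k \<le> |a|\<close> on the half-plane, \<open>k\<close> cannot have an argument
    smaller than \<open>p\<close> in absolute value.\<close>
  define \<rho> where "\<rho> = 2 * \<bar>a\<bar> + 1 + \<bar>a\<bar> / cos p"
  have cp: "cos p > 0" using p by (intro cos_gt_zero) auto
  have "compact (R ` (half_plane \<inter> cball 0 \<rho>))"
  proof (rule compact_continuous_image)
    have "closed half_plane" unfolding half_plane_def by (simp add: closed_halfspace_Re_ge)
    then show "compact (half_plane \<inter> cball 0 \<rho>)" by (rule closed_Int_compact) simp
  qed (rule continuous_on_subset[OF cont], simp)
  then obtain Kc where Kc: "\<And>l. l \<in> half_plane \<Longrightarrow> cmod l \<le> \<rho> \<Longrightarrow> norm (R l) \<le> Kc" "Kc > 0"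
    using compact_imp_bounded bounded_pos
    by (metis (no_types, lifting) IntI image_eqI mem_cball_0)
  have \<rho>: "\<rho> \<ge> 1" unfolding \<rho>_def using cp by simp
  define M where "M = max (4 * M0) (Kc * (1 + \<rho>))"
  have bound: "norm (R l z) \<le> M / (1 + cmod l) * norm z" if l: "l \<in> half_plane" for l z
  proof (cases "cmod l \<le> \<rho>")
    case True
    have "norm (R l z) \<le> norm (R l) * norm z" by (rule norm_blinfun)
    also have "\<dots> \<le> Kc * norm z" by (intro mult_right_mono Kc(1)[OF l True]) simp
    also have "\<dots> \<le> M / (1 + cmod l) * norm z"
    proof (intro mult_right_mono)
      have "Kc * (1 + cmod l) \<le> Kc * (1 + \<rho>)" using True Kc(2) by (intro mult_left_mono) auto
      also have "\<dots> \<le> M" by (simp add: M_def)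
      finally show "Kc \<le> M / (1 + cmod l)" by (simp add: pos_le_divide_eq add_pos_nonneg)
    qed simp
    finally show ?thesis .
  next
    case False
    define k where "k = - l - of_real a"
    have "cmod l \<le> cmod k + \<bar>a\<bar>"
    proof -
      have "l = - k - of_real a" by (simp add: k_def)
      then show ?thesis using norm_triangle_ineq4[of "- k" "of_real a :: complex"] by simp
    qed
    moreover have c0: "0 \<le> \<bar>a\<bar> / cos p" using cp by simp
    ultimately have k1: "1 + cmod l \<le> 4 * cmod k" and k2: "\<bar>a\<bar> / cos p < cmod k" and k3: "cmod k > 0"
      using False unfolding \<rho>_def by linarith+
    have "p \<le> \<bar>Arg k\<bar>"
    proof (rule ccontr)
      assume "\<not> p \<le> \<bar>Arg k\<bar>"
      then have "cmod k * cos p \<le> cmod k * cos (Arg k)"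
        using p by (intro mult_left_mono cos_ge_of_small_arg) auto
      also have "\<dots> = Re k" using k3 by (simp add: cos_Arg)
      also have "\<dots> \<le> \<bar>a\<bar>" using l by (simp add: k_def half_plane_def)
      finally show False using k2 cp by (simp add: pos_divide_less_eq)
    qed
    moreover have "- l \<noteq> of_real a" using k3 by (auto simp: k_def)
    ultimately obtain Q where Q: "is_resolvent D A (- l) Q" "onorm Q \<le> M0 / cmod k"
      using sect[of "- l"] unfolding k_def by blast
    have "norm (R l z) = norm (Q z)" using R(4)[OF l Q(1)] by simp
    also have "\<dots> \<le> onorm Q * norm z"
      using Q(1) unfolding is_resolvent_def by (intro onorm) auto
    also have "\<dots> \<le> M / (1 + cmod l) * norm z"
    proof (intro mult_right_mono)
      have "M0 / cmod k = 4 * M0 / (4 * cmod k)" by simp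
      also have "\<dots> \<le> 4 * M0 / (1 + cmod l)"
        using k1 M0 k3 by (intro divide_left_mono) (auto intro!: mult_pos_pos add_pos_nonneg)
      also have "\<dots> \<le> M / (1 + cmod l)" by (intro divide_right_mono) (auto simp: M_def)
      finally show "onorm Q \<le> M / (1 + cmod l)" using Q(2) by simp
    qed simp
    finally show ?thesis .
  qed
  have "half_plane_resolvent R M"
    by unfold_locales (use comm ident bound M0 in \<open>auto simp: M_def\<close>)
  then show ?thesis using that R(3) by blast
qed

section \<open>Decay of the semigroup\<close>

text \<open>Inside the interval of convergence the terms \<open>q^n c n\<close> are bounded, so for
  \<open>|h| \<le> q / 2\<close> the terms of order at least 2 are dominated by a geometric series
  with sum of order \<open>h^2\<close>.\<close>

lemma power_series_has_vector_derivative: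
  fixes f :: "real \<Rightarrow> 'a::banach"
  assumes r: "r > 0" and f: "\<And>h. \<bar>h\<bar> < r \<Longrightarrow> (\<lambda>n. h ^ n *\<^sub>R c n) sums f (t + h)"
  shows "(f has_vector_derivative c 1) (at t)"
proof -
  define q where "q = r / 2"
  have q: "0 < q" "q < r" using r by (auto simp: q_def)
  have "summable (\<lambda>n. q ^ n *\<^sub>R c n)" using f[of q] q by (auto simp: sums_iff)
  then have "Bseq (\<lambda>n. q ^ n *\<^sub>R c n)"
    by (rule convergent_imp_Bseq[OF convergentI[OF summable_LIMSEQ_zero]])
  then obtain K where K: "K > 0" "\<And>n. norm (q ^ n *\<^sub>R c n) \<le> K" unfolding Bseq_def by blast
  have f0: "f t = c 0"
  proof -
    have "(\<lambda>n. 0 ^ n *\<^sub>R c n) sums (\<Sum>n\<in>{0}. 0 ^ n *\<^sub>R c n)"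
      by (rule sums_finite) auto
    moreover have "(\<lambda>n. 0 ^ n *\<^sub>R c n) sums f t" using f[of 0] r by simp
    ultimately show ?thesis using sums_unique2 by fastforce
  qed
  have est: "norm (f (t + h) - f t - h *\<^sub>R c 1) \<le> 2 * K / q\<^sup>2 * h\<^sup>2" if h: "\<bar>h\<bar> \<le> q / 2" for h
  proof -
    have "\<bar>h\<bar> < r" using h q by simp
    from sums_split_initial_segment[OF f[OF this], of 2]
    have s: "(\<lambda>n. h ^ (n + 2) *\<^sub>R c (n + 2)) sums (f (t + h) - f t - h *\<^sub>R c 1)"
      by (simp add: numeral_2_eq_2 f0 algebra_simps)
    have g: "(\<lambda>n. (K * h\<^sup>2 / q\<^sup>2) * (1 / 2) ^ n) sums ((K * h\<^sup>2 / q\<^sup>2) * (1 / (1 - 1 / 2)))"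
      by (intro sums_mult geometric_sums) simp
    have le: "norm (h ^ (n + 2) *\<^sub>R c (n + 2)) \<le> (K * h\<^sup>2 / q\<^sup>2) * (1 / 2) ^ n" for n
    proof -
      have "norm (h ^ (n + 2) *\<^sub>R c (n + 2)) = (\<bar>h\<bar> / q) ^ (n + 2) * norm (q ^ (n + 2) *\<^sub>R c (n + 2))"
        using q by (simp add: power_abs power_divide abs_mult)
      also have "\<dots> \<le> (\<bar>h\<bar> / q) ^ (n + 2) * K" using q by (intro mult_left_mono K) auto
      also have "\<dots> = (K * h\<^sup>2 / q\<^sup>2) * (\<bar>h\<bar> / q) ^ n"
        unfolding power_add by (simp add: power_divide mult_ac)
      also have "\<dots> \<le> (K * h\<^sup>2 / q\<^sup>2) * (1 / 2) ^ n"
        using h q K by (intro mult_left_mono power_mono) (auto simp: field_simps)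
      finally show ?thesis .
    qed
    have "norm (\<Sum>n. h ^ (n + 2) *\<^sub>R c (n + 2)) \<le> (\<Sum>n. (K * h\<^sup>2 / q\<^sup>2) * (1 / 2) ^ n)"
      by (rule norm_suminf_le[OF le sums_summable[OF g]])
    then show ?thesis using s g by (simp add: sums_iff mult_ac)
  qed
  show ?thesis unfolding has_vector_derivative_def
  proof (rule has_derivativeI_sandwich[where e = "q / 2" and H = "\<lambda>s. 2 * K / q\<^sup>2 * \<bar>s - t\<bar>"])
    show "norm (f s - f t - (s - t) *\<^sub>R c 1) / norm (s - t) \<le> 2 * K / q\<^sup>2 * \<bar>s - t\<bar>"
      if "s \<noteq> t" "dist s t < q / 2" for s
    proof -
      have "norm (f s - f t - (s - t) *\<^sub>R c 1) \<le> 2 * K / q\<^sup>2 * (s - t)\<^sup>2"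
        using est[of "s - t"] that by (simp add: dist_real_def)
      also have "(s - t)\<^sup>2 = \<bar>s - t\<bar> * \<bar>s - t\<bar>" by (simp add: power2_eq_square abs_mult_self_eq)
      finally show ?thesis using that(1) by (simp add: divide_le_eq mult_ac)
    qed
    have "((\<lambda>s. 2 * K / q\<^sup>2 * \<bar>s - t\<bar>) \<longlongrightarrow> 2 * K / q\<^sup>2 * \<bar>t - t\<bar>) (at t)"
      by (intro tendsto_intros)
    then show "((\<lambda>s. 2 * K / q\<^sup>2 * \<bar>s - t\<bar>) \<longlongrightarrow> 0) (at t)" by simp
  qed (use q in \<open>auto intro: bounded_linear_scaleR_left\<close>)
qed

lemma has_vector_derivative_right_iff:
  fixes f :: "real \<Rightarrow> 'a::real_normed_vector"
  shows "(f has_vector_derivative d) (at t within {t..}) \<longleftrightarrow>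
    ((\<lambda>h. (1 / h) *\<^sub>R (f (t + h) - f t)) \<longlongrightarrow> d) (at_right 0)"
proof -
  have "(f has_vector_derivative d) (at t within {t..}) \<longleftrightarrow>
      ((\<lambda>y. (1 / norm (y - t)) *\<^sub>R (f y - (f t + (y - t) *\<^sub>R d))) \<longlongrightarrow> 0) (at_right t)"
    unfolding has_vector_derivative_def has_derivative_within at_within_Ici_at_right
    by (simp add: bounded_linear_scaleR_left)
  also have "\<dots> \<longleftrightarrow> ((\<lambda>h. (1 / norm (h + t - t)) *\<^sub>R (f (h + t) - (f t + (h + t - t) *\<^sub>R d))) \<longlongrightarrow> 0) (at_right 0)"
    by (rule filterlim_at_right_to_0)
  also have "\<dots> \<longleftrightarrow> ((\<lambda>h. (1 / h) *\<^sub>R (f (t + h) - f t) - d) \<longlongrightarrow> 0) (at_right 0)"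
  proof (rule filterlim_cong[OF refl refl])
    show "\<forall>\<^sub>F h in at_right 0. (1 / norm (h + t - t)) *\<^sub>R (f (h + t) - (f t + (h + t - t) *\<^sub>R d)) = (1 / h) *\<^sub>R (f (t + h) - f t) - d"
      using eventually_at_right_less[of "0::real"]
      by eventually_elim (simp add: add.commute scaleR_diff_right algebra_simps)
  qed
  also have "\<dots> \<longleftrightarrow> ((\<lambda>h. (1 / h) *\<^sub>R (f (t + h) - f t)) \<longlongrightarrow> d) (at_right 0)"
    by (rule LIM_zero_iff)
  finally show ?thesis .
qed

locale minus_generated =
  fixes D :: "'a::banach set" and A :: "'a \<Rightarrow> 'a" and T :: "real \<Rightarrow> 'a \<Rightarrow> 'a"
  assumes gen: "semigroup_generated_by_minus D A T"
begin

lemma bounded_linear_T: "t \<ge> 0 \<Longrightarrow> bounded_linear (T t)"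
  and T_0: "T 0 x = x"
  and T_add: "s \<ge> 0 \<Longrightarrow> t \<ge> 0 \<Longrightarrow> T (s + t) x = T s (T t x)"
  and T_right: "((\<lambda>t. T t x) \<longlongrightarrow> x) (at_right 0)"
  using gen unfolding semigroup_generated_by_minus_def analytic_semigroup_def by blast+

lemma generator_iff:
  "((\<lambda>h. (1 / h) *\<^sub>R (T h x - x)) \<longlongrightarrow> y) (at_right 0) \<longleftrightarrow> x \<in> D \<and> y = - A x"
proof -
  have "(x, y) \<in> generator_graph T \<longleftrightarrow> (x, y) \<in> op_graph D (\<lambda>x. - A x)"
    using gen unfolding semigroup_generated_by_minus_def by simp
  then show ?thesis unfolding generator_graph_def op_graph_def by auto
qed

text \<open>\<open>T (t + h) x = T h (T t x)\<close> turns the right difference quotient at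
  \<open>t\<close> into the one that defines the generator at \<open>T t x\<close>.\<close>

lemma T_derivative_right:
  assumes "t \<ge> 0"
  shows "((\<lambda>s. T s x) has_vector_derivative d) (at t within {t..}) \<longleftrightarrow> T t x \<in> D \<and> d = - A (T t x)"
proof -
  have "((\<lambda>s. T s x) has_vector_derivative d) (at t within {t..}) \<longleftrightarrow>
      ((\<lambda>h. (1 / h) *\<^sub>R (T (t + h) x - T t x)) \<longlongrightarrow> d) (at_right 0)"
    by (rule has_vector_derivative_right_iff)
  also have "\<dots> \<longleftrightarrow> ((\<lambda>h. (1 / h) *\<^sub>R (T h (T t x) - T t x)) \<longlongrightarrow> d) (at_right 0)"
  proof (rule filterlim_cong[OF refl refl])
    show "\<forall>\<^sub>F h in at_right 0. (1 / h) *\<^sub>R (T (t + h) x - T t x) = (1 / h) *\<^sub>R (T h (T t x) - T t x)"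
      using eventually_at_right_less[of "0::real"]
    proof eventually_elim
      case (elim h)
      then show ?case using T_add[of h t x] assms by (simp add: add.commute)
    qed
  qed
  finally show ?thesis by (simp add: generator_iff)
qed

text \<open>Analyticity provides a two-sided derivative at positive times for every
  \<open>x\<close>; its right-hand half puts \<open>T t x\<close> into the domain and identifies the
  derivative.\<close>

lemma T_derivative:
  assumes "t > 0"
  shows "T t x \<in> D" "((\<lambda>s. T s x) has_vector_derivative - A (T t x)) (at t)"
proof -
  obtain r c where "r > 0" "\<And>h. \<bar>h\<bar> < r \<Longrightarrow> (\<lambda>n. h ^ n *\<^sub>R c n) sums T (t + h) x"
    using gen assms unfolding semigroup_generated_by_minus_def analytic_semigroup_def by meson
  then have d: "((\<lambda>s. T s x) has_vector_derivative c 1) (at t)"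
    by (rule power_series_has_vector_derivative)
  then have "T t x \<in> D \<and> c 1 = - A (T t x)"
    using T_derivative_right[of t x "c 1"] assms by (simp add: has_vector_derivative_at_within)
  then show "T t x \<in> D" "((\<lambda>s. T s x) has_vector_derivative - A (T t x)) (at t)"
    using d by auto
qed

lemma T_derivative_domain:
  assumes x: "x \<in> D" and s: "s \<ge> 0"
  shows "T s x \<in> D" "A (T s x) = T s (A x)"
    "((\<lambda>s. T s x) has_vector_derivative - A (T s x)) (at s within {0..})"
proof -
  interpret Ts: bounded_linear "T s" by (rule bounded_linear_T[OF s])
  have "((\<lambda>h. (1 / h) *\<^sub>R (T h x - x)) \<longlongrightarrow> - A x) (at_right 0)"
    using generator_iff[of x "- A x"] x by simp
  from Ts.tendsto[OF this]
  have "((\<lambda>h. (1 / h) *\<^sub>R (T s (T h x) - T s x)) \<longlongrightarrow> T s (- A x)) (at_right 0)"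
    by (simp add: Ts.scaleR Ts.diff)
  moreover have "((\<lambda>h. (1 / h) *\<^sub>R (T s (T h x) - T s x)) \<longlongrightarrow> T s (- A x)) (at_right 0) \<longleftrightarrow>
    ((\<lambda>h. (1 / h) *\<^sub>R (T h (T s x) - T s x)) \<longlongrightarrow> T s (- A x)) (at_right 0)"
  proof (rule filterlim_cong[OF refl refl])
    show "\<forall>\<^sub>F h in at_right 0. (1 / h) *\<^sub>R (T s (T h x) - T s x) = (1 / h) *\<^sub>R (T h (T s x) - T s x)"
      using eventually_at_right_less[of "0::real"]
    proof eventually_elim
      case (elim h)
      then show ?case using T_add[of h s x] T_add[of s h x] s by (simp add: add.commute)
    qed
  qed
  ultimately have *: "T s x \<in> D \<and> T s (- A x) = - A (T s x)" by (simp add: generator_iff)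
  then show "T s x \<in> D" "A (T s x) = T s (A x)" by (auto simp: Ts.neg)
  show "((\<lambda>s. T s x) has_vector_derivative - A (T s x)) (at s within {0..})"
  proof (cases "s = 0")
    case True
    then show ?thesis using T_derivative_right[of 0 x "- A (T 0 x)"] x by (simp add: T_0)
  next
    case False
    then show ?thesis using T_derivative(2)[of s x] s by (simp add: has_vector_derivative_at_within)
  qed
qed

lemma continuous_on_T: "continuous_on {0..} (\<lambda>t. T t x)"
  unfolding continuous_on_def
proof
  fix t :: real assume t: "t \<in> {0..}"
  show "((\<lambda>t. T t x) \<longlongrightarrow> T t x) (at t within {0..})"
  proof (cases "t = 0")
    case True
    then show ?thesis using T_right[of x] by (simp add: T_0 at_within_Ici_at_right)
  next
    case False
    then have "((\<lambda>s. T s x) has_vector_derivative - A (T t x)) (at t)" using T_derivative t by simp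
    then have "isCont (\<lambda>s. T s x) t" by (rule has_vector_derivative_continuous)
    then show ?thesis unfolding isCont_def by (rule tendsto_within_subset) simp
  qed
qed

end

text \<open>Orbits of vectors of \<open>D\<close>, embedded in the complexification as pairs with
  second component 0, satisfy the hypotheses of the orbit estimates. Density of \<open>D\<close>
  extends the bounds on \<open>T t\<close> to all vectors.\<close>

lemma semigroup_bounds:
  fixes D :: "'a::banach set"
  assumes sec: "sectorial D A" and spec: "\<forall>l\<in>op_spectrum D A. Re l > 0"
    and gen: "semigroup_generated_by_minus D A T"
  obtains C where "C \<ge> 0" "\<And>t x. t \<ge> 0 \<Longrightarrow> norm (T t x) \<le> C * norm x / (1 + t)\<^sup>2"
    "\<And>t x. t > 0 \<Longrightarrow> norm (A (T t x)) \<le> C * norm x / t"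
proof -
  interpret minus_generated D A T by unfold_locales (rule gen)
  obtain R :: "complex \<Rightarrow> ('a \<times> 'a) \<Rightarrow>\<^sub>L ('a \<times> 'a)" and M where R: "half_plane_resolvent R M"
    "\<And>l z. l \<in> half_plane \<Longrightarrow> z \<in> D \<times> D \<Longrightarrow> R l (cmul l z + complexify A z) = z"
    using half_plane_resolvent_of_sectorial[OF sec spec] by blast
  interpret half_plane_resolvent R M by (rule R(1))
  have sub: "subspace (op_graph D A)" and dense: "closure D = UNIV"
    using sec unfolding sectorial_def closed_densely_defined_def by auto
  note D0 = op_graph_subspaceD(1,2)[OF sub]
  have res: "R l (cmul l (y, 0)) - R l (- A y, 0) = (y, 0)" if "y \<in> D" "l \<in> half_plane" for y l
  proof -
    have "R l (cmul l (y, 0)) - R l (- A y, 0) = R l (cmul l (y, 0) + complexify A (y, 0))"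
    proof -
      have "cmul l (y, 0) - (- A y, 0) = cmul l (y, 0) + complexify A (y, 0)"
        using D0 by (simp add: complexify_def prod_eq_iff)
      then show ?thesis by (simp only: blinfun.diff_right[symmetric])
    qed
    then show ?thesis using R(2)[OF that(2), of "(y, 0)"] that(1) D0 by simp
  qed
  have der: "((\<lambda>s. (T s x, 0 :: 'a)) has_vector_derivative (- A (T s x), 0)) (at s within {0..})"
    if "x \<in> D" "s \<ge> 0" for x s
    by (intro has_vector_derivative_Pair T_derivative_domain that) (auto intro: derivative_eq_intros)
  define K1 where "K1 = 2 * exp 1 * M ^ 3"
  define K2 where "K2 = 2 * M ^ 3"
  define K3 where "K3 = 6 * exp 1 * M ^ 3"
  have K: "K1 \<ge> 0" "K2 \<ge> 0" "K3 \<ge> 0" using M_ge_1 by (auto simp: K1_def K2_def K3_def)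
  have dom: "norm (T t x) \<le> K1 * norm x \<and> norm (T t x) \<le> K2 * norm x / t\<^sup>2" if "x \<in> D" "t > 0" for t x
    using norm_orbit_le[of "\<lambda>s. (T s x, 0)" "\<lambda>s. (- A (T s x), 0)" t] that
      der[OF that(1)] res[OF T_derivative_domain(1)[OF that(1)]]
    by (simp add: K1_def K2_def T_0)
  have ext: "norm (T t x) \<le> k * norm x" if "t > 0" "\<And>x. x \<in> D \<Longrightarrow> norm (T t x) \<le> k * norm x" for t x k
  proof -
    have "closed {x. norm (T t x) \<le> k * norm x}"
      using that(1) by (intro closed_Collect_le continuous_intros
          linear_continuous_on[OF bounded_linear_T]) auto
    then have "closure D \<subseteq> {x. norm (T t x) \<le> k * norm x}"
      using that(2) by (intro closure_minimal) auto
    then show ?thesis using dense by auto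
  qed
  have T1: "norm (T t x) \<le> K1 * norm x" if "t > 0" for t x
    by (rule ext[OF that]) (use dom that in blast)
  have T2: "norm (T t x) \<le> K2 * norm x / t\<^sup>2" if "t > 0" for t x
    using ext[OF that, of "K2 / t\<^sup>2" x] dom that by auto
  have AT: "norm (A (T t x)) \<le> 2 * K3 * K1 * norm x / t" if t: "t > 0" for t x
  proof -
    \<comment> \<open>Half of the time is spent on regularity: \<open>y\<close> and
      \<open>A y\<close> both lie in \<open>D\<close>, so the orbit of \<open>- A y\<close> is
      differentiable up to time 0. The other half produces the factor \<open>1 / t\<close>.\<close>
    define y where "y = T (t / 2) x"
    have y: "y \<in> D" using T_derivative t by (simp add: y_def)
    have "y = T (t / 4) (T (t / 4) x)" using T_add[of "t / 4" "t / 4" x] t by (simp add: y_def)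
    then have "A y = T (t / 4) (A (T (t / 4) x))"
      using T_derivative_domain(2)[of "T (t / 4) x" "t / 4"] T_derivative[of "t / 4" x] t by simp
    then have Ay: "A y \<in> D" using T_derivative t by simp
    have r1: "R l (cmul l (T s y, 0)) - R l (- A (T s y), 0) = (T s y, 0)" if "s \<ge> 0" "l \<in> half_plane" for s l
      by (rule res[OF T_derivative_domain(1)[OF y that(1)] that(2)])
    have nAy: "- A y \<in> D" using op_graph_subspaceD(4)[OF sub Ay, of "-1"] by simp
    have nT: "T s (- A y) = - A (T s y)" if "s \<ge> 0" for s
      using T_derivative_domain(2)[OF y that] linear_neg[OF bounded_linear.linear[OF bounded_linear_T[OF that]], of "A y"] by simp
    have d2: "((\<lambda>s. (- A (T s y), 0 :: 'a)) has_vector_derivative (- A (T s (- A y)), 0)) (at s within {0..})" if "s \<ge> 0" for s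
      by (rule has_vector_derivative_transform[OF _ _ der[OF nAy that]]) (use that nT in auto)
    have r2: "R l (cmul l (- A (T s y), 0)) - R l (- A (T s (- A y)), 0) = (- A (T s y), 0)" if "s \<ge> 0" "l \<in> half_plane" for s l
      using res[OF T_derivative_domain(1)[OF nAy that(1)] that(2)] nT[OF that(1)] by simp
    have "norm (- A (T (t / 2) y), 0 :: 'a) \<le> 6 * exp 1 * M ^ 3 * norm (T 0 y, 0 :: 'a) / (t / 2)"
      by (rule norm_orbit_derivative_le[where \<phi> = "\<lambda>s. (T s y, 0)" and \<psi> = "\<lambda>s. (- A (T s y), 0)"
            and \<xi> = "\<lambda>s. (- A (T s (- A y)), 0)", OF r1 d2 r2]) (use t in auto)
    moreover have "T (t / 2) y = T t x" using T_add[of "t / 2" "t / 2" x] t by (simp add: y_def)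
    ultimately have "norm (A (T t x)) \<le> K3 * norm y / (t / 2)" by (simp add: K3_def T_0)
    also have "\<dots> \<le> K3 * (K1 * norm x) / (t / 2)"
      using t T1[of "t / 2" x] K by (intro divide_right_mono mult_left_mono) (auto simp: y_def)
    finally show ?thesis by (simp add: mult_ac)
  qed
  \<comment> \<open>The factors 4 come from \<open>(1 + t)^2 \<le> 4\<close> for
    \<open>t \<le> 1\<close> and \<open>(1 + t)^2 \<le> 4 t^2\<close> for
    \<open>t \<ge> 1\<close>.\<close>
  define C where "C = max (max 1 (4 * K1)) (max (4 * K2) (2 * K3 * K1))"
  show ?thesis
  proof (rule that)
    show "C \<ge> 0" by (simp add: C_def)
    fix t :: real and x
    show "norm (T t x) \<le> C * norm x / (1 + t)\<^sup>2" if t: "t \<ge> 0"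
    proof -
      consider "t = 0" | "0 < t" "t \<le> 1" | "1 < t" using t by linarith
      then show ?thesis
      proof cases
        case 1
        have "1 * norm x \<le> C * norm x" by (intro mult_right_mono) (auto simp: C_def)
        then show ?thesis using 1 by (simp add: T_0)
      next
        case 2
        have "(1 + t)\<^sup>2 \<le> (2::real)\<^sup>2" using 2 by (intro power_mono) auto
        then have "norm (T t x) * (1 + t)\<^sup>2 \<le> (K1 * norm x) * 4"
          using T1[OF 2(1), of x] K by (intro mult_mono) auto
        also have "\<dots> = (4 * K1) * norm x" by simp
        also have "\<dots> \<le> C * norm x" by (intro mult_right_mono) (auto simp: C_def)
        finally show ?thesis using 2 by (simp add: pos_le_divide_eq)
      next
        case 3
        have "(1 + t)\<^sup>2 \<le> (2 * t)\<^sup>2" using 3 by (intro power_mono) auto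
        then have "norm (T t x) * (1 + t)\<^sup>2 \<le> (K2 * norm x / t\<^sup>2) * (2 * t)\<^sup>2"
          using T2[of t x] 3 K by (intro mult_mono) auto
        also have "\<dots> = (4 * K2) * norm x" using 3 by (simp add: power_mult_distrib)
        also have "\<dots> \<le> C * norm x" by (intro mult_right_mono) (auto simp: C_def)
        finally show ?thesis using 3 by (simp add: pos_le_divide_eq)
      qed
    qed
    show "norm (A (T t x)) \<le> C * norm x / t" if t: "t > 0"
    proof -
      have "2 * K3 * K1 * norm x / t \<le> C * norm x / t"
        using t by (intro divide_right_mono mult_right_mono) (auto simp: C_def)
      then show ?thesis using AT[OF t, of x] by linarith
    qed
  qed
qed

section \<open>Fractional powers\<close>

text \<open>One bound combines boundedness for small times with quadratic decay. It makes
  \<open>t powr (a - 1)\<close> times the orbit integrable for \<open>0 < a < 2\<close>, in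
  particular for \<open>a = 1\<close>, the case of \<open>A^-1\<close>.\<close>

locale decaying_semigroup = minus_generated +
  fixes C :: real
  assumes C_nonneg: "0 \<le> C"
    and norm_T_le: "t \<ge> 0 \<Longrightarrow> norm (T t x) \<le> C * norm x / (1 + t)\<^sup>2"
    and norm_AT_le: "t > 0 \<Longrightarrow> norm (A (T t x)) \<le> C * norm x / t"
begin

lemma continuous_on_powr_T: "continuous_on {0<..} (\<lambda>t. t powr (a - 1) *\<^sub>R T t x)"
  by (intro continuous_intros continuous_on_subset[OF continuous_on_T]) auto

lemma powr_T_integral:
  assumes a: "0 < a" "a < 2"
  shows "(\<lambda>t. t powr (a - 1) *\<^sub>R T t x) integrable_on {0..}"
    and "norm (integral {0..} (\<lambda>t. t powr (a - 1) *\<^sub>R T t x))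
      \<le> C * norm x * integral {0..} (\<lambda>t. t powr (a - 1) / (1 + t)\<^sup>2)"
proof -
  have g: "(\<lambda>t. (C * norm x) * (t powr (a - 1) / (1 + t)\<^sup>2)) integrable_on {0..}"
    by (intro integrable_on_mult_right integrable_powr_over_square a)
  have le: "norm (t powr (a - 1) *\<^sub>R T t x) \<le> (C * norm x) * (t powr (a - 1) / (1 + t)\<^sup>2)" if "0 < t" for t
  proof -
    have "norm (t powr (a - 1) *\<^sub>R T t x) = t powr (a - 1) * norm (T t x)" by simp
    also have "\<dots> \<le> t powr (a - 1) * (C * norm x / (1 + t)\<^sup>2)"
      using that by (intro mult_left_mono norm_T_le) auto
    finally show ?thesis by (simp add: mult_ac)
  qed
  show "(\<lambda>t. t powr (a - 1) *\<^sub>R T t x) integrable_on {0..}"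
    by (rule integrable_dominated_half_line(1)[OF continuous_on_powr_T g le])
  have "norm (integral {0..} (\<lambda>t. t powr (a - 1) *\<^sub>R T t x))
      \<le> integral {0..} (\<lambda>t. (C * norm x) * (t powr (a - 1) / (1 + t)\<^sup>2))"
    by (rule integrable_dominated_half_line(3)[OF continuous_on_powr_T g le])
  then show "norm (integral {0..} (\<lambda>t. t powr (a - 1) *\<^sub>R T t x))
      \<le> C * norm x * integral {0..} (\<lambda>t. t powr (a - 1) / (1 + t)\<^sup>2)"
    by (simp only: integral_mult_right)
qed

lemma T_integral:
  shows "(\<lambda>t. T t x) integrable_on {0..}"
    and "((\<lambda>b. integral {0..b} (\<lambda>t. T t x)) \<longlongrightarrow> integral {0..} (\<lambda>t. T t x)) at_top"
proof -
  have g: "(\<lambda>t. (C * norm x) * (t powr (1 - 1) / (1 + t)\<^sup>2)) integrable_on {0..}"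
    by (intro integrable_on_mult_right integrable_powr_over_square) auto
  have le: "norm (T t x) \<le> (C * norm x) * (t powr (1 - 1) / (1 + t)\<^sup>2)" if "0 < t" for t
    using norm_T_le[of t x] that by simp
  have c: "continuous_on {0<..} (\<lambda>t. T t x)" by (rule continuous_on_subset[OF continuous_on_T]) auto
  show "(\<lambda>t. T t x) integrable_on {0..}"
    and "((\<lambda>b. integral {0..b} (\<lambda>t. T t x)) \<longlongrightarrow> integral {0..} (\<lambda>t. T t x)) at_top"
    using integrable_dominated_half_line[OF c g le] by auto
qed

lemma linear_T: "t \<ge> 0 \<Longrightarrow> linear (T t)"
  using bounded_linear_T bounded_linear.linear by blast

lemma bounded_linear_neg_frac_power:
  assumes a: "0 \<le> a" "a < 1"
  shows "bounded_linear (neg_frac_power T a)"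
proof (cases "a = 0")
  case True
  then show ?thesis by (simp add: neg_frac_power_def[abs_def] bounded_linear_ident)
next
  case False
  then have a: "0 < a" "a < 2" using assms by auto
  have eqT: "integral {0..} (\<lambda>t. t powr (a - 1) *\<^sub>R T t x) = integral {0..} (\<lambda>t. t powr (a - 1) *\<^sub>R h t)"
    if "\<And>t. t \<ge> 0 \<Longrightarrow> T t x = h t" for x h
    by (rule Henstock_Kurzweil_Integration.integral_cong) (use that in auto)
  show ?thesis
  proof (rule bounded_linear_intro[where K = "\<bar>1 / Gamma a\<bar> * (C * integral {0..} (\<lambda>t. t powr (a - 1) / (1 + t)\<^sup>2))"])
    fix x y
    have "integral {0..} (\<lambda>t. t powr (a - 1) *\<^sub>R T t (x + y))
      = integral {0..} (\<lambda>t. t powr (a - 1) *\<^sub>R T t x) + integral {0..} (\<lambda>t. t powr (a - 1) *\<^sub>R T t y)"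
      by (subst eqT[where h = "\<lambda>t. T t x + T t y"])
        (auto simp: linear_add[OF linear_T] scaleR_add_right intro!: Henstock_Kurzweil_Integration.integral_add powr_T_integral a)
    then show "neg_frac_power T a (x + y) = neg_frac_power T a x + neg_frac_power T a y"
      using False by (simp add: neg_frac_power_def scaleR_add_right)
  next
    fix r x
    have "integral {0..} (\<lambda>t. t powr (a - 1) *\<^sub>R T t (r *\<^sub>R x)) = integral {0..} (\<lambda>t. r *\<^sub>R (t powr (a - 1) *\<^sub>R T t x))"
      by (subst eqT[where h = "\<lambda>t. r *\<^sub>R T t x"]) (auto simp: linear_cmul[OF linear_T] mult.commute)
    also have "\<dots> = r *\<^sub>R integral {0..} (\<lambda>t. t powr (a - 1) *\<^sub>R T t x)" by (rule integral_cmul)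
    finally show "neg_frac_power T a (r *\<^sub>R x) = r *\<^sub>R neg_frac_power T a x"
      using False by (simp add: neg_frac_power_def)
  next
    fix x
    have "norm (neg_frac_power T a x) \<le> \<bar>1 / Gamma a\<bar> * (C * norm x * integral {0..} (\<lambda>t. t powr (a - 1) / (1 + t)\<^sup>2))"
      using False powr_T_integral(2)[OF a, of x] by (simp add: neg_frac_power_def divide_right_mono)
    then show "norm (neg_frac_power T a x) \<le> norm x * (\<bar>1 / Gamma a\<bar> * (C * integral {0..} (\<lambda>t. t powr (a - 1) / (1 + t)\<^sup>2)))"
      by (simp add: mult_ac)
  qed
qed

lemma bounded_linear_neg_frac_power_integral:
  assumes a: "0 < a" "a < 1" and L: "bounded_linear L"
  shows "L (neg_frac_power T a x) = (1 / Gamma a) *\<^sub>R integral {0..} (\<lambda>t. t powr (a - 1) *\<^sub>R L (T t x))"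
proof -
  interpret L: bounded_linear L by (rule L)
  have "L (integral {0..} (\<lambda>t. t powr (a - 1) *\<^sub>R T t x)) = integral {0..} (L \<circ> (\<lambda>t. t powr (a - 1) *\<^sub>R T t x))"
    using a by (intro integral_linear[symmetric] powr_T_integral L) auto
  then show ?thesis using a by (simp add: neg_frac_power_def L.scaleR o_def)
qed

lemma T_neg_frac_power:
  assumes a: "0 \<le> a" "a < 1" and h: "h \<ge> 0"
  shows "T h (neg_frac_power T a x) = neg_frac_power T a (T h x)"
proof (cases "a = 0")
  case False
  have "integral {0..} (\<lambda>t. t powr (a - 1) *\<^sub>R T h (T t x)) = integral {0..} (\<lambda>t. t powr (a - 1) *\<^sub>R T t (T h x))"
  proof (rule Henstock_Kurzweil_Integration.integral_cong)
    fix t :: real assume "t \<in> {0..}"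
    then show "t powr (a - 1) *\<^sub>R T h (T t x) = t powr (a - 1) *\<^sub>R T t (T h x)"
      using T_add[of h t x] T_add[of t h x] h by (simp add: add.commute)
  qed
  then show ?thesis
    using bounded_linear_neg_frac_power_integral[OF _ a(2) bounded_linear_T[OF h], of x] a False
    by (simp add: neg_frac_power_def)
qed (simp add: neg_frac_power_def)

text \<open>The Hahn-Banach theorem reduces \<open>A\<^sup>-\<^sup>a A\<^sup>-\<^sup>(\<^sup>1\<^sup>-\<^sup>a\<^sup>) = A\<^sup>-\<^sup>1\<close> to a statement about real functions.\<close>

lemma neg_frac_power_compose:
  assumes a: "0 < a" "a < 1"
  shows "neg_frac_power T a (neg_frac_power T (1 - a) x) = integral {0..} (\<lambda>u. T u x)"
proof -
  define z where "z = neg_frac_power T a (neg_frac_power T (1 - a) x) - integral {0..} (\<lambda>u. T u x)"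
  obtain \<phi> where \<phi>: "bounded_linear \<phi>" "\<And>x. \<bar>\<phi> x\<bar> \<le> norm x" "\<phi> z = norm z"
    using Hahn_Banach_norming_functional by blast
  define g where "g u = \<phi> (T u x)" for u
  have a': "0 < 1 - a" "1 - a < 1" using a by auto
  have inner: "\<phi> (T t (neg_frac_power T (1 - a) x)) = 1 / Gamma (1 - a) * integral {0..} (\<lambda>s. s powr (- a) * g (t + s))"
    if t: "t \<ge> 0" for t
  proof -
    have "\<phi> (T t (neg_frac_power T (1 - a) x)) = (1 / Gamma (1 - a)) *\<^sub>R integral {0..} (\<lambda>s. s powr (1 - a - 1) *\<^sub>R \<phi> (T t (T s x)))"
      by (rule bounded_linear_neg_frac_power_integral[OF a' bounded_linear_compose[OF \<phi>(1) bounded_linear_T[OF t]]])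
    also have "integral {0..} (\<lambda>s. s powr (1 - a - 1) *\<^sub>R \<phi> (T t (T s x))) = integral {0..} (\<lambda>s. s powr (- a) * g (t + s))"
      using t by (intro Henstock_Kurzweil_Integration.integral_cong) (auto simp: g_def T_add)
    finally show ?thesis by simp
  qed
  have "\<phi> (neg_frac_power T a (neg_frac_power T (1 - a) x))
     = (1 / Gamma a) *\<^sub>R integral {0..} (\<lambda>t. t powr (a - 1) *\<^sub>R \<phi> (T t (neg_frac_power T (1 - a) x)))"
    by (rule bounded_linear_neg_frac_power_integral[OF a \<phi>(1)])
  also have "integral {0..} (\<lambda>t. t powr (a - 1) *\<^sub>R \<phi> (T t (neg_frac_power T (1 - a) x)))
     = integral {0..} (\<lambda>t. 1 / Gamma (1 - a) * (t powr (a - 1) * integral {0..} (\<lambda>s. s powr (- a) * g (t + s))))"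
    by (intro Henstock_Kurzweil_Integration.integral_cong) (auto simp: inner)
  also have "\<dots> = 1 / Gamma (1 - a) * integral {0..} (\<lambda>t. t powr (a - 1) * integral {0..} (\<lambda>s. s powr (- a) * g (t + s)))"
    by (rule integral_mult_right)
  also have "integral {0..} (\<lambda>t. t powr (a - 1) * integral {0..} (\<lambda>s. s powr (- a) * g (t + s)))
     = Gamma a * Gamma (1 - a) * integral {0..} g"
  proof (rule iterated_Abel_integral_real[OF a, where C = "C * norm x"])
    show "continuous_on {0..} g"
      unfolding g_def by (rule bounded_linear.continuous_on[OF \<phi>(1) continuous_on_T])
    show "\<bar>g u\<bar> \<le> C * norm x / (1 + u)\<^sup>2" if "u \<ge> 0" for u
      unfolding g_def using \<phi>(2) norm_T_le[OF that] order_trans by blast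
  qed
  also have "(1 / Gamma a) *\<^sub>R (1 / Gamma (1 - a) * (Gamma a * Gamma (1 - a) * integral {0..} g)) = integral {0..} g"
  proof -
    have "Gamma a > 0" "Gamma (1 - a) > 0" using a by (auto intro: Gamma_real_pos)
    then show ?thesis by simp
  qed
  also have "integral {0..} g = \<phi> (integral {0..} (\<lambda>u. T u x))"
    unfolding g_def using integral_linear[OF T_integral(1) \<phi>(1), of x] by (simp add: o_def)
  finally have "\<phi> z = 0" unfolding z_def by (simp add: linear_diff[OF bounded_linear.linear[OF \<phi>(1)]])
  then show ?thesis using \<phi>(3) by (simp add: z_def)
qed

lemma T_integral_shift:
  assumes h: "0 \<le> h" and b: "0 \<le> b"
  shows "T h (integral {0..b} (\<lambda>u. T u x)) = integral {0..b + h} (\<lambda>u. T u x) - integral {0..h} (\<lambda>u. T u x)"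
proof -
  have int: "(\<lambda>u. T u x) integrable_on {c..d}" if "0 \<le> c" for c d
    using that by (intro integrable_continuous_interval continuous_on_subset[OF continuous_on_T]) auto
  have "T h (integral {0..b} (\<lambda>u. T u x)) = integral {0..b} (\<lambda>u. T h (T u x))"
    using integral_linear[OF int bounded_linear_T[OF h], of 0 b] by (simp add: o_def)
  also have "\<dots> = integral {0..b} (\<lambda>u. T (u + h) x)"
    using h by (intro Henstock_Kurzweil_Integration.integral_cong) (simp add: add.commute[of _ h] T_add)
  also have "\<dots> = integral {h..b + h} (\<lambda>u. T u x)"
  proof -
    have "((\<lambda>u. T (1 *\<^sub>R u + h) x) has_integral (1 / \<bar>1\<bar> ^ DIM(real)) *\<^sub>R integral {h..b + h} (\<lambda>u. T u x)) ((\<lambda>u. (1 / 1) *\<^sub>R u + - ((1 / 1) *\<^sub>R h)) ` cbox h (b + h))"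
      by (rule has_integral_affinity) (use integrable_integral[OF int[OF h]] in auto)
    moreover have "(\<lambda>u. (1 / 1) *\<^sub>R u + - ((1 / 1) *\<^sub>R h)) ` cbox h (b + h) = {0..b}"
      by (auto simp: image_iff)
    ultimately show ?thesis by (simp add: integral_unique)
  qed
  also have "\<dots> = integral {0..b + h} (\<lambda>u. T u x) - integral {0..h} (\<lambda>u. T u x)"
    using Henstock_Kurzweil_Integration.integral_combine[of 0 h "b + h" "\<lambda>u. T u x"] int h b by (simp add: algebra_simps)
  finally show ?thesis .
qed

text \<open>Injectivity of \<open>A^-1\<close>. Applying \<open>T h\<close> to the truncated
  integrals \<open>F b\<close> gives \<open>F (b + h) - F h\<close>; in the limit
  \<open>F h = 0\<close> for every \<open>h\<close>, and the derivative of \<open>F\<close> at 0 is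
  \<open>x\<close>.\<close>

lemma T_integral_eq_0D:
  assumes "integral {0..} (\<lambda>u. T u x) = 0"
  shows "x = 0"
proof -
  define F where "F b = integral {0..b} (\<lambda>u. T u x)" for b
  have lim: "(F \<longlongrightarrow> 0) at_top"
    using T_integral(2)[of x] assms by (simp add: F_def[abs_def])
  have F0: "F h = 0" if h: "h \<ge> 0" for h
  proof -
    interpret Th: bounded_linear "T h" by (rule bounded_linear_T[OF h])
    have "((\<lambda>b. F (b + h) - F h) \<longlongrightarrow> 0 - F h) at_top"
    proof (intro tendsto_diff tendsto_const)
      show "((\<lambda>b. F (b + h)) \<longlongrightarrow> 0) at_top"
        using lim by (rule filterlim_compose) real_asymp
    qed
    moreover have "((\<lambda>b. F (b + h) - F h) \<longlongrightarrow> T h 0) at_top"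
    proof (rule Lim_transform_eventually[OF Th.tendsto[OF lim]])
      show "\<forall>\<^sub>F b in at_top. T h (F b) = F (b + h) - F h"
        using eventually_ge_at_top[of 0]
        by eventually_elim (use T_integral_shift[OF h] in \<open>simp add: F_def\<close>)
    qed
    ultimately have "0 - F h = T h 0" by (rule tendsto_unique[rotated]) simp
    then show ?thesis by (simp add: Th.zero)
  qed
  have "(F has_vector_derivative T 0 x) (at 0 within {0..1})"
    unfolding F_def by (intro integral_has_vector_derivative continuous_on_subset[OF continuous_on_T]) auto
  moreover have "(F has_vector_derivative 0) (at 0 within {0..1})"
    by (rule has_vector_derivative_transform[of _ _ _ "\<lambda>_. 0"]) (auto simp: F0)
  ultimately have "T 0 x = 0"
    using vector_derivative_unique_within_closed_interval[of 0 1 0 F] by auto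
  then show ?thesis by (simp add: T_0)
qed

text \<open>Composition with the complementary power is the integral of the semigroup, whose kernel
  is trivial.\<close>

lemma inj_neg_frac_power:
  assumes a: "0 \<le> a" "a < 1"
  shows "inj (neg_frac_power T a)"
proof (cases "a = 0")
  case True
  then show ?thesis by (simp add: neg_frac_power_def[abs_def])
next
  case False
  then have a': "0 < 1 - a" "1 - a < 1" using a by auto
  have lin: "linear (neg_frac_power T b)" if "0 \<le> b" "b < 1" for b
    using bounded_linear_neg_frac_power[OF that] bounded_linear.linear by blast
  show ?thesis
    unfolding linear_injective_0[OF lin[OF a]]
  proof (intro allI impI)
    fix x assume "neg_frac_power T a x = 0"
    then have "neg_frac_power T (1 - a) (neg_frac_power T (1 - (1 - a)) x) = 0"
      using linear_0[OF lin[of "1 - a"]] a' by simp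
    then show "x = 0"
      unfolding neg_frac_power_compose[OF a'] by (rule T_integral_eq_0D)
  qed
qed

text \<open>For \<open>y = T t x\<close> the map \<open>u \<mapsto> - T u y\<close> is a primitive
  of \<open>T u (A y)\<close>, and it vanishes at infinity by decay. In effect this is
  \<open>A^-1 A y = y\<close>.\<close>

lemma integral_T_generator:
  assumes t: "t > 0"
  shows "integral {0..} (\<lambda>u. T u (A (T t x))) = T t x"
proof (rule tendsto_unique[OF _ T_integral(2)])
  have "((\<lambda>b. T t x - T (t + b) x) \<longlongrightarrow> T t x - 0) at_top"
  proof (rule tendsto_diff[OF tendsto_const], rule Lim_null_comparison)
    show "\<forall>\<^sub>F b in at_top. norm (T (t + b) x) \<le> C * norm x / (1 + (t + b))\<^sup>2"
      using eventually_ge_at_top[of 0] by eventually_elim (use t in \<open>intro norm_T_le, simp\<close>)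
    show "((\<lambda>b. C * norm x / (1 + (t + b))\<^sup>2) \<longlongrightarrow> 0) at_top" by real_asymp
  qed
  moreover have "\<forall>\<^sub>F b in at_top. T t x - T (t + b) x = integral {0..b} (\<lambda>u. T u (A (T t x)))"
    using eventually_ge_at_top[of 0]
  proof eventually_elim
    case (elim b)
    have y: "T t x \<in> D" using T_derivative[OF t] by blast
    have "((\<lambda>u. T u (A (T t x))) has_integral (- T b (T t x)) - (- T 0 (T t x))) {0..b}"
    proof (rule fundamental_theorem_of_calculus[OF elim])
      fix u assume u: "u \<in> {0..b}"
      have "((\<lambda>s. T s (T t x)) has_vector_derivative - A (T u (T t x))) (at u within {0..b})"
        by (rule has_vector_derivative_within_subset[OF T_derivative_domain(3)[OF y]]) (use u in auto)
      then have "((\<lambda>s. - T s (T t x)) has_vector_derivative A (T u (T t x))) (at u within {0..b})"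
        using has_vector_derivative_minus by fastforce
      then show "((\<lambda>s. - T s (T t x)) has_vector_derivative T u (A (T t x))) (at u within {0..b})"
        using T_derivative_domain(2)[OF y, of u] u by simp
    qed
    then show ?case using T_add[of b t x] elim t by (simp add: integral_unique T_0 add.commute)
  qed
  ultimately have "((\<lambda>b. integral {0..b} (\<lambda>u. T u (A (T t x)))) \<longlongrightarrow> T t x - 0) at_top"
    by (rule Lim_transform_eventually)
  then show "((\<lambda>b. integral {0..b} (\<lambda>u. T u (A (T t x)))) \<longlongrightarrow> T t x) at_top" by simp
qed simp

section \<open>The operators \<open>A^a e^(-At)\<close>\<close>

text \<open>This is \<open>A^a T t\<close>, written as \<open>A^-(1 - a)\<close> after
  \<open>A T t\<close>. Both factors have known bounds, whereas \<open>A^a\<close> itself is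
  unbounded in general.\<close>

definition smoothing :: "real \<Rightarrow> real \<Rightarrow> 'a \<Rightarrow> 'a"
  where "smoothing a t x = (if a = 0 then T t x else neg_frac_power T (1 - a) (A (T t x)))"

lemma neg_frac_power_smoothing:
  assumes a: "0 \<le> a" "a < 1" and t: "t > 0"
  shows "neg_frac_power T a (smoothing a t x) = T t x"
proof (cases "a = 0")
  case True
  then show ?thesis by (simp add: smoothing_def neg_frac_power_def)
next
  case False
  then show ?thesis
    using neg_frac_power_compose[of a] integral_T_generator[OF t] a by (simp add: smoothing_def)
qed

lemma T_smoothing:
  assumes a: "0 \<le> a" "a < 1" and t: "t > 0" and h: "h \<ge> 0"
  shows "T h (smoothing a t x) = smoothing a (t + h) x"
proof (rule injD[OF inj_neg_frac_power[OF a]])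
  show "neg_frac_power T a (T h (smoothing a t x)) = neg_frac_power T a (smoothing a (t + h) x)"
    using T_neg_frac_power[OF a h] neg_frac_power_smoothing[OF a] t h T_add[of h t x]
    by (metis add.commute add_pos_nonneg less_imp_le)
qed

text \<open>\<open>A\<close> is linear only on \<open>D\<close>; applying the injective
  \<open>neg_frac_power T a\<close> reduces the claim to linearity of \<open>T t\<close>.\<close>

lemma linear_smoothing:
  assumes a: "0 \<le> a" "a < 1" and t: "t > 0"
  shows "linear (smoothing a t)"
proof -
  have N: "linear (neg_frac_power T a)"
    using bounded_linear_neg_frac_power[OF a] bounded_linear.linear by blast
  note T = linear_T[OF less_imp_le[OF t]]
  note inj = injD[OF inj_neg_frac_power[OF a]]
  show ?thesis
  proof
    show "smoothing a t (x + y) = smoothing a t x + smoothing a t y" for x y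
      by (rule inj) (simp add: linear_add[OF N] linear_add[OF T] neg_frac_power_smoothing[OF a t])
    show "smoothing a t (r *\<^sub>R x) = r *\<^sub>R smoothing a t x" for r x
      by (rule inj) (simp add: linear_cmul[OF N] linear_cmul[OF T] neg_frac_power_smoothing[OF a t])
  qed
qed

text \<open>The integrand involves \<open>A T (s + t) x\<close>, of norm at most
  \<open>C * norm x / t\<close> for \<open>s \<le> t\<close> and \<open>C * norm x / s\<close> for
  \<open>s > t\<close>. Against \<open>s^-a\<close> the two ranges contribute
  \<open>t^-a / (1 - a)\<close> and \<open>t^-a / a\<close>.\<close>

lemma norm_smoothing_le:
  assumes a: "0 \<le> a" "a < 1"
  obtains K where "\<And>t x. t > 0 \<Longrightarrow> norm (smoothing a t x) \<le> K * t powr (- a) * norm x" "K \<ge> 0"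
proof (cases "a = 0")
  case True
  have "norm (T t x) \<le> C * norm x" if "t > 0" for t x
  proof -
    have "1\<^sup>2 \<le> (1 + t)\<^sup>2" using that by (intro power_mono) auto
    then have "C * norm x / (1 + t)\<^sup>2 \<le> C * norm x / 1"
      using C_nonneg that by (intro divide_left_mono) auto
    then show ?thesis using norm_T_le[of t x] that by simp
  qed
  then show ?thesis using True C_nonneg by (intro that[of C]) (auto simp: smoothing_def)
next
  case False
  then have a0: "0 < a" using a by simp
  define K where "K = \<bar>1 / Gamma (1 - a)\<bar> * (C * (1 / (1 - a) + 1 / a))"
  show ?thesis
  proof (rule that)
    show "K \<ge> 0" unfolding K_def using C_nonneg a a0 by (intro mult_nonneg_nonneg) auto
    fix t :: real and x :: 'a assume t: "t > 0"
    define g where "g s = C * norm x * (if s \<le> t then s powr (- a) / t else s powr (- a - 1))" for s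
    have "((\<lambda>s. s powr (- a) / t) has_integral t powr (- a + 1) / (- a + 1) / t) {0..t}"
      using has_integral_powr_from_0[of "- a" t] a t by (intro has_integral_divide) auto
    then have g1: "(g has_integral C * norm x * (t powr (- a + 1) / (- a + 1) / t)) {0..t}"
      by (intro has_integral_eq[OF _ has_integral_mult_right]) (auto simp: g_def)
    have "((\<lambda>s. s powr (- a - 1)) has_integral - (t powr (- a - 1 + 1)) / (- a - 1 + 1)) {t..}"
      using has_integral_powr_to_inf[of "- a - 1" t] a0 t by simp
    then have g2: "(g has_integral C * norm x * (- (t powr (- a - 1 + 1)) / (- a - 1 + 1))) {t..}"
    proof (rule has_integral_spike[of "{t}", rotated 2, OF has_integral_mult_right])
      show "g s = C * norm x * s powr (- a - 1)" if "s \<in> {t..} - {t}" for s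
        using that by (auto simp: g_def)
    qed simp
    have "{0..t} \<union> {t..} = {0..}" "{0..t} \<inter> {t..} = {t}" using t by auto
    then have gi: "(g has_integral C * norm x * (t powr (- a + 1) / (- a + 1) / t) + C * norm x * (- (t powr (- a - 1 + 1)) / (- a - 1 + 1))) {0..}"
      using has_integral_Un[OF g1 g2] by simp
    have tp: "t powr (- a + 1) = t powr (- a) * t" using powr_add[of t "- a" 1] t by simp
    have val: "C * norm x * (t powr (- a + 1) / (- a + 1) / t) + C * norm x * (- (t powr (- a - 1 + 1)) / (- a - 1 + 1))
      = C * (1 / (1 - a) + 1 / a) * t powr (- a) * norm x"
    proof -
      have "z * t / b / t = z / b" for z b :: real using t by simp
      then have "t powr (- a + 1) / (- a + 1) / t = t powr (- a) * (1 / (1 - a))" unfolding tp by simp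
      moreover have "- (t powr (- a - 1 + 1)) / (- a - 1 + 1) = t powr (- a) * (1 / a)" by simp
      ultimately show ?thesis by (simp only: distrib_left distrib_right mult_ac)
    qed
    have le: "norm (s powr (1 - a - 1) *\<^sub>R T s (A (T t x))) \<le> g s" if s: "0 < s" for s
    proof -
      have y: "T t x \<in> D" using T_derivative[OF t] by blast
      have "T s (A (T t x)) = A (T (s + t) x)"
        using T_derivative_domain(2)[OF y, of s] T_add[of s t x] s t by simp
      then have "norm (T s (A (T t x))) \<le> C * norm x / (s + t)" using norm_AT_le[of "s + t" x] s t by simp
      also have "\<dots> \<le> C * norm x / (if s \<le> t then t else s)"
        using s t C_nonneg by (intro divide_left_mono) auto
      finally have "s powr (- a) * norm (T s (A (T t x))) \<le> s powr (- a) * (C * norm x / (if s \<le> t then t else s))"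
        by (intro mult_left_mono) auto
      moreover have "s powr (- a - 1) = s powr (- a) / s" using s by (simp add: powr_diff)
      ultimately show ?thesis by (simp add: g_def mult_ac split: if_splits)
    qed
    have "norm (integral {0..} (\<lambda>s. s powr (1 - a - 1) *\<^sub>R T s (A (T t x)))) \<le> integral {0..} g"
      by (rule integrable_dominated_half_line(3)[OF continuous_on_powr_T _ le]) (use gi in auto)
    also have "\<dots> = C * (1 / (1 - a) + 1 / a) * t powr (- a) * norm x"
      using gi val by (simp add: integral_unique)
    finally have "norm (smoothing a t x) \<le> \<bar>1 / Gamma (1 - a)\<bar> * (C * (1 / (1 - a) + 1 / a) * t powr (- a) * norm x)"
      using False a by (simp add: smoothing_def neg_frac_power_def divide_right_mono)
    then show "norm (smoothing a t x) \<le> K * t powr (- a) * norm x" by (simp add: K_def mult_ac)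
  qed
qed

end

section \<open>Relative compactness and box-counting dimension\<close>

text \<open>In a Banach space, a set is relatively compact if and only if for every positive
  radius it has a finite net.\<close>

definition has_finite_nets :: "'a::metric_space set \<Rightarrow> bool"
  where "has_finite_nets S \<longleftrightarrow> (\<forall>e>0. \<exists>F. finite F \<and> (\<forall>x\<in>S. \<exists>y\<in>F. dist x y < e))"

lemma has_finite_netsD:
  "has_finite_nets S \<Longrightarrow> e > 0 \<Longrightarrow> \<exists>F. finite F \<and> (\<forall>x\<in>S. \<exists>y\<in>F. dist x y < e)"
  by (simp add: has_finite_nets_def)

lemma has_finite_nets_subset:
  assumes "has_finite_nets S" "S' \<subseteq> S" shows "has_finite_nets S'"
  unfolding has_finite_nets_def
proof (intro allI impI)
  fix e :: real assume "e > 0"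
  obtain F where "finite F" "\<forall>x\<in>S. \<exists>y\<in>F. dist x y < e"
    using has_finite_netsD[OF assms(1) \<open>e > 0\<close>] by blast
  then show "\<exists>F. finite F \<and> (\<forall>x\<in>S'. \<exists>y\<in>F. dist x y < e)" using assms(2) by blast
qed

lemma compact_finite_net:
  assumes "compact S" "e > 0"
  obtains F where "F \<subseteq> S" "finite F" "\<forall>x\<in>S. \<exists>y\<in>F. dist x y < e"
proof -
  obtain F where F: "F \<subseteq> S" "finite F" "S \<subseteq> (\<Union>x\<in>F. ball x e)"
  proof (rule compactE_image[OF assms(1), of S "\<lambda>x. ball x e"])
    show "S \<subseteq> (\<Union>x\<in>S. ball x e)" using assms(2) by auto
  qed auto
  have "\<forall>x\<in>S. \<exists>y\<in>F. dist x y < e"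
  proof
    fix x assume "x \<in> S"
    then obtain y where "y \<in> F" "x \<in> ball y e" using F(3) by blast
    then show "\<exists>y\<in>F. dist x y < e" by (auto simp: dist_commute)
  qed
  then show thesis using that F by blast
qed

lemma compact_has_finite_nets: "compact S \<Longrightarrow> has_finite_nets S"
  unfolding has_finite_nets_def by (meson compact_finite_net)

lemma compact_operator_has_finite_nets:
  "compact_operator L \<Longrightarrow> bounded B \<Longrightarrow> has_finite_nets (L ` B)"
  unfolding compact_operator_def
  by (meson closure_subset compact_has_finite_nets has_finite_nets_subset)

text \<open>The operators \<open>L x\<close> form a compact set in operator norm, so finitely many
  of them approximate all uniformly on the ball, and each of these maps the ball to a set with
  finite nets.\<close>

lemma compact_family_has_finite_nets:
  fixes L :: "'c::metric_space \<Rightarrow> 'b::real_normed_vector \<Rightarrow>\<^sub>L 'a::real_normed_vector"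
  assumes K: "compact K" and L: "continuous_on K L" and co: "\<And>x. x \<in> K \<Longrightarrow> compact_operator (L x)"
  shows "has_finite_nets (\<Union>x\<in>K. L x ` cball 0 r)"
  unfolding has_finite_nets_def
proof (intro allI impI)
  fix e :: real assume e: "e > 0"
  define d where "d = e / (2 * (\<bar>r\<bar> + 1))"
  have d: "d > 0" using e by (simp add: d_def)
  obtain F where F: "F \<subseteq> L ` K" "finite F" "\<forall>y\<in>L ` K. \<exists>z\<in>F. dist y z < d"
    using compact_finite_net[OF compact_continuous_image[OF L K] d] by blast
  have "has_finite_nets (l ` cball 0 r)" if "l \<in> F" for l :: "'b \<Rightarrow>\<^sub>L 'a"
    using co F(1) that by (intro compact_operator_has_finite_nets) auto
  then have "\<forall>l\<in>F. \<exists>G. finite G \<and> (\<forall>x\<in>blinfun_apply l ` cball 0 r. \<exists>z\<in>G. dist x z < e / 2)"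
    by (intro ballI has_finite_netsD) (use e in auto)
  then obtain G where G: "\<forall>l\<in>F. finite (G l) \<and> (\<forall>x\<in>blinfun_apply l ` cball 0 r. \<exists>z\<in>G l. dist x z < e / 2)"
    by (rule bchoice[THEN exE])
  show "\<exists>F. finite F \<and> (\<forall>x\<in>(\<Union>x\<in>K. L x ` cball 0 r). \<exists>y\<in>F. dist x y < e)"
  proof (intro exI[of _ "\<Union>l\<in>F. G l"] conjI ballI)
    show "finite (\<Union>l\<in>F. G l)" using F(2) G by auto
    fix w assume "w \<in> (\<Union>x\<in>K. L x ` cball 0 r)"
    then obtain x v where xv: "x \<in> K" "v \<in> cball 0 r" "w = L x v" by blast
    obtain l where l: "l \<in> F" "dist (L x) l < d" using F(3) xv(1) by blast
    obtain z where z: "z \<in> G l" "dist (l v) z < e / 2" using G l(1) xv(2) by blast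
    have "dist w (l v) = norm ((L x - l) v)" by (simp add: xv dist_norm blinfun.diff_left)
    also have "\<dots> \<le> norm (L x - l) * norm v" by (rule norm_blinfun)
    also have "\<dots> \<le> d * (\<bar>r\<bar> + 1)"
      using l(2) xv(2) d by (intro mult_mono) (auto simp: dist_norm)
    also have "\<dots> = e / 2" by (simp add: d_def field_simps)
    finally have "dist w z < e" using z(2) dist_triangle[of w z "l v"] by simp
    then show "\<exists>y\<in>\<Union>l\<in>F. G l. dist w y < e" using l z by blast
  qed
qed

text \<open>A Riemann sum divided by \<open>b - a\<close> is a convex combination of values of
  \<open>h\<close>, and exchanging each value for a nearby element of \<open>F\<close> costs at most
  \<open>d\<close>; \<open>e\<close> absorbs the error of the Riemann sum. For finite
  \<open>F\<close> the hull is compact, which yields finite nets for integrals.\<close>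

lemma integral_near_convex_hull:
  fixes h :: "real \<Rightarrow> 'a::banach"
  assumes h: "h integrable_on {a..b}" and ab: "a < b"
    and near: "\<And>s. s \<in> {a..b} \<Longrightarrow> \<exists>q\<in>F. norm (h s - q) \<le> d" and e: "e > 0"
  shows "\<exists>p\<in>convex hull F. norm (integral {a..b} h - (b - a) *\<^sub>R p) \<le> (b - a) * d + e"
proof -
  have "(h has_integral integral {a..b} h) (cbox a b)" using h by (simp add: integrable_integral)
  then obtain \<gamma> where \<gamma>: "gauge \<gamma>" "\<And>D. D tagged_division_of cbox a b \<Longrightarrow> \<gamma> fine D \<Longrightarrow>
      norm ((\<Sum>(x, k)\<in>D. measure lborel k *\<^sub>R h x) - integral {a..b} h) < e"
    unfolding has_integral using e by meson
  obtain D where D: "D tagged_division_of cbox a b" "\<gamma> fine D"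
    using fine_division_exists[OF \<gamma>(1), of a b] by blast
  obtain q where q: "\<And>s. s \<in> {a..b} \<Longrightarrow> q s \<in> F \<and> norm (h s - q s) \<le> d" using near by metis
  have fin: "finite D" using D(1) by blast
  have tag: "x \<in> {a..b}" if "(x, k) \<in> D" for x k
    using tagged_division_ofD(2,3)[OF D(1) that] by auto
  have cont: "(\<Sum>(x, k)\<in>D. measure lborel k) = b - a"
    using additive_content_tagged_division[OF D(1)] ab by simp
  define p where "p = (\<Sum>xk\<in>D. (measure lborel (snd xk) / (b - a)) *\<^sub>R q (fst xk))"
  have "p \<in> convex hull F"
    unfolding p_def
  proof (rule convex_sum[OF fin convex_convex_hull])
    show "(\<Sum>xk\<in>D. measure lborel (snd xk) / (b - a)) = 1"
      using cont ab by (simp add: split_beta flip: sum_divide_distrib)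
    show "q (fst xk) \<in> convex hull F" if "xk \<in> D" for xk
      using q tag[of "fst xk" "snd xk"] that by (auto intro: hull_inc)
  qed (use ab in auto)
  moreover have "norm ((\<Sum>(x, k)\<in>D. measure lborel k *\<^sub>R h x) - (b - a) *\<^sub>R p) \<le> (b - a) * d"
  proof -
    have "(b - a) *\<^sub>R p = (\<Sum>(x, k)\<in>D. measure lborel k *\<^sub>R q x)"
      using ab by (simp add: p_def scaleR_sum_right split_beta)
    then have "norm ((\<Sum>(x, k)\<in>D. measure lborel k *\<^sub>R h x) - (b - a) *\<^sub>R p) = norm (\<Sum>(x, k)\<in>D. measure lborel k *\<^sub>R (h x - q x))"
      by (simp add: split_beta scaleR_diff_right sum_subtractf)
    also have "\<dots> \<le> (\<Sum>(x, k)\<in>D. measure lborel k * d)"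
      unfolding split_beta
    proof (rule sum_norm_le)
      fix xk assume "xk \<in> D"
      then show "norm (measure lborel (snd xk) *\<^sub>R (h (fst xk) - q (fst xk))) \<le> measure lborel (snd xk) * d"
        using q tag[of "fst xk" "snd xk"] by (simp add: mult_left_mono)
    qed
    also have "\<dots> = (b - a) * d" using cont by (simp add: split_beta flip: sum_distrib_right)
    finally show ?thesis .
  qed
  moreover have "norm (integral {a..b} h - (\<Sum>(x, k)\<in>D. measure lborel k *\<^sub>R h x)) < e"
    using \<gamma>(2)[OF D] by (simp add: norm_minus_commute)
  ultimately show ?thesis
    using norm_triangle_ineq[of "integral {a..b} h - (\<Sum>(x, k)\<in>D. measure lborel k *\<^sub>R h x)" "(\<Sum>(x, k)\<in>D. measure lborel k *\<^sub>R h x) - (b - a) *\<^sub>R p"]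
    by (intro bexI[of _ p]) auto
qed

lemma covering_number_le:
  assumes "finite C" "K \<subseteq> (\<Union>c\<in>C. ball c \<epsilon>)"
  shows "covering_number K \<epsilon> \<le> card C"
  unfolding covering_number_def by (rule Least_le) (use assms in blast)

text \<open>Covers of \<open>\<Phi> ` (K \<inter> ball x r)\<close> by at most \<open>n\<close> balls of half the radius iterate to covers of \<open>K\<close> by
  at most \<open>N n\<^sup>k\<close> balls of radius \<open>r0 / 2\<^sup>k\<close>.\<close>

lemma upper_box_dim_finite_of_halving:
  fixes K :: "'b::metric_space set" and \<Phi> :: "'b \<Rightarrow> 'b"
  assumes K: "compact K" and \<Phi>: "\<Phi> ` K = K" and r0: "r0 > 0" and n: "n \<ge> 1"
    and step: "\<And>x r. x \<in> K \<Longrightarrow> 0 < r \<Longrightarrow> r \<le> r0 \<Longrightarrow>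
      \<exists>C. finite C \<and> card C \<le> n \<and> C \<subseteq> K \<and> \<Phi> ` (K \<inter> ball x r) \<subseteq> (\<Union>c\<in>C. ball c (r / 2))"
  shows "upper_box_dim K < \<infinity>"
proof -
  obtain C0 where C0: "C0 \<subseteq> K" "finite C0" "\<forall>x\<in>K. \<exists>y\<in>C0. dist x y < r0"
    using compact_finite_net[OF K r0] by blast
  define N where "N = max 1 (card C0)"
  have cover: "\<exists>C. finite C \<and> card C \<le> N * n ^ k \<and> C \<subseteq> K \<and> K \<subseteq> (\<Union>c\<in>C. ball c (r0 / 2 ^ k))" for k
  proof (induction k)
    case 0
    then show ?case using C0 by (intro exI[of _ C0]) (auto simp: N_def dist_commute)
  next
    case (Suc k)
    then obtain C where C: "finite C" "card C \<le> N * n ^ k" "C \<subseteq> K" "K \<subseteq> (\<Union>c\<in>C. ball c (r0 / 2 ^ k))" by blast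
    have r: "0 < r0 / 2 ^ k" "r0 / 2 ^ k \<le> r0" using r0 by (auto simp: divide_le_eq mult_le_cancel_left1)
    have "\<exists>E. finite E \<and> card E \<le> n \<and> E \<subseteq> K \<and> \<Phi> ` (K \<inter> ball x (r0 / 2 ^ k)) \<subseteq> (\<Union>c\<in>E. ball c (r0 / 2 ^ k / 2))" if "x \<in> C" for x
      using step[OF _ r] C(3) that by blast
    then obtain E where E: "\<And>x. x \<in> C \<Longrightarrow> finite (E x) \<and> card (E x) \<le> n \<and> E x \<subseteq> K \<and> \<Phi> ` (K \<inter> ball x (r0 / 2 ^ k)) \<subseteq> (\<Union>c\<in>E x. ball c (r0 / 2 ^ k / 2))"
      by metis
    show ?case
    proof (intro exI[of _ "\<Union>x\<in>C. E x"] conjI)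
      show "finite (\<Union>x\<in>C. E x)" using C(1) E by auto
      have "card (\<Union>x\<in>C. E x) \<le> (\<Sum>x\<in>C. card (E x))" by (rule card_UN_le[OF C(1)])
      also have "\<dots> \<le> (\<Sum>x\<in>C. n)" using E by (intro sum_mono) auto
      also have "\<dots> \<le> N * n ^ k * n" using C(2) by simp
      finally show "card (\<Union>x\<in>C. E x) \<le> N * n ^ Suc k" by (simp add: mult_ac)
      show "(\<Union>x\<in>C. E x) \<subseteq> K" using E by auto
      show "K \<subseteq> (\<Union>c\<in>(\<Union>x\<in>C. E x). ball c (r0 / 2 ^ Suc k))"
      proof
        fix y assume "y \<in> K"
        then obtain z where z: "z \<in> K" "y = \<Phi> z" using \<Phi> by blast
        then obtain x where x: "x \<in> C" "z \<in> ball x (r0 / 2 ^ k)" using C(4) by blast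
        then have "y \<in> (\<Union>c\<in>E x. ball c (r0 / 2 ^ k / 2))" using E[OF x(1)] z by blast
        then show "y \<in> (\<Union>c\<in>(\<Union>x\<in>C. E x). ball c (r0 / 2 ^ Suc k))" using x(1) by (auto simp: mult.commute)
      qed
    qed
  qed
  \<comment> \<open>With \<open>k\<close> halvings,
    \<open>k \<le> |ln r0| / ln 2 - ln \<epsilon> / ln 2 + 1\<close>, the logarithm of the number of
    balls is at most \<open>ln N + k ln n\<close>. For \<open>\<epsilon> < exp (- 1)\<close> one has
    \<open>- ln \<epsilon> > 1\<close>, so additive constants may be multiplied by
    \<open>- ln \<epsilon>\<close>.\<close>
  define B where "B = ln N + ln n * (2 + \<bar>ln r0\<bar> / ln 2 + 1 / ln 2)"
  have ln2: "ln 2 > (0::real)" by simp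
  have N: "1 \<le> N" by (simp add: N_def)
  have bound: "ereal (ln (real (covering_number K \<epsilon>)) / - ln \<epsilon>) \<le> ereal B"
    if \<epsilon>: "0 < \<epsilon>" "\<epsilon> < exp (- 1)" for \<epsilon>
  proof -
    have L: "- ln \<epsilon> > 1"
      using ln_less_cancel_iff[of \<epsilon> "exp (- 1)"] \<epsilon> by simp
    define k where "k = nat \<lceil>(ln r0 - ln \<epsilon>) / ln 2\<rceil>"
    have k1: "(ln r0 - ln \<epsilon>) / ln 2 \<le> real k" unfolding k_def by linarith
    have k2: "real k \<le> \<bar>ln r0\<bar> / ln 2 + - ln \<epsilon> / ln 2 + 1"
    proof -
      have "real k \<le> max 0 ((ln r0 - ln \<epsilon>) / ln 2 + 1)" unfolding k_def by linarith
      also have "\<dots> \<le> \<bar>ln r0\<bar> / ln 2 + - ln \<epsilon> / ln 2 + 1"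
      proof -
        have "ln r0 / ln 2 \<le> \<bar>ln r0\<bar> / ln 2" by (intro divide_right_mono) auto
        moreover have "0 \<le> - ln \<epsilon> / ln 2" using L by (intro divide_nonneg_nonneg) auto
        moreover have "0 \<le> \<bar>ln r0\<bar> / ln 2" by simp
        moreover have "(ln r0 - ln \<epsilon>) / ln 2 = ln r0 / ln 2 + - ln \<epsilon> / ln 2" by (simp add: diff_divide_distrib)
        ultimately show ?thesis by linarith
      qed
      finally show ?thesis .
    qed
    have "ln r0 - ln \<epsilon> \<le> real k * ln 2" using k1 by (simp add: pos_divide_le_eq)
    then have "ln (r0 / 2 ^ k) \<le> ln \<epsilon>" using r0 by (simp add: ln_div ln_realpow)
    then have re: "r0 / 2 ^ k \<le> \<epsilon>" using r0 \<epsilon> by simp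
    obtain C where C: "finite C" "card C \<le> N * n ^ k" "K \<subseteq> (\<Union>c\<in>C. ball c (r0 / 2 ^ k))" using cover by blast
    have "K \<subseteq> (\<Union>c\<in>C. ball c \<epsilon>)" using C(3) subset_ball[OF re] by blast
    then have "covering_number K \<epsilon> \<le> N * n ^ k"
      using covering_number_le[OF C(1)] C(2) order_trans by blast
    then have cn: "real (covering_number K \<epsilon>) \<le> real N * real n ^ k"
      by (metis of_nat_le_iff of_nat_mult of_nat_power)
    have "ln (real (covering_number K \<epsilon>)) \<le> ln (real N * real n ^ k)"
    proof (cases "covering_number K \<epsilon> = 0")
      \<comment> \<open>Here \<open>K\<close> is empty and \<open>ln 0 = 0\<close>, so the
        right-hand side only has to be nonnegative.\<close>
      case True
      have "1 \<le> real N * real n ^ k" using N n by (simp add: one_le_power mult_ge1_I)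
      then show ?thesis using True by simp
    next
      case False
      then show ?thesis using cn by (intro ln_mono) auto
    qed
    also have "\<dots> = ln N + real k * ln n" using N n by (simp add: ln_mult ln_realpow)
    also have "\<dots> \<le> ln N + (\<bar>ln r0\<bar> / ln 2 + - ln \<epsilon> / ln 2 + 1) * ln n"
      using k2 n by (intro add_left_mono mult_right_mono) auto
    also have "\<dots> \<le> B * (- ln \<epsilon>)"
    proof -
      have p: "0 \<le> ln (real N)" "0 \<le> ln (real n)" using N n by auto
      have "ln N * 1 \<le> ln N * (- ln \<epsilon>)" using p L by (intro mult_left_mono) auto
      moreover have "(\<bar>ln r0\<bar> / ln 2 + 1) * 1 \<le> (\<bar>ln r0\<bar> / ln 2 + 1) * (- ln \<epsilon>)"
        using L by (intro mult_left_mono) auto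
      then have "\<bar>ln r0\<bar> / ln 2 + - ln \<epsilon> / ln 2 + 1 \<le> (2 + \<bar>ln r0\<bar> / ln 2 + 1 / ln 2) * (- ln \<epsilon>)"
        using L by (simp add: algebra_simps)
      then have "(\<bar>ln r0\<bar> / ln 2 + - ln \<epsilon> / ln 2 + 1) * ln n \<le> (2 + \<bar>ln r0\<bar> / ln 2 + 1 / ln 2) * (- ln \<epsilon>) * ln n"
        using p by (intro mult_right_mono)
      ultimately show ?thesis unfolding B_def by (simp add: algebra_simps)
    qed
    finally have "ln (real (covering_number K \<epsilon>)) / - ln \<epsilon> \<le> B"
      by (subst pos_divide_le_eq) (use L in auto)
    then show ?thesis by simp
  qed
  have "upper_box_dim K \<le> ereal B"
    unfolding upper_box_dim_def
  proof (rule Limsup_bounded)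
    have "\<forall>\<^sub>F \<epsilon> in at_right 0. 0 < \<epsilon> \<and> \<epsilon> < exp (- 1 :: real)"
      by (auto simp: eventually_at_right_field intro!: exI[of _ "exp (- 1 :: real)"])
    then show "\<forall>\<^sub>F \<epsilon> in at_right 0. ereal (ln (real (covering_number K \<epsilon>)) / - ln \<epsilon>) \<le> ereal B"
      by eventually_elim (use bound in blast)
  qed
  then show ?thesis by (rule le_less_trans) simp
qed

section \<open>Mild solutions\<close>

text \<open>Neighbourhoods of \<open>K\<close> need not be compact, so a Lebesgue number argument is
  used: it bounds \<open>f' w - f' x\<close> for \<open>x\<close> in \<open>K\<close> and arbitrary
  \<open>w\<close> within \<open>\<rho>\<close> of \<open>x\<close>. The mean value inequality on
  that ball finishes the proof.\<close>

lemma uniform_linearization_on_compact: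
  fixes f :: "'b::real_normed_vector \<Rightarrow> 'a::real_normed_vector" and f' :: "'b \<Rightarrow> 'b \<Rightarrow>\<^sub>L 'a"
  assumes K: "compact K" and f: "\<And>x. (f has_derivative f' x) (at x)"
    and f': "continuous_on UNIV f'" and e: "e > 0"
  obtains \<rho> where "\<rho> > 0" "\<And>x y. x \<in> K \<Longrightarrow> norm (y - x) \<le> \<rho> \<Longrightarrow> norm (f y - f x - f' x (y - x)) \<le> e * norm (y - x)"
proof -
  have "\<exists>d>0. \<forall>z. dist z x < 2 * d \<longrightarrow> dist (f' z) (f' x) < e / 2" for x
  proof -
    obtain d where "d > 0" "\<forall>z. dist z x < d \<longrightarrow> dist (f' z) (f' x) < e / 2"
      using f' e unfolding continuous_on_iff by (metis UNIV_I half_gt_zero)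
    then show ?thesis by (intro exI[of _ "d / 2"]) auto
  qed
  then obtain d where d: "\<And>x. d x > 0" "\<And>x z. dist z x < 2 * d x \<Longrightarrow> dist (f' z) (f' x) < e / 2" by metis
  obtain F where F: "F \<subseteq> K" "finite F" "K \<subseteq> (\<Union>x\<in>F. ball x (d x))"
  proof (rule compactE_image[OF K, of K "\<lambda>x. ball x (d x)"])
    show "K \<subseteq> (\<Union>x\<in>K. ball x (d x))" using d by auto
  qed auto
  \<comment> \<open>The inserted 1 keeps the minimum defined if \<open>F\<close> is empty; halving
    makes the inequality \<open>\<rho> < d x\<close> strict.\<close>
  define \<rho> where "\<rho> = Min (insert 1 (d ` F)) / 2"
  have m: "Min (insert 1 (d ` F)) > 0" using F(2) d by (subst Min_gr_iff) auto
  then have \<rho>: "\<rho> > 0" by (simp add: \<rho>_def)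
  have \<rho>d: "\<rho> < d x" if "x \<in> F" for x
  proof -
    have "Min (insert 1 (d ` F)) \<le> d x" using F(2) that by (intro Min_le) auto
    then show ?thesis using m by (simp add: \<rho>_def)
  qed
  show thesis
  proof (rule that[OF \<rho>])
    fix x y assume x: "x \<in> K" and y: "norm (y - x) \<le> \<rho>"
    obtain z where z: "z \<in> F" "dist x z < d z" using F(3) x by (auto simp: dist_commute)
    have near: "dist w z < 2 * d z" if "dist w x \<le> \<rho>" for w
      using dist_triangle[of w z x] z that \<rho>d[OF z(1)] by simp
    have "norm (f y - f x - f' x (y - x)) \<le> norm (y - x) * e"
    proof (rule differentiable_bound_linearization[where S = "cball x \<rho>" and f' = "\<lambda>w. f' w"])
      fix t :: real assume "t \<in> {0..1}"
      then have "\<bar>t\<bar> * norm (y - x) \<le> 1 * \<rho>" using y by (intro mult_mono) auto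
      then show "x + t *\<^sub>R (y - x) \<in> cball x \<rho>" by (simp add: dist_norm)
    next
      fix w assume w: "w \<in> cball x \<rho>"
      show "(f has_derivative f' w) (at w within cball x \<rho>)" using f by (rule has_derivative_at_withinI)
      have "dist (f' w) (f' z) < e / 2" using w by (intro d(2) near) (simp add: dist_commute)
      moreover have "dist (f' x) (f' z) < e / 2" using \<rho> by (intro d(2) near) auto
      ultimately have n: "norm (f' w - f' x) \<le> e"
        using dist_triangle2[of "f' w" "f' x" "f' z"] by (simp add: dist_norm)
      show "onorm (blinfun_apply (f' w) - blinfun_apply (f' x)) \<le> e"
      proof (rule onorm_bound)
        fix v
        have "norm ((f' w - f' x) v) \<le> norm (f' w - f' x) * norm v" by (rule norm_blinfun)
        also have "\<dots> \<le> e * norm v" using n by (intro mult_right_mono) auto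
        finally show "norm ((blinfun_apply (f' w) - blinfun_apply (f' x)) v) \<le> e * norm v"
          by (simp add: blinfun.diff_left)
      qed (use e in simp)
    qed (use \<rho> in auto)
    then show "norm (f y - f x - f' x (y - x)) \<le> e * norm (y - x)" by (simp add: mult.commute)
  qed
qed

text \<open>The integrand may blow up at \<open>s = t\<close>, but its primitive stays continuous
  there because \<open>\<alpha> < 1\<close>.\<close>

lemma has_integral_powr_endpoint:
  fixes a t :: real
  assumes "a \<le> t" "\<alpha> < 1"
  shows "((\<lambda>s. (t - s) powr (- \<alpha>)) has_integral (t - a) powr (1 - \<alpha>) / (1 - \<alpha>)) {a..t}"
proof -
  have "((\<lambda>s. (t - s) powr (- \<alpha>)) has_integral (- ((t - t) powr (1 - \<alpha>) / (1 - \<alpha>))) - (- ((t - a) powr (1 - \<alpha>) / (1 - \<alpha>)))) {a..t}"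
  proof (rule fundamental_theorem_of_calculus_interior[OF assms(1)])
    show "continuous_on {a..t} (\<lambda>s. - ((t - s) powr (1 - \<alpha>) / (1 - \<alpha>)))"
      using assms by (intro continuous_intros continuous_on_powr') auto
    fix s assume s: "s \<in> {a<..<t}"
    have "((\<lambda>s. - ((t - s) powr (1 - \<alpha>) / (1 - \<alpha>))) has_real_derivative (t - s) powr (- \<alpha>)) (at s)"
    proof -
      have "((\<lambda>s. (t - s) powr (1 - \<alpha>)) has_real_derivative (1 - \<alpha>) * (t - s) powr (1 - \<alpha> - of_nat 1) * (- 1)) (at s)"
        using s by (intro DERIV_fun_powr) (auto intro!: derivative_eq_intros)
      from DERIV_minus[OF DERIV_cdivide[OF this, of "1 - \<alpha>"]] show ?thesis using assms by simp
    qed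
    then show "((\<lambda>s. - ((t - s) powr (1 - \<alpha>) / (1 - \<alpha>))) has_vector_derivative (t - s) powr (- \<alpha>)) (at s)"
      by (simp add: has_real_derivative_iff_has_vector_derivative)
  qed
  then show ?thesis by simp
qed

lemma exists_small_powr:
  fixes B p e :: real
  assumes "0 \<le> B" "0 < p" "0 < e" "0 < \<tau>"
  obtains h where "0 < h" "h < \<tau>" "B * h powr p \<le> e"
proof -
  have "((\<lambda>h. B * h powr p) \<longlongrightarrow> B * 0 powr p) (at_right 0)"
    using assms(2) by (intro tendsto_mult tendsto_const tendsto_powr' tendsto_ident_at) (auto simp: eventually_at_right_field intro!: exI[of _ 1])
  then have "\<forall>\<^sub>F h in at_right 0. B * h powr p < e"
    using assms by (intro order_tendstoD) auto
  moreover have "\<forall>\<^sub>F h in at_right 0. h < \<tau>" using assms(4) by (auto simp: eventually_at_right_field)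
  moreover have "\<forall>\<^sub>F h in at_right 0. (0::real) < h" by (rule eventually_at_right_less)
  ultimately have "\<forall>\<^sub>F h in at_right 0. 0 < h \<and> h < \<tau> \<and> B * h powr p \<le> e" by eventually_elim auto
  then have "\<exists>h. 0 < h \<and> h < \<tau> \<and> B * h powr p \<le> e"
    by (rule eventually_happens'[OF trivial_limit_at_right_real])
  then show thesis using that by blast
qed

section \<open>Semigroup and smoothing operators on \<open>X^\<alpha>\<close>\<close>

text \<open>\<open>U t\<close> is \<open>e^(-At)\<close> on \<open>X^\<alpha>\<close> and
  \<open>V t\<close> is \<open>e^(-At)\<close> from \<open>X\<close> to \<open>X^\<alpha>\<close>.
  Nothing else about the operator and its fractional powers enters the study of the flow.\<close>

locale smoothing_pair =
  fixes U :: "real \<Rightarrow> 'b::banach \<Rightarrow> 'b" and V :: "real \<Rightarrow> 'a::banach \<Rightarrow> 'b" and \<alpha> C M :: real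
  assumes \<alpha>: "0 \<le> \<alpha>" "\<alpha> < 1" and C: "0 \<le> C" and M: "0 \<le> M"
    and linear_U: "0 \<le> t \<Longrightarrow> bounded_linear (U t)"
    and norm_U_le: "0 \<le> t \<Longrightarrow> norm (U t v) \<le> M * norm v"
    and continuous_on_U: "continuous_on {0..} (\<lambda>t. U t v)"
    and linear_V: "0 < t \<Longrightarrow> linear (V t)"
    and norm_V_le: "0 < t \<Longrightarrow> norm (V t x) \<le> C * t powr (- \<alpha>) * norm x"
    and U_V: "0 \<le> h \<Longrightarrow> 0 < t \<Longrightarrow> U h (V t x) = V (t + h) x"
begin

text \<open>For \<open>s\<close> near \<open>t\<close> one has
  \<open>V s x = U (s - t / 2) (V (t / 2) x)\<close>, so continuity is inherited from the orbits of
  \<open>U\<close>.\<close>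

lemma continuous_on_V: "continuous_on {0<..} (\<lambda>t. V t x)"
  unfolding continuous_on_eq_continuous_at[OF open_greaterThan]
proof
  fix t :: real assume t: "t \<in> {0<..}"
  have "continuous_on {t / 2<..} (\<lambda>s. U (s - t / 2) (V (t / 2) x))"
    by (rule continuous_on_compose2[OF continuous_on_U]) (auto intro!: continuous_intros)
  then have "continuous_on {t / 2<..} (\<lambda>s. V s x)"
    by (rule continuous_on_eq) (use t in \<open>simp add: U_V\<close>)
  then show "isCont (\<lambda>s. V s x) t"
    using t continuous_on_eq_continuous_at[OF open_greaterThan[of "t / 2"]] by fastforce
qed

text \<open>The bound on \<open>V\<close>, locally uniform at positive times, controls the change of
  the vector; the change of time for a fixed vector is \<open>continuous_on_V\<close>.\<close>

lemma continuous_on_V2: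
  assumes r: "continuous_on I r" "\<And>s. s \<in> I \<Longrightarrow> 0 < r s" and g: "continuous_on I g"
  shows "continuous_on I (\<lambda>s. V (r s) (g s))"
  unfolding continuous_on_def
proof
  fix s assume s: "s \<in> I"
  have rt: "(r \<longlongrightarrow> r s) (at s within I)" and gt: "(g \<longlongrightarrow> g s) (at s within I)"
    using r g s by (auto simp: continuous_on_def)
  have ev: "\<forall>\<^sub>F u in at s within I. u \<in> I" by (simp add: eventually_at_filter)
  have "((\<lambda>u. V (r u) (g u - g s)) \<longlongrightarrow> 0) (at s within I)"
  proof (rule Lim_null_comparison)
    show "\<forall>\<^sub>F u in at s within I. norm (V (r u) (g u - g s)) \<le> C * r u powr (- \<alpha>) * norm (g u - g s)"
      using ev by eventually_elim (rule norm_V_le[OF r(2)])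
    have "((\<lambda>u. C * r u powr (- \<alpha>) * norm (g u - g s)) \<longlongrightarrow> C * r s powr (- \<alpha>) * norm (g s - g s)) (at s within I)"
      by (intro tendsto_mult tendsto_const tendsto_powr tendsto_norm tendsto_diff rt gt) (use r(2)[OF s] in auto)
    then show "((\<lambda>u. C * r u powr (- \<alpha>) * norm (g u - g s)) \<longlongrightarrow> 0) (at s within I)" by simp
  qed
  moreover have "((\<lambda>u. V (r u) (g s)) \<longlongrightarrow> V (r s) (g s)) (at s within I)"
  proof (rule isCont_tendsto_compose[OF _ rt])
    show "isCont (\<lambda>t. V t (g s)) (r s)"
      using continuous_on_V[of "g s"] r(2)[OF s] continuous_on_eq_continuous_at[OF open_greaterThan[of 0]] by fastforce
  qed
  ultimately have "((\<lambda>u. V (r u) (g u - g s) + V (r u) (g s)) \<longlongrightarrow> 0 + V (r s) (g s)) (at s within I)"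
    by (rule tendsto_add)
  moreover have "\<forall>\<^sub>F u in at s within I. V (r u) (g u - g s) + V (r u) (g s) = V (r u) (g u)"
    using ev by eventually_elim (simp add: linear_diff[OF linear_V[OF r(2)]])
  ultimately show "((\<lambda>u. V (r u) (g u)) \<longlongrightarrow> V (r s) (g s)) (at s within I)"
    by (simp add: Lim_transform_eventually)
qed

lemma V_integrable:
  assumes g: "continuous_on {0..t} g" and ab: "0 \<le> a" "b \<le> t"
  shows "(\<lambda>s. V (t - s) (g s)) integrable_on {a..b}"
proof -
  have "(\<lambda>s. V (t - s) (g s)) integrable_on {0..t}"
  proof (cases "0 \<le> t")
    case True
    have "\<exists>B. \<forall>s\<in>{0..t}. norm (g s) \<le> B"
      using compact_imp_bounded[OF compact_continuous_image[OF g]] unfolding bounded_iff by auto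
    then obtain B where B: "\<And>s. s \<in> {0..t} \<Longrightarrow> norm (g s) \<le> B" by blast
    show ?thesis
    proof (rule integrable_dominated_right)
      show "continuous_on {0..<t} (\<lambda>s. V (t - s) (g s))"
        by (intro continuous_on_V2 continuous_intros continuous_on_subset[OF g]) auto
      show "(\<lambda>s. C * B * (t - s) powr (- \<alpha>)) integrable_on {0..t}"
        using has_integral_powr_endpoint[OF True \<alpha>(2)] by (intro integrable_on_mult_right) auto
      show "norm (V (t - s) (g s)) \<le> C * B * (t - s) powr (- \<alpha>)" if "0 \<le> s" "s < t" for s
      proof -
        have "norm (V (t - s) (g s)) \<le> C * (t - s) powr (- \<alpha>) * norm (g s)"
          using that by (intro norm_V_le) auto
        also have "\<dots> \<le> C * (t - s) powr (- \<alpha>) * B"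
          using that C B[of s] by (intro mult_left_mono) auto
        finally show ?thesis by (simp add: mult_ac)
      qed
    qed
  qed auto
  then show ?thesis by (rule integrable_on_subinterval) (use ab in auto)
qed

lemma norm_V_integral_le:
  assumes g: "continuous_on {0..t} g" and ab: "0 \<le> a" "a \<le> b" "b \<le> t"
    and B: "\<And>s. s \<in> {a..b} \<Longrightarrow> norm (g s) \<le> B"
  shows "norm (integral {a..b} (\<lambda>s. V (t - s) (g s))) \<le> C * B * ((t - a) powr (1 - \<alpha>) / (1 - \<alpha>))"
proof -
  have at: "a \<le> t" using ab by simp
  have B0: "0 \<le> B" using B[of a] ab norm_ge_zero order_trans by (metis atLeastAtMost_iff order_refl)
  note hi = has_integral_powr_endpoint[OF at \<alpha>(2)]
  define k where "k s = C * B * (t - s) powr (- \<alpha>)" for s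
  have ki: "k integrable_on {a..t}" unfolding k_def using hi by (intro integrable_on_mult_right) auto
  have ki': "k integrable_on {a..b}" by (rule integrable_on_subinterval[OF ki]) (use ab in auto)
  \<comment> \<open>The value of \<open>V\<close> at time 0 is unconstrained, so the integrand is
    set to 0 at \<open>s = t\<close>.\<close>
  have "norm (integral {a..b} (\<lambda>s. if s = t then 0 else V (t - s) (g s))) \<le> integral {a..b} k"
  proof (rule integral_norm_bound_integral[OF _ ki'])
    show "(\<lambda>s. if s = t then 0 else V (t - s) (g s)) integrable_on {a..b}"
      by (rule integrable_spike[OF V_integrable[OF g ab(1,3)], of "{t}"]) auto
    fix s assume s: "s \<in> {a..b}"
    show "norm (if s = t then 0 else V (t - s) (g s)) \<le> k s"
    proof (cases "s = t")
      case False
      then have st: "0 < t - s" using s ab by auto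
      have "norm (V (t - s) (g s)) \<le> C * (t - s) powr (- \<alpha>) * norm (g s)" by (rule norm_V_le[OF st])
      also have "\<dots> \<le> C * (t - s) powr (- \<alpha>) * B" using C B[OF s] by (intro mult_left_mono) auto
      finally show ?thesis using False by (simp add: k_def mult_ac)
    qed (use C B0 in \<open>simp add: k_def\<close>)
  qed
  also have "integral {a..b} (\<lambda>s. if s = t then 0 else V (t - s) (g s)) = integral {a..b} (\<lambda>s. V (t - s) (g s))"
    by (rule integral_spike[of "{t}"]) auto
  also have "integral {a..b} k \<le> integral {a..t} k"
    by (rule integral_subset_le[OF _ ki' ki]) (use ab C B0 in \<open>auto simp: k_def\<close>)
  also have "\<dots> = C * B * ((t - a) powr (1 - \<alpha>) / (1 - \<alpha>))"
    unfolding k_def using hi by (simp add: integral_unique)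
  finally show ?thesis .
qed

end

section \<open>The flow on a compact invariant set\<close>

locale mild_flow = smoothing_pair U V \<alpha> C M
  for U :: "real \<Rightarrow> 'b::banach \<Rightarrow> 'b" and V :: "real \<Rightarrow> 'a::banach \<Rightarrow> 'b" and \<alpha> C M +
  fixes f :: "'b \<Rightarrow> 'a" and f' :: "'b \<Rightarrow> 'b \<Rightarrow>\<^sub>L 'a" and S :: "real \<Rightarrow> 'b \<Rightarrow> 'b" and K :: "'b set"
    and L :: real
  assumes derivative_f: "(f has_derivative blinfun_apply (f' v)) (at v)"
    and continuous_f': "continuous_on UNIV f'"
    and continuous_on_S: "continuous_on {0..} (\<lambda>t. S t v)"
    and S_eq: "0 \<le> t \<Longrightarrow> S t v = U t v + integral {0..t} (\<lambda>s. V (t - s) (f (S s v)))"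
    and compact_K: "compact K" and S_K: "0 \<le> t \<Longrightarrow> S t ` K = K"
    and lipschitz_f: "L-lipschitz_on K f"
begin

lemma L_nonneg: "0 \<le> L"
  using lipschitz_f lipschitz_on_nonneg by blast

lemma continuous_on_f_S: "continuous_on {0..t} (\<lambda>s. f (S s v))"
proof -
  have "continuous_on UNIV f"
    using derivative_f by (meson continuous_at_imp_continuous_on has_derivative_continuous)
  then show ?thesis
    by (rule continuous_on_compose2) (auto intro: continuous_on_subset[OF continuous_on_S])
qed

lemma S_diff:
  assumes t: "0 \<le> t"
  shows "S t y - S t x = U t (y - x) + integral {0..t} (\<lambda>s. V (t - s) (f (S s y) - f (S s x)))"
proof -
  have int: "(\<lambda>s. V (t - s) (f (S s v))) integrable_on {0..t}" for v
    by (rule V_integrable[OF continuous_on_f_S]) auto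
  have "integral {0..t} (\<lambda>s. V (t - s) (f (S s y) - f (S s x)))
     = integral {0..t} (\<lambda>s. V (t - s) (f (S s y)) - V (t - s) (f (S s x)))"
  proof (rule integral_spike[of "{t}"])
    show "V (t - s) (f (S s y)) - V (t - s) (f (S s x)) = V (t - s) (f (S s y) - f (S s x))" if "s \<in> {0..t} - {t}" for s
      using that by (simp add: linear_diff[OF linear_V])
  qed simp
  also have "\<dots> = integral {0..t} (\<lambda>s. V (t - s) (f (S s y))) - integral {0..t} (\<lambda>s. V (t - s) (f (S s x)))"
    by (rule Henstock_Kurzweil_Integration.integral_diff[OF int int])
  finally show ?thesis
    using S_eq[OF t] linear_diff[OF bounded_linear.linear[OF linear_U[OF t]]] by simp
qed

lemma S_in_K: "0 \<le> t \<Longrightarrow> x \<in> K \<Longrightarrow> S t x \<in> K"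
  using S_K by blast

lemma norm_f_diff_le:
  assumes "x \<in> K" "y \<in> K" shows "norm (f y - f x) \<le> L * norm (y - x)"
  using lipschitz_onD[OF lipschitz_f assms(2,1)] by (simp add: dist_norm)

text \<open>A singular Gronwall inequality: on time steps of length \<open>h\<close> the integral over the current
  step is absorbed into the left hand side.\<close>

lemma S_lipschitz:
  obtains \<Lambda> where "1 \<le> \<Lambda>" "\<And>x y t. x \<in> K \<Longrightarrow> y \<in> K \<Longrightarrow> t \<in> {0..\<tau>} \<Longrightarrow> norm (S t y - S t x) \<le> \<Lambda> * norm (y - x)"
proof -
  have p: "0 < 1 - \<alpha>" using \<alpha> by simp
  obtain h where h: "0 < h" "h < 1" "(C * L / (1 - \<alpha>)) * h powr (1 - \<alpha>) \<le> 1 / 2"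
    using exists_small_powr[of "C * L / (1 - \<alpha>)" "1 - \<alpha>" "1 / 2" 1] p C L_nonneg by auto
  have step: "\<exists>\<Lambda>. \<forall>x\<in>K. \<forall>y\<in>K. \<forall>t\<in>{0..real k * h}. norm (S t y - S t x) \<le> \<Lambda> * norm (y - x)" for k
  proof (induction k)
    case 0
    have "norm (S 0 y - S 0 x) \<le> M * norm (y - x)" for x y
      using S_diff[of 0 y x] norm_U_le[of 0 "y - x"] by simp
    then show ?case by (intro exI[of _ M]) auto
  next
    case (Suc k)
    then obtain \<Lambda> where \<Lambda>: "\<And>x y t. x \<in> K \<Longrightarrow> y \<in> K \<Longrightarrow> t \<in> {0..real k * h} \<Longrightarrow> norm (S t y - S t x) \<le> \<Lambda> * norm (y - x)" by blast
    define a where "a = real k * h"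
    define b where "b = real (Suc k) * h"
    have ab: "0 \<le> a" "a \<le> b" "b - a = h" using h by (auto simp: a_def b_def algebra_simps)
    define \<Lambda>0 where "\<Lambda>0 = \<bar>\<Lambda>\<bar>"
    define \<Lambda>' where "\<Lambda>' = 2 * (M + C * L * \<Lambda>0 * (b powr (1 - \<alpha>) / (1 - \<alpha>)))"
    have \<Lambda>0: "norm (S t y - S t x) \<le> \<Lambda>0 * norm (y - x)" if "x \<in> K" "y \<in> K" "t \<in> {0..a}" for x y t
      using \<Lambda>[of x y t] that mult_right_mono[OF abs_ge_self[of \<Lambda>] norm_ge_zero[of "y - x"]]
      by (simp add: a_def \<Lambda>0_def)
    have "norm (S t y - S t x) \<le> \<Lambda>' * norm (y - x)" if x: "x \<in> K" and y: "y \<in> K" and t: "t \<in> {a..b}" for x y t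
    proof -
      have "continuous_on {a..b} (\<lambda>t. norm (S t y - S t x))"
        using ab by (intro continuous_intros continuous_on_subset[OF continuous_on_S]) auto
      \<comment> \<open>A time at which the difference is largest on the current step: on
        \<open>{a..u}\<close> the integrand is then controlled by \<open>m\<close> itself, and the
        choice of \<open>h\<close> leaves at most \<open>m / 2\<close> to absorb.\<close>
      then obtain u where u: "u \<in> {a..b}" "\<And>s. s \<in> {a..b} \<Longrightarrow> norm (S s y - S s x) \<le> norm (S u y - S u x)"
        using continuous_attains_sup[of "{a..b}" "\<lambda>t. norm (S t y - S t x)"] ab by auto
      define m where "m = norm (S u y - S u x)"
      define g where "g s = f (S s y) - f (S s x)" for s
      have u0: "0 \<le> u" "a \<le> u" "u \<le> b" using u ab by auto
      have g: "continuous_on {0..u} g" unfolding g_def by (intro continuous_intros continuous_on_f_S)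
      have gb: "norm (g s) \<le> L * norm (S s y - S s x)" if "0 \<le> s" for s
        unfolding g_def by (rule norm_f_diff_le[OF S_in_K[OF that x] S_in_K[OF that y]])
      have i1: "norm (integral {0..a} (\<lambda>s. V (u - s) (g s))) \<le> C * (L * (\<Lambda>0 * norm (y - x))) * ((u - 0) powr (1 - \<alpha>) / (1 - \<alpha>))"
      proof (rule norm_V_integral_le[OF g])
        fix s assume s: "s \<in> {0..a}"
        have "norm (g s) \<le> L * norm (S s y - S s x)" using s by (intro gb) auto
        also have "\<dots> \<le> L * (\<Lambda>0 * norm (y - x))" using L_nonneg \<Lambda>0[OF x y s] by (intro mult_left_mono)
        finally show "norm (g s) \<le> L * (\<Lambda>0 * norm (y - x))" .
      qed (use u0 ab in auto)
      have i2: "norm (integral {a..u} (\<lambda>s. V (u - s) (g s))) \<le> C * (L * m) * ((u - a) powr (1 - \<alpha>) / (1 - \<alpha>))"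
      proof (rule norm_V_integral_le[OF g])
        fix s assume s: "s \<in> {a..u}"
        have "norm (g s) \<le> L * norm (S s y - S s x)" using s ab by (intro gb) auto
        also have "\<dots> \<le> L * m" unfolding m_def using L_nonneg s u0 by (intro mult_left_mono u(2)) auto
        finally show "norm (g s) \<le> L * m" .
      qed (use u0 ab in auto)
      have split: "integral {0..u} (\<lambda>s. V (u - s) (g s)) = integral {0..a} (\<lambda>s. V (u - s) (g s)) + integral {a..u} (\<lambda>s. V (u - s) (g s))"
        using Henstock_Kurzweil_Integration.integral_combine[OF ab(1) u0(2) V_integrable[OF g]] by simp
      have absorb: "m \<le> 2 * (p + q)" if "m \<le> p + (q + m / 2)" for p q using that by simp
      have "m = norm (U u (y - x) + integral {0..u} (\<lambda>s. V (u - s) (g s)))"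
        unfolding m_def S_diff[OF u0(1)] g_def ..
      also have "\<dots> \<le> norm (U u (y - x)) + (norm (integral {0..a} (\<lambda>s. V (u - s) (g s))) + norm (integral {a..u} (\<lambda>s. V (u - s) (g s))))"
        unfolding split by (intro order_trans[OF norm_triangle_ineq] add_left_mono norm_triangle_ineq)
      also have "\<dots> \<le> M * norm (y - x) + (C * L * \<Lambda>0 * (b powr (1 - \<alpha>) / (1 - \<alpha>)) * norm (y - x) + m / 2)"
      proof (intro add_mono norm_U_le u0(1))
        have "(u - 0) powr (1 - \<alpha>) / (1 - \<alpha>) \<le> b powr (1 - \<alpha>) / (1 - \<alpha>)"
          using u0 p by (intro divide_right_mono powr_mono2) auto
        then have "C * (L * (\<Lambda>0 * norm (y - x))) * ((u - 0) powr (1 - \<alpha>) / (1 - \<alpha>)) \<le> C * (L * (\<Lambda>0 * norm (y - x))) * (b powr (1 - \<alpha>) / (1 - \<alpha>))"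
          using C L_nonneg by (intro mult_left_mono) (auto simp: \<Lambda>0_def)
        then show "norm (integral {0..a} (\<lambda>s. V (u - s) (g s))) \<le> C * L * \<Lambda>0 * (b powr (1 - \<alpha>) / (1 - \<alpha>)) * norm (y - x)"
          using i1 by (simp add: mult_ac)
        have "(u - a) powr (1 - \<alpha>) \<le> h powr (1 - \<alpha>)"
          using u0 p ab by (intro powr_mono2) auto
        then have "(C * L / (1 - \<alpha>)) * (u - a) powr (1 - \<alpha>) \<le> (C * L / (1 - \<alpha>)) * h powr (1 - \<alpha>)"
          using C L_nonneg p by (intro mult_left_mono) auto
        also have "\<dots> \<le> 1 / 2" by (rule h(3))
        finally have "m * ((C * L / (1 - \<alpha>)) * (u - a) powr (1 - \<alpha>)) \<le> m * (1 / 2)"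
          by (intro mult_left_mono) (auto simp: m_def)
        moreover have "C * (L * m) * ((u - a) powr (1 - \<alpha>) / (1 - \<alpha>)) = m * ((C * L / (1 - \<alpha>)) * (u - a) powr (1 - \<alpha>))"
          by simp
        ultimately show "norm (integral {a..u} (\<lambda>s. V (u - s) (g s))) \<le> m / 2"
          using i2 by linarith
      qed
      finally have "m \<le> 2 * (M * norm (y - x) + C * L * \<Lambda>0 * (b powr (1 - \<alpha>) / (1 - \<alpha>)) * norm (y - x))"
        by (rule absorb)
      also have "\<dots> = \<Lambda>' * norm (y - x)" by (simp add: \<Lambda>'_def distrib_right)
      finally have "m \<le> \<Lambda>' * norm (y - x)" .
      then show ?thesis using u(2)[OF t] by (simp add: m_def)
    qed
    note new = this
    have "norm (S t y - S t x) \<le> max \<Lambda>0 \<Lambda>' * norm (y - x)" if "x \<in> K" "y \<in> K" "t \<in> {0..b}" for x y t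
    proof (cases "t \<le> a")
      case True
      have "norm (S t y - S t x) \<le> \<Lambda>0 * norm (y - x)" using \<Lambda>0[of x y t] that True by simp
      also have "\<dots> \<le> max \<Lambda>0 \<Lambda>' * norm (y - x)" by (intro mult_right_mono) auto
      finally show ?thesis .
    next
      case False
      have "norm (S t y - S t x) \<le> \<Lambda>' * norm (y - x)" using new[of x y t] that False by simp
      also have "\<dots> \<le> max \<Lambda>0 \<Lambda>' * norm (y - x)" by (intro mult_right_mono) auto
      finally show ?thesis .
    qed
    then show ?case unfolding b_def by blast
  qed
  obtain k :: nat where k: "\<tau> / h \<le> real k" using real_arch_simple by blast
  then have "\<tau> \<le> real k * h" using h by (simp add: pos_divide_le_eq)
  moreover obtain \<Lambda> where "\<And>x y t. x \<in> K \<Longrightarrow> y \<in> K \<Longrightarrow> t \<in> {0..real k * h} \<Longrightarrow> norm (S t y - S t x) \<le> \<Lambda> * norm (y - x)"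
    using step[of k] by blast
  ultimately have "norm (S t y - S t x) \<le> max 1 \<Lambda> * norm (y - x)" if "x \<in> K" "y \<in> K" "t \<in> {0..\<tau>}" for x y t
  proof -
    assume *: "\<tau> \<le> real k * h" "\<And>x y t. x \<in> K \<Longrightarrow> y \<in> K \<Longrightarrow> t \<in> {0..real k * h} \<Longrightarrow> norm (S t y - S t x) \<le> \<Lambda> * norm (y - x)"
    have "norm (S t y - S t x) \<le> \<Lambda> * norm (y - x)" using *(1) that by (intro *(2)) auto
    also have "\<dots> \<le> max 1 \<Lambda> * norm (y - x)" by (intro mult_right_mono) auto
    finally show ?thesis .
  qed
  then show thesis using that[of "max 1 \<Lambda>"] by auto
qed

lemma continuous_on_f_diff: "continuous_on {0..t} (\<lambda>s. f (S s y) - f (S s x))"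
  by (intro continuous_intros continuous_on_f_S)

text \<open>The conclusion gives a finite set, independent of \<open>x\<close> and of the scale \<open>r\<close>, of approximate
  values of the difference quotients of \<open>S \<tau>\<close> on \<open>K\<close>. This is where compactness enters: first
  through the semigroup, then through the derivative of \<open>f\<close>.\<close>

lemma finite_net_of_compact_semigroup:
  assumes co: "\<And>t. 0 < t \<Longrightarrow> compact_operator (U t)"
  obtains F where "finite F" "\<And>x y r. x \<in> K \<Longrightarrow> y \<in> K \<Longrightarrow> 0 < r \<Longrightarrow> norm (y - x) \<le> r \<Longrightarrow>
    \<exists>q\<in>F. norm (S 1 y - S 1 x - r *\<^sub>R q) \<le> r / 8"
proof -
  have p: "0 < 1 - \<alpha>" using \<alpha> by simp
  obtain \<Lambda> where \<Lambda>: "1 \<le> \<Lambda>" "\<And>x y t. x \<in> K \<Longrightarrow> y \<in> K \<Longrightarrow> t \<in> {0..1} \<Longrightarrow> norm (S t y - S t x) \<le> \<Lambda> * norm (y - x)"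
    using S_lipschitz[of 1] by blast
  have c0: "0 \<le> C * L * \<Lambda> / (1 - \<alpha>)" using C L_nonneg \<Lambda>(1) p by simp
  \<comment> \<open>The last time interval of length \<open>h\<close> contributes at most
    \<open>r / 24\<close>. With \<open>r / 24\<close> for each of the two net approximations the
    total is \<open>r / 8\<close>.\<close>
  obtain h where h: "0 < h" "h < 1" "(C * L * \<Lambda> / (1 - \<alpha>)) * h powr (1 - \<alpha>) \<le> 1 / 24"
    using exists_small_powr[OF c0 p, of "1 / 24" 1] by auto
  define B where "B = C * L * \<Lambda> * ((1 - h) powr (1 - \<alpha>) / (1 - \<alpha>))"
  have "has_finite_nets (U 1 ` cball 0 1)" "has_finite_nets (U h ` cball 0 B)"
    using h by (auto intro!: compact_operator_has_finite_nets co)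
  then obtain F1 F2 where F1: "finite F1" "\<forall>x\<in>U 1 ` cball 0 1. \<exists>y\<in>F1. dist x y < 1 / 24"
    and F2: "finite F2" "\<forall>x\<in>U h ` cball 0 B. \<exists>y\<in>F2. dist x y < 1 / 24"
    using has_finite_netsD[of _ "1 / 24"] by (metis zero_less_divide_1_iff zero_less_numeral)
  define F where "F = (\<lambda>(a, b). a + b) ` (F1 \<times> F2)"
  show thesis
  proof (rule that)
    show "finite F" using F1 F2 by (simp add: F_def)
    fix x y r assume x: "x \<in> K" and y: "y \<in> K" and r: "0 < r" "norm (y - x) \<le> r"
    define g where "g s = f (S s y) - f (S s x)" for s
    have g: "continuous_on {0..t} g" for t unfolding g_def by (rule continuous_on_f_diff)
    have gb: "norm (g s) \<le> L * \<Lambda> * r" if "s \<in> {0..1}" for s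
    proof -
      have "norm (g s) \<le> L * norm (S s y - S s x)"
        unfolding g_def by (rule norm_f_diff_le) (use that x y in \<open>auto intro: S_in_K\<close>)
      also have "\<dots> \<le> L * (\<Lambda> * norm (y - x))" by (intro mult_left_mono \<Lambda>(2) x y that L_nonneg)
      also have "\<dots> \<le> L * (\<Lambda> * r)" using L_nonneg \<Lambda>(1) r by (intro mult_left_mono) auto
      finally show ?thesis by simp
    qed
    define Y where "Y = integral {0..1 - h} (\<lambda>s. V (1 - h - s) (g s))"
    define Z where "Z = integral {1 - h..1} (\<lambda>s. V (1 - s) (g s))"
    \<comment> \<open>Away from the final time \<open>V (1 - s) = U h (V (1 - h - s))\<close>: the
      integral is the image under the compact \<open>U h\<close> of a vector bounded by
      \<open>B * r\<close>.\<close>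
    have UY: "integral {0..1 - h} (\<lambda>s. V (1 - s) (g s)) = U h Y"
    proof -
      have "U h Y = integral {0..1 - h} (\<lambda>s. U h (V (1 - h - s) (g s)))"
        unfolding Y_def using integral_linear[OF V_integrable[OF g] linear_U, of 0 "1 - h" "1 - h" h] h by (simp add: o_def)
      also have "\<dots> = integral {0..1 - h} (\<lambda>s. V (1 - s) (g s))"
        by (rule integral_spike[of "{1 - h}"]) (use h in \<open>auto simp: U_V\<close>)
      finally show ?thesis ..
    qed
    have eq: "S 1 y - S 1 x = U 1 (y - x) + U h Y + Z"
      unfolding S_diff[OF zero_le_one] g_def[symmetric] Z_def UY[symmetric]
      using Henstock_Kurzweil_Integration.integral_combine[of 0 "1 - h" 1, OF _ _ V_integrable[OF g]] h by (simp add: algebra_simps)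
    have "norm Y \<le> C * (L * \<Lambda> * r) * ((1 - h - 0) powr (1 - \<alpha>) / (1 - \<alpha>))"
      unfolding Y_def using h by (intro norm_V_integral_le[OF g] gb) auto
    then have Y: "norm ((1 / r) *\<^sub>R Y) \<le> B" using r by (simp add: B_def divide_le_eq mult_ac)
    have "norm Z \<le> C * (L * \<Lambda> * r) * ((1 - (1 - h)) powr (1 - \<alpha>) / (1 - \<alpha>))"
      unfolding Z_def using h by (intro norm_V_integral_le[OF g] gb) auto
    also have "\<dots> = ((C * L * \<Lambda> / (1 - \<alpha>)) * h powr (1 - \<alpha>)) * r" by simp
    also have "\<dots> \<le> 1 / 24 * r" using h r by (intro mult_right_mono) auto
    finally have Z: "norm Z \<le> r / 24" by simp
    have lin: "U t v = r *\<^sub>R U t ((1 / r) *\<^sub>R v)" if "0 \<le> t" for t v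
      using linear_cmul[OF bounded_linear.linear[OF linear_U[OF that]]] r by simp
    have "(1 / r) *\<^sub>R (y - x) \<in> cball 0 1" using r by (simp add: divide_le_eq)
    then obtain a where a: "a \<in> F1" "dist (U 1 ((1 / r) *\<^sub>R (y - x))) a < 1 / 24" using F1(2) by blast
    obtain b where b: "b \<in> F2" "dist (U h ((1 / r) *\<^sub>R Y)) b < 1 / 24" using F2(2) Y by (metis imageI mem_cball_0)
    have scal: "norm (U t v - r *\<^sub>R c) \<le> r / 24" if "dist (U t ((1 / r) *\<^sub>R v)) c < 1 / 24" "0 \<le> t" for t v c
    proof -
      have "U t v - r *\<^sub>R c = r *\<^sub>R (U t ((1 / r) *\<^sub>R v) - c)"
        using lin[OF that(2), of v] by (simp add: scaleR_diff_right)
      then have "norm (U t v - r *\<^sub>R c) = r * dist (U t ((1 / r) *\<^sub>R v)) c"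
        using r by (simp add: dist_norm)
      also have "\<dots> \<le> r * (1 / 24)" using that(1) r by (intro mult_left_mono) auto
      finally show ?thesis by simp
    qed
    have "S 1 y - S 1 x - r *\<^sub>R (a + b) = (U 1 (y - x) - r *\<^sub>R a) + (U h Y - r *\<^sub>R b) + Z"
      by (simp add: eq algebra_simps)
    then have "norm (S 1 y - S 1 x - r *\<^sub>R (a + b)) \<le> r / 24 + r / 24 + r / 24"
      using scal[OF a(2)] scal[OF b(2)] Z h
      by (metis (no_types, opaque_lifting) add_mono less_imp_le norm_triangle_mono zero_le_one)
    moreover have "a + b \<in> F" using a(1) b(1) by (force simp: F_def)
    ultimately show "\<exists>q\<in>F. norm (S 1 y - S 1 x - r *\<^sub>R q) \<le> r / 8" by (intro bexI[of _ "a + b"]) auto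
  qed
qed

lemma finite_net_of_compact_derivative:
  assumes co: "\<And>x. x \<in> K \<Longrightarrow> compact_operator (f' x)"
    and \<tau>: "0 < \<tau>" and contr: "\<And>v. norm (U \<tau> v) \<le> norm v / 32"
  obtains F \<rho> where "finite F" "0 < \<rho>" "\<And>x y r. x \<in> K \<Longrightarrow> y \<in> K \<Longrightarrow> 0 < r \<Longrightarrow> r \<le> \<rho> \<Longrightarrow> norm (y - x) \<le> r \<Longrightarrow>
    \<exists>q\<in>F. norm (S \<tau> y - S \<tau> x - r *\<^sub>R q) \<le> r / 8"
proof -
  have p: "0 < 1 - \<alpha>" using \<alpha> by simp
  obtain \<Lambda> where \<Lambda>: "1 \<le> \<Lambda>" "\<And>x y t. x \<in> K \<Longrightarrow> y \<in> K \<Longrightarrow> t \<in> {0..\<tau>} \<Longrightarrow> norm (S t y - S t x) \<le> \<Lambda> * norm (y - x)"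
    using S_lipschitz[of \<tau>] by blast
  have c0: "0 \<le> C * L * \<Lambda> / (1 - \<alpha>)" using C L_nonneg \<Lambda>(1) p by simp
  obtain h where h: "0 < h" "h < \<tau>" "(C * L * \<Lambda> / (1 - \<alpha>)) * h powr (1 - \<alpha>) \<le> 1 / 32"
    using exists_small_powr[OF c0 p, of "1 / 32" \<tau>] \<tau> by auto
  \<comment> \<open>A uniform bound for \<open>V\<close> at times at least \<open>h\<close>, away
    from its singularity.\<close>
  define C1 where "C1 = C * h powr (- \<alpha>)"
  have C1: "0 \<le> C1" "\<And>t z. h \<le> t \<Longrightarrow> norm (V t z) \<le> C1 * norm z"
  proof -
    show "0 \<le> C1" using C by (simp add: C1_def)
    fix t z assume t: "h \<le> t"
    have "norm (V t z) \<le> C * t powr (- \<alpha>) * norm z" using t h by (intro norm_V_le) auto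
    also have "\<dots> \<le> C1 * norm z"
      unfolding C1_def using t h C \<alpha> by (intro mult_right_mono mult_left_mono powr_mono2') auto
    finally show "norm (V t z) \<le> C1 * norm z" .
  qed
  \<comment> \<open>\<open>\<delta>\<close> measures the error in the difference quotients of
    \<open>f\<close>, \<open>\<delta>1\<close> the error in the values of \<open>V\<close>. They are
    chosen so that the integral over a time less than \<open>\<tau>\<close> accumulates at most
    \<open>1 / 32\<close>, as stated in \<open>small\<close>.\<close>
  define \<delta> where "\<delta> = 1 / (128 * (C1 + 1) * (\<tau> + 1))"
  define \<delta>1 where "\<delta>1 = 1 / (64 * (\<tau> + 1))"
  have \<delta>: "0 < \<delta>" "0 < \<delta>1" using C1 \<tau> by (auto simp: \<delta>_def \<delta>1_def intro!: mult_pos_pos)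
  have small: "(\<tau> - h) * (C1 * (2 * \<delta>) + \<delta>1) \<le> 1 / 32"
  proof -
    have "C1 * (2 * \<delta>) \<le> (C1 + 1) * (2 * \<delta>)" using \<delta> by (intro mult_right_mono) auto
    also have "\<dots> = \<delta>1"
    proof -
      have "c * (2 * (1 / (128 * c * (\<tau> + 1)))) = 1 / (64 * (\<tau> + 1))" if "c > 0" for c
        using that \<tau> by (simp add: divide_simps)
      from this[of "C1 + 1"] show ?thesis using C1(1) unfolding \<delta>_def \<delta>1_def by linarith
    qed
    finally have "(\<tau> - h) * (C1 * (2 * \<delta>) + \<delta>1) \<le> (\<tau> + 1) * (\<delta>1 + \<delta>1)"
      using h \<delta> C1 by (intro mult_mono add_mono) auto
    also have "\<dots> = 1 / 32" using \<tau> by (simp add: \<delta>1_def field_simps)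
    finally show ?thesis .
  qed
  have "has_finite_nets (\<Union>x\<in>K. f' x ` cball 0 \<Lambda>)"
    by (intro compact_family_has_finite_nets compact_K continuous_on_subset[OF continuous_f'] co) auto
  from has_finite_netsD[OF this \<delta>(1)] obtain F0 where F0: "finite F0"
    "\<forall>z\<in>(\<Union>x\<in>K. f' x ` cball 0 \<Lambda>). \<exists>q\<in>F0. dist z q < \<delta>" by blast
  \<comment> \<open>Difference quotients of \<open>f\<close> are near the finite set
    \<open>F0\<close>, so up to small errors the integrand takes values on finitely many continuous
    arcs, which form a compact set.\<close>
  define Q where "Q = (\<Union>q\<in>F0. (\<lambda>s. V (\<tau> - s) q) ` {0..\<tau> - h})"
  have "compact Q" unfolding Q_def
  proof (intro compact_UN F0(1) compact_continuous_image)
    show "continuous_on {0..\<tau> - h} (\<lambda>s. V (\<tau> - s) q)" for q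
      by (rule continuous_on_compose2[OF continuous_on_V]) (use h in \<open>auto intro!: continuous_intros\<close>)
  qed simp
  from has_finite_netsD[OF compact_has_finite_nets[OF this] \<delta>(2)]
  obtain F1 where F1: "finite F1" "\<forall>z\<in>Q. \<exists>w\<in>F1. dist z w < \<delta>1" by blast
  have "compact ((\<lambda>w. (\<tau> - h) *\<^sub>R w) ` (convex hull F1))"
    by (intro compact_continuous_image continuous_intros finite_imp_compact_convex_hull F1)
  from has_finite_netsD[OF compact_has_finite_nets[OF this], of "1 / 64"]
  obtain F where F: "finite F" "\<forall>z\<in>(\<lambda>w. (\<tau> - h) *\<^sub>R w) ` (convex hull F1). \<exists>q\<in>F. dist z q < 1 / 64" by auto
  \<comment> \<open>Dividing by \<open>\<Lambda>\<close> compensates the growth of differences by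
    the factor \<open>\<Lambda>\<close> up to time \<open>\<tau>\<close>: the linearization error
    becomes \<open>\<delta> * r\<close>.\<close>
  obtain \<rho>0 where \<rho>0: "0 < \<rho>0" "\<And>x y. x \<in> K \<Longrightarrow> norm (y - x) \<le> \<rho>0 \<Longrightarrow> norm (f y - f x - f' x (y - x)) \<le> \<delta> / \<Lambda> * norm (y - x)"
    using uniform_linearization_on_compact[OF compact_K derivative_f continuous_f', of "\<delta> / \<Lambda>"] \<delta> \<Lambda>(1) by (smt (verit) divide_pos_pos)
  show thesis
  proof (rule that)
    show "finite F" by (rule F(1))
    \<comment> \<open>At this scale the two trajectories stay within \<open>\<rho>0\<close> of each
      other up to time \<open>\<tau>\<close>.\<close>
    show "0 < \<rho>0 / \<Lambda>" using \<rho>0 \<Lambda> by simp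
    fix x y r assume x: "x \<in> K" and y: "y \<in> K" and r: "0 < r" "r \<le> \<rho>0 / \<Lambda>" "norm (y - x) \<le> r"
    define g where "g s = f (S s y) - f (S s x)" for s
    have g: "continuous_on {0..t} g" for t unfolding g_def by (rule continuous_on_f_diff)
    have Sb: "norm (S s y - S s x) \<le> \<Lambda> * r" if "s \<in> {0..\<tau>}" for s
    proof -
      have "norm (S s y - S s x) \<le> \<Lambda> * norm (y - x)" by (rule \<Lambda>(2)[OF x y that])
      also have "\<dots> \<le> \<Lambda> * r" using r \<Lambda>(1) by (intro mult_left_mono) auto
      finally show ?thesis .
    qed
    have gb: "norm (g s) \<le> L * \<Lambda> * r" if s: "s \<in> {0..\<tau>}" for s
    proof -
      have "norm (g s) \<le> L * norm (S s y - S s x)"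
        unfolding g_def by (rule norm_f_diff_le) (use s x y in \<open>auto intro: S_in_K\<close>)
      also have "\<dots> \<le> L * (\<Lambda> * r)" by (intro mult_left_mono Sb s L_nonneg)
      finally show ?thesis by simp
    qed
    have gq: "\<exists>q\<in>F0. norm ((1 / r) *\<^sub>R g s - q) \<le> 2 * \<delta>" if s: "s \<in> {0..\<tau>}" for s
    proof -
      define w where "w = S s y - S s x"
      have sx: "S s x \<in> K" using s x by (auto intro: S_in_K)
      have w: "norm w \<le> \<Lambda> * r" unfolding w_def by (rule Sb[OF s])
      have "\<Lambda> * r \<le> \<rho>0" using r(2) \<Lambda>(1) by (simp add: pos_le_divide_eq mult.commute)
      then have "norm (g s - f' (S s x) w) \<le> \<delta> / \<Lambda> * norm w"
        using \<rho>0(2)[OF sx, of "S s y"] w by (simp add: g_def w_def)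
      also have "\<dots> \<le> \<delta> / \<Lambda> * (\<Lambda> * r)" using w \<delta> \<Lambda>(1) by (intro mult_left_mono) auto
      also have "\<dots> = \<delta> * r" using \<Lambda>(1) by simp
      finally have e: "norm (g s - f' (S s x) w) \<le> \<delta> * r" .
      have "norm ((1 / r) *\<^sub>R w) \<le> \<Lambda>" using w r(1) by (simp add: divide_le_eq)
      then have "f' (S s x) ((1 / r) *\<^sub>R w) \<in> (\<Union>x\<in>K. f' x ` cball 0 \<Lambda>)" using sx by force
      then obtain q where q: "q \<in> F0" "dist (f' (S s x) ((1 / r) *\<^sub>R w)) q < \<delta>" using F0(2) by blast
      have "norm ((1 / r) *\<^sub>R g s - f' (S s x) ((1 / r) *\<^sub>R w)) = (1 / r) * norm (g s - f' (S s x) w)"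
        using r(1) by (simp add: blinfun.scaleR_right flip: scaleR_diff_right)
      also have "\<dots> \<le> (1 / r) * (\<delta> * r)" using e r(1) by (intro mult_left_mono) auto
      finally have "norm ((1 / r) *\<^sub>R g s - f' (S s x) ((1 / r) *\<^sub>R w)) \<le> \<delta>" using r(1) by simp
      then have "norm ((1 / r) *\<^sub>R g s - q) \<le> 2 * \<delta>"
        using q(2) norm_triangle_ineq[of "(1 / r) *\<^sub>R g s - f' (S s x) ((1 / r) *\<^sub>R w)" "f' (S s x) ((1 / r) *\<^sub>R w) - q"]
        by (simp add: dist_norm)
      then show ?thesis using q(1) by blast
    qed
    define k where "k s = V (\<tau> - s) ((1 / r) *\<^sub>R g s)" for s
    have ki: "k integrable_on {0..\<tau> - h}"
      unfolding k_def using h by (intro V_integrable continuous_intros g) auto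
    have near: "\<exists>w\<in>F1. norm (k s - w) \<le> C1 * (2 * \<delta>) + \<delta>1" if s: "s \<in> {0..\<tau> - h}" for s
    proof -
      obtain q where q: "q \<in> F0" "norm ((1 / r) *\<^sub>R g s - q) \<le> 2 * \<delta>" using gq[of s] s h by auto
      have "V (\<tau> - s) q \<in> Q" using q(1) s unfolding Q_def by blast
      then obtain w where w: "w \<in> F1" "dist (V (\<tau> - s) q) w < \<delta>1" using F1(2) by blast
      have hs: "h \<le> \<tau> - s" using s by simp
      have "norm (k s - V (\<tau> - s) q) = norm (V (\<tau> - s) ((1 / r) *\<^sub>R g s - q))"
        unfolding k_def using hs h by (subst linear_diff[OF linear_V]) auto
      also have "\<dots> \<le> C1 * norm ((1 / r) *\<^sub>R g s - q)" by (rule C1(2)[OF hs])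
      also have "\<dots> \<le> C1 * (2 * \<delta>)" using C1(1) q(2) by (intro mult_left_mono)
      finally have "norm (k s - w) \<le> C1 * (2 * \<delta>) + \<delta>1"
        using w(2) norm_triangle_ineq[of "k s - V (\<tau> - s) q" "V (\<tau> - s) q - w"] by (simp add: dist_norm)
      then show ?thesis using w(1) by blast
    qed
    obtain w where w: "w \<in> convex hull F1"
      "norm (integral {0..\<tau> - h} k - (\<tau> - h - 0) *\<^sub>R w) \<le> (\<tau> - h - 0) * (C1 * (2 * \<delta>) + \<delta>1) + 1 / 128"
      using integral_near_convex_hull[OF ki _ near, of "1 / 128"] h by auto
    obtain q where q: "q \<in> F" "dist ((\<tau> - h) *\<^sub>R w) q < 1 / 64" using F(2) w(1) by blast
    \<comment> \<open>The errors are \<open>1 / 32\<close> from \<open>small\<close>,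
      \<open>1 / 128\<close> from the Riemann sum and \<open>1 / 64\<close> from the net, together
      less than \<open>1 / 16\<close>.\<close>
    have kq: "norm (integral {0..\<tau> - h} k - q) \<le> 1 / 16"
      using w(2) small q(2) norm_triangle_ineq[of "integral {0..\<tau> - h} k - (\<tau> - h) *\<^sub>R w" "(\<tau> - h) *\<^sub>R w - q"]
      by (simp add: dist_norm)
    have rk: "integral {0..\<tau> - h} (\<lambda>s. V (\<tau> - s) (g s)) = r *\<^sub>R integral {0..\<tau> - h} k"
    proof -
      have "integral {0..\<tau> - h} (\<lambda>s. V (\<tau> - s) (g s)) = integral {0..\<tau> - h} (\<lambda>s. r *\<^sub>R k s)"
      proof (rule Henstock_Kurzweil_Integration.integral_cong)
        fix s assume "s \<in> {0..\<tau> - h}"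
        then have "0 < \<tau> - s" using h by auto
        then show "V (\<tau> - s) (g s) = r *\<^sub>R k s"
          using r(1) linear_cmul[OF linear_V] by (simp add: k_def)
      qed
      then show ?thesis by (simp only: integral_cmul)
    qed
    define Z where "Z = integral {\<tau> - h..\<tau>} (\<lambda>s. V (\<tau> - s) (g s))"
    have eq: "S \<tau> y - S \<tau> x = U \<tau> (y - x) + r *\<^sub>R integral {0..\<tau> - h} k + Z"
      unfolding S_diff[OF less_imp_le[OF \<tau>]] g_def[symmetric] Z_def rk[symmetric]
      using Henstock_Kurzweil_Integration.integral_combine[of 0 "\<tau> - h" \<tau>, OF _ _ V_integrable[OF g]] h by (simp add: algebra_simps)
    have "norm Z \<le> C * (L * \<Lambda> * r) * ((\<tau> - (\<tau> - h)) powr (1 - \<alpha>) / (1 - \<alpha>))"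
      unfolding Z_def using h by (intro norm_V_integral_le[OF g] gb) auto
    also have "\<dots> = ((C * L * \<Lambda> / (1 - \<alpha>)) * h powr (1 - \<alpha>)) * r" by simp
    also have "\<dots> \<le> 1 / 32 * r" using h r by (intro mult_right_mono) auto
    finally have Z: "norm Z \<le> r / 32" by simp
    have Uc: "norm (U \<tau> (y - x)) \<le> r / 32" using contr[of "y - x"] r(3) by simp
    have kr: "norm (r *\<^sub>R (integral {0..\<tau> - h} k - q)) \<le> r / 16"
      using mult_left_mono[OF kq, of r] r(1) by simp
    have "S \<tau> y - S \<tau> x - r *\<^sub>R q = U \<tau> (y - x) + r *\<^sub>R (integral {0..\<tau> - h} k - q) + Z"
      by (simp add: eq algebra_simps)
    then have "norm (S \<tau> y - S \<tau> x - r *\<^sub>R q) \<le> r / 32 + r / 16 + r / 32"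
      using Uc kr Z by (metis (no_types, opaque_lifting) norm_triangle_mono)
    then show "\<exists>q\<in>F. norm (S \<tau> y - S \<tau> x - r *\<^sub>R q) \<le> r / 8" using q(1) by (intro bexI[of _ q]) auto
  qed
qed

text \<open>The approximate values \<open>S \<tau> x + r q\<close> need not lie in \<open>K\<close>,
  but the iteration needs centres in \<open>K\<close>. Each nonempty piece \<open>P q\<close>
  therefore contributes one of its own points; two points of a piece are at distance at most
  \<open>r / 4\<close>.\<close>

lemma upper_box_dim_finite_of_net:
  assumes F: "finite F" and \<rho>: "0 < \<rho>" and \<tau>: "0 \<le> \<tau>"
    and net: "\<And>x y r. x \<in> K \<Longrightarrow> y \<in> K \<Longrightarrow> 0 < r \<Longrightarrow> r \<le> \<rho> \<Longrightarrow> norm (y - x) \<le> r \<Longrightarrow>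
      \<exists>q\<in>F. norm (S \<tau> y - S \<tau> x - r *\<^sub>R q) \<le> r / 8"
  shows "upper_box_dim K < \<infinity>"
proof (rule upper_box_dim_finite_of_halving[OF compact_K S_K[OF \<tau>] \<rho>, of "max 1 (card F)"])
  fix x r assume x: "x \<in> K" and r: "0 < r" "r \<le> \<rho>"
  define P where "P q = {z \<in> K. norm (z - S \<tau> x - r *\<^sub>R q) \<le> r / 8}" for q
  define F' where "F' = {q \<in> F. P q \<noteq> {}}"
  define c where "c q = (SOME z. z \<in> P q)" for q
  have c: "c q \<in> P q" if "q \<in> F'" for q
    using that unfolding F'_def c_def by (simp add: some_in_eq)
  show "\<exists>C. finite C \<and> card C \<le> max 1 (card F) \<and> C \<subseteq> K \<and> S \<tau> ` (K \<inter> ball x r) \<subseteq> (\<Union>c\<in>C. ball c (r / 2))"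
  proof (intro exI[of _ "c ` F'"] conjI)
    show "finite (c ` F')" using F by (simp add: F'_def)
    have "card (c ` F') \<le> card F'" using F by (intro card_image_le) (simp add: F'_def)
    also have "\<dots> \<le> card F" using F by (intro card_mono) (auto simp: F'_def)
    finally show "card (c ` F') \<le> max 1 (card F)" by simp
    show "c ` F' \<subseteq> K" using c by (auto simp: P_def)
    show "S \<tau> ` (K \<inter> ball x r) \<subseteq> (\<Union>c\<in>c ` F'. ball c (r / 2))"
    proof
      fix z assume "z \<in> S \<tau> ` (K \<inter> ball x r)"
      then obtain y where y: "y \<in> K" "norm (y - x) \<le> r" "z = S \<tau> y"
        by (auto simp: dist_norm norm_minus_commute)
      obtain q where q: "q \<in> F" "norm (S \<tau> y - S \<tau> x - r *\<^sub>R q) \<le> r / 8" using net[OF x y(1) r y(2)] by blast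
      then have zP: "z \<in> P q" using y S_in_K[OF \<tau>] by (simp add: P_def)
      then have qF: "q \<in> F'" using q(1) by (auto simp: F'_def)
      have "norm (c q - S \<tau> x - r *\<^sub>R q) \<le> r / 8" using c[OF qF] by (simp add: P_def)
      then have "dist (c q) z \<le> r / 8 + r / 8"
        using norm_triangle_ineq4[of "c q - S \<tau> x - r *\<^sub>R q" "z - S \<tau> x - r *\<^sub>R q"] zP by (simp add: P_def dist_norm)
      then have "z \<in> ball (c q) (r / 2)" using r by simp
      then show "z \<in> (\<Union>c\<in>c ` F'. ball c (r / 2))" using qF by blast
    qed
  qed
qed simp

theorem upper_box_dim_finite:
  assumes "(\<forall>t>0. compact_operator (U t)) \<or>
    ((\<forall>x\<in>K. compact_operator (blinfun_apply (f' x))) \<and> (\<exists>\<tau>>0. \<forall>v. norm (U \<tau> v) \<le> norm v / 32))"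
  shows "upper_box_dim K < \<infinity>"
  using assms
proof (elim disjE conjE exE)
  assume "\<forall>t>0. compact_operator (U t)"
  then obtain F where F: "finite F" "\<And>x y r. x \<in> K \<Longrightarrow> y \<in> K \<Longrightarrow> 0 < r \<Longrightarrow> norm (y - x) \<le> r \<Longrightarrow>
    \<exists>q\<in>F. norm (S 1 y - S 1 x - r *\<^sub>R q) \<le> r / 8"
    using finite_net_of_compact_semigroup by metis
  show ?thesis by (rule upper_box_dim_finite_of_net[OF F(1), of 1 1]) (use F(2) in auto)
next
  fix \<tau> assume co: "\<forall>x\<in>K. compact_operator (blinfun_apply (f' x))" and \<tau>: "0 < \<tau>" "\<forall>v. norm (U \<tau> v) \<le> norm v / 32"
  obtain F \<rho> where F: "finite F" "0 < \<rho>" "\<And>x y r. x \<in> K \<Longrightarrow> y \<in> K \<Longrightarrow> 0 < r \<Longrightarrow> r \<le> \<rho> \<Longrightarrow> norm (y - x) \<le> r \<Longrightarrow>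
    \<exists>q\<in>F. norm (S \<tau> y - S \<tau> x - r *\<^sub>R q) \<le> r / 8"
    using finite_net_of_compact_derivative[of \<tau>] co \<tau> by blast
  show ?thesis by (rule upper_box_dim_finite_of_net[OF F(1,2), of \<tau>]) (use F(3) \<tau> in auto)
qed

end

section \<open>The attractor of the parabolic problem\<close>

theorem corollary3p4:
  fixes D :: "'a::banach set" and A :: "'a \<Rightarrow> 'a"
    and T :: "real \<Rightarrow> 'a \<Rightarrow> 'a"
    and \<alpha> :: real and J :: "'b::banach \<Rightarrow> 'a"
    and f :: "'b \<Rightarrow> 'a" and f' :: "'b \<Rightarrow> 'b \<Rightarrow>\<^sub>L 'a"
    and S :: "real \<Rightarrow> 'b \<Rightarrow> 'b" and K :: "'b set"
  assumes "sectorial D A"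
    and "\<forall>l\<in>op_spectrum D A. Re l > 0"
    and "semigroup_generated_by_minus D A T"
    and "0 \<le> \<alpha>" and "\<alpha> < 1"
    and "fractional_power_space T \<alpha> J"
    and "\<forall>x. (f has_derivative blinfun_apply (f' x)) (at x)"
    and "continuous_on UNIV f'"
    and "\<forall>B. bounded B \<longrightarrow> (\<exists>L. L-lipschitz_on B f)"
    and "\<forall>x. mild_solution T J f x (\<lambda>t. S t x)"
    and "global_attractor S K"
    and "(\<forall>t>0. compact_operator (T t)) \<or> (\<forall>x\<in>K. compact_operator (blinfun_apply (f' x)))"
  shows "upper_box_dim K < \<infinity>"
proof -
  obtain C where C: "C \<ge> 0" "\<And>t x. t \<ge> 0 \<Longrightarrow> norm (T t x) \<le> C * norm x / (1 + t)\<^sup>2"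
    "\<And>t x. t > 0 \<Longrightarrow> norm (A (T t x)) \<le> C * norm x / t"
    using semigroup_bounds[OF assms(1-3)] by blast
  interpret decaying_semigroup D A T C
    by unfold_locales (use assms(3) C in auto)
  define N where "N = neg_frac_power T \<alpha>"
  note \<alpha> = assms(4,5)
  have blN: "bounded_linear N" unfolding N_def by (rule bounded_linear_neg_frac_power[OF \<alpha>])
  then have lN: "linear N" by (rule bounded_linear.linear)
  have injN: "inj N" unfolding N_def by (rule inj_neg_frac_power[OF \<alpha>])
  have J: "linear J" "range J = range N" "\<And>v. norm v = norm (inv N (J v))"
    using assms(6) unfolding fractional_power_space_def frac_domain_def frac_power_def N_def by auto
  \<comment> \<open>\<open>P\<close> is \<open>A^\<alpha>\<close> on \<open>X^\<alpha>\<close>, a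
    linear isometry onto \<open>X\<close>; its inverse \<open>Q\<close> below identifies the two
    spaces.\<close>
  define P where "P v = inv N (J v)" for v
  have NP: "N (P v) = J v" for v
    unfolding P_def using J(2) by (intro f_inv_into_f) auto
  have nP: "norm (P v) = norm v" for v using J(3) by (simp add: P_def)
  have lP: "linear P"
  proof
    show "P (x + y) = P x + P y" for x y
      by (rule injD[OF injN]) (simp add: NP linear_add[OF lN] linear_add[OF J(1)])
    show "P (r *\<^sub>R x) = r *\<^sub>R P x" for r x
      by (rule injD[OF injN]) (simp add: NP linear_cmul[OF lN] linear_cmul[OF J(1)])
  qed
  have "surj P"
  proof (rule surjI)
    fix w
    have "N w \<in> range J" using J(2) by blast
    then have "J (inv J (N w)) = N w" by (rule f_inv_into_f)
    then show "P (inv J (N w)) = w" using injD[OF injN, of "P (inv J (N w))" w] by (simp add: NP)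
  qed
  define Q where "Q = inv P"
  have PQ: "P (Q w) = w" for w unfolding Q_def by (rule surj_f_inv_f[OF \<open>surj P\<close>])
  have injP: "inj P"
    unfolding linear_injective_0[OF lP] using nP by (metis norm_eq_zero)
  have lQ: "linear Q"
  proof
    show "Q (x + y) = Q x + Q y" for x y by (rule injD[OF injP]) (simp add: PQ linear_add[OF lP])
    show "Q (r *\<^sub>R x) = r *\<^sub>R Q x" for r x by (rule injD[OF injP]) (simp add: PQ linear_cmul[OF lP])
  qed
  have nQ: "norm (Q w) = norm w" for w using nP[of "Q w"] by (simp add: PQ)
  have blP: "bounded_linear P"
    by (rule bounded_linear_intro[of _ 1]) (simp_all add: linear_add[OF lP] linear_cmul[OF lP] nP)
  have blQ: "bounded_linear Q"
    by (rule bounded_linear_intro[of _ 1]) (simp_all add: linear_add[OF lQ] linear_cmul[OF lQ] nQ)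
  have blJ: "bounded_linear J"
    using bounded_linear_compose[OF blN blP] by (simp add: NP)
  have injJ: "inj J"
  proof (rule injI)
    fix u v assume "J u = J v"
    then have "N (P u) = N (P v)" by (simp only: NP)
    then show "u = v" by (rule injD[OF injP, OF injD[OF injN]])
  qed
  \<comment> \<open>Conjugating by the isometry gives the semigroup on \<open>X^\<alpha>\<close>,
    since \<open>T t\<close> commutes with \<open>A^-\<alpha>\<close>. \<open>V t\<close> is
    \<open>T t\<close> with values read in \<open>X^\<alpha>\<close>.\<close>
  define U where "U t v = Q (T t (P v))" for t v
  define V where "V t x = Q (smoothing \<alpha> t x)" for t x
  have JU: "J (U t v) = T t (J v)" if "0 \<le> t" for t v
    using T_neg_frac_power[OF \<alpha> that, of "P v"] by (simp add: U_def PQ N_def flip: NP)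
  have JV: "J (V t x) = T t x" if "0 < t" for t x
    using neg_frac_power_smoothing[OF \<alpha> that, of x] by (simp add: V_def PQ N_def flip: NP)
  obtain C' where C': "\<And>t x. t > 0 \<Longrightarrow> norm (smoothing \<alpha> t x) \<le> C' * t powr (- \<alpha>) * norm x" "C' \<ge> 0"
    using norm_smoothing_le[OF \<alpha>] by blast
  have UC: "norm (U t v) \<le> C * norm v / (1 + t)\<^sup>2" if "0 \<le> t" for t v
    using C(2)[OF that, of "P v"] by (simp add: U_def nQ nP)
  interpret smoothing_pair U V \<alpha> C' C
  proof (rule smoothing_pair.intro)
    fix t :: real and v :: 'b assume t: "0 \<le> t"
    show "bounded_linear (U t)"
      unfolding U_def by (rule bounded_linear_compose[OF blQ bounded_linear_compose[OF bounded_linear_T[OF t] blP]])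
    have "C * norm v / (1 + t)\<^sup>2 \<le> C * norm v / 1"
      using t C(1) by (intro divide_left_mono) (auto intro: one_le_power)
    then show "norm (U t v) \<le> C * norm v" using UC[OF t, of v] by simp
  next
    show "continuous_on {0..} (\<lambda>t. U t v)" for v
      unfolding U_def by (rule bounded_linear.continuous_on[OF blQ continuous_on_T])
  next
    fix t :: real and x :: 'a assume t: "0 < t"
    show "linear (V t)"
      unfolding V_def using linear_compose[OF linear_smoothing[OF \<alpha> t] lQ] by (simp add: o_def)
    show "norm (V t x) \<le> C' * t powr - \<alpha> * norm x" using C'(1)[OF t] by (simp add: V_def nQ)
    show "U h (V t x) = V (t + h) x" if "0 \<le> h" for h
      using T_smoothing[OF \<alpha> t that] by (simp add: U_def V_def PQ)
  qed (use \<alpha> C C' in auto)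
  have S: "continuous_on {0..} (\<lambda>t. S t v)"
    "0 \<le> t \<Longrightarrow> J (S t v) = T t (J v) + integral {0..t} (\<lambda>s. T (t - s) (f (S s v)))" for t v
    using assms(10) unfolding mild_solution_def by auto
  have K: "compact K" "0 \<le> t \<Longrightarrow> S t ` K = K" for t
    using assms(11) unfolding global_attractor_def by auto
  obtain L where L: "L-lipschitz_on K f" using assms(9) compact_imp_bounded[OF K(1)] by blast
  have cf: "continuous_on UNIV f"
    using assms(7) by (meson continuous_at_imp_continuous_on has_derivative_continuous)
  interpret mild_flow U V \<alpha> C' C f f' S K L
  proof
    fix t v assume t: "(0::real) \<le> t"
    have g: "continuous_on {0..t} (\<lambda>s. f (S s v))"
      by (rule continuous_on_compose2[OF cf]) (auto intro: continuous_on_subset[OF S(1)])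
    \<comment> \<open>The mild solution formula holds in \<open>X\<close>. As \<open>J\<close> is
      bounded it passes through the integral, and as it is injective the formula lifts to
      \<open>X^\<alpha>\<close>.\<close>
    have "J (integral {0..t} (\<lambda>s. V (t - s) (f (S s v)))) = integral {0..t} (\<lambda>s. J (V (t - s) (f (S s v))))"
      using integral_linear[OF V_integrable[OF g] blJ, of 0 t] by (simp add: o_def)
    also have "\<dots> = integral {0..t} (\<lambda>s. T (t - s) (f (S s v)))"
      by (rule integral_spike[of "{t}"]) (auto simp: JV)
    finally have "J (S t v) = J (U t v + integral {0..t} (\<lambda>s. V (t - s) (f (S s v))))"
      using S(2)[OF t, of v] by (simp add: linear_add[OF J(1)] JU[OF t])
    then show "S t v = U t v + integral {0..t} (\<lambda>s. V (t - s) (f (S s v)))"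
      by (rule injD[OF injJ])
  qed (use assms(7,8) S(1) K L in auto)
  show ?thesis
  proof (rule upper_box_dim_finite, rule disj_forward[OF assms(12)])
    assume co: "\<forall>t>0. compact_operator (T t)"
    show "\<forall>t>0. compact_operator (U t)"
    proof (intro allI impI)
      fix t :: real assume t: "0 < t"
      show "compact_operator (U t)" unfolding compact_operator_def
      proof (intro conjI allI impI)
        show "bounded_linear (U t)" using t by (intro linear_U) simp
        fix B :: "'b set" assume "bounded B"
        then have "bounded (P ` B)" by (rule bounded_linear_image[OF _ blP])
        then have cpt: "compact (closure (T t ` P ` B))" using co t unfolding compact_operator_def by blast
        have cQ: "compact (Q ` closure (T t ` P ` B))"
          by (rule compact_continuous_image[OF linear_continuous_on[OF blQ] cpt])
        have "U t ` B \<subseteq> Q ` closure (T t ` P ` B)"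
          using closure_subset[of "T t ` P ` B"] by (auto simp: U_def)
        then have "closure (U t ` B) \<subseteq> Q ` closure (T t ` P ` B)"
          by (rule closure_minimal[OF _ compact_imp_closed[OF cQ]])
        then show "compact (closure (U t ` B))"
          using compact_Int_closed[OF cQ closed_closure, of "U t ` B"] by (simp add: Int_absorb1)
      qed
    qed
  next
    assume co: "\<forall>x\<in>K. compact_operator (blinfun_apply (f' x))"
    \<comment> \<open>Chosen so that \<open>32 * C \<le> (1 + \<tau>)^2\<close>, which makes the
      decay bound at time \<open>\<tau>\<close> at most \<open>1 / 32\<close>.\<close>
    define \<tau> where "\<tau> = 32 * C + 1"
    have \<tau>: "0 < \<tau>" using C_nonneg by (simp add: \<tau>_def)
    have "norm (U \<tau> v) \<le> norm v / 32" for v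
    proof -
      have "32 * C \<le> (1 + \<tau>) * 1" by (simp add: \<tau>_def)
      also have "\<dots> \<le> (1 + \<tau>) * (1 + \<tau>)" using \<tau> by (intro mult_left_mono) auto
      finally have "32 * C * norm v \<le> (1 + \<tau>)\<^sup>2 * norm v" by (intro mult_right_mono) (auto simp: power2_eq_square)
      then have "C * norm v / (1 + \<tau>)\<^sup>2 \<le> norm v / 32" using \<tau> by (simp add: divide_le_eq mult_ac)
      with UC[of \<tau> v] \<tau> show ?thesis by (meson less_imp_le order_trans)
    qed
    then show "(\<forall>x\<in>K. compact_operator (blinfun_apply (f' x))) \<and> (\<exists>\<tau>>0. \<forall>v. norm (U \<tau> v) \<le> norm v / 32)"
      using co \<tau> by blast
  qed
qed

end
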